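(* Let $\alpha_*$ be the optimal rate for boundary control of the Schrödinger equation on a segment (defined in the context) and let $\alpha^{*}=4\left(\frac{36}{37}\right)^{2}$. Then $$\frac14\ \leq\ \alpha_{*}\ \leq\ \alpha^{*}\ <\ 4 .$$
   Context: For $L>0$ let $H^{1}_{1}(0,L)=\{f\in H^{1}(0,L)\mid f(L)=0\}$ and $H^{1}_{0}(0,L)=\{f\in H^{1}_{1}(0,L)\mid f(0)=0\}$. Definition of $\alpha_*$: it is the smallest positive constant such that the following property holds: for all $\alpha>\alpha_{*}$ there exists $C>0$ such that, for all $k\in\{0,1\}$, $L>0$, $T\in\,]0,\min(\pi,L)^{2}]$ and $u_{0}\in H^{1}_{k}(0,L)$, the solution $u\in C^{0}([0,\infty);H^{1}_{k}(0,L))$ of $$i\partial_{t}u-\partial_{s}^{2}u=0\ \text{ in }]0,T[\times]0,L[,\qquad \partial_{s}^{k}u|_{s=0}=0=u|_{s=L},\qquad u|_{t=0}=u_{0},$$ satisfies $$\|u_{0}\|_{H^{1}}\leq C\exp(\alpha L^{2}/T)\,\|\partial_{s}u|_{s=L}\|_{L^{2}(0,T)} .$$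
   Formalization: In the definition of α_*, C may depend on a positive lower bound L₀ for L (for every L₀>0 there is C valid for all L≥L₀): with one C for all L>0 no α qualifies, since for the first Dirichlet mode with T=L² the H¹ norm blows up as L→0 while the trace norm stays π. *)

theory Defs
  imports "HOL-Analysis.Analysis"
begin

definition L2 :: "real \<Rightarrow> (real \<Rightarrow> complex) \<Rightarrow> bool" where
  "L2 L f \<longleftrightarrow> set_borel_measurable lborel {0..L} f \<and>
     set_integrable lborel {0..L} (\<lambda>x. (norm (f x))\<^sup>2)"

definition L2_inner :: "real \<Rightarrow> (real \<Rightarrow> complex) \<Rightarrow> (real \<Rightarrow> complex) \<Rightarrow> complex" where
  "L2_inner L f g = (LINT x:{0..L}|lborel. f x * cnj (g x))"

definition L2_norm :: "real \<Rightarrow> (real \<Rightarrow> complex) \<Rightarrow> real" where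
  "L2_norm L f = sqrt (LINT x:{0..L}|lborel. (norm (f x))\<^sup>2)"

text \<open>
  In one dimension the elements of \<open>H\<^sup>1(0,L)\<close> are identified with their continuous
  representatives on \<open>[0,L]\<close>, i.e. with the absolutely continuous functions whose
  derivative \<open>g\<close> is square integrable.  Values outside \<open>[0,L]\<close> are irrelevant.
\<close>

definition has_weak_deriv :: "real \<Rightarrow> (real \<Rightarrow> complex) \<Rightarrow> (real \<Rightarrow> complex) \<Rightarrow> bool" where
  "has_weak_deriv L f g \<longleftrightarrow> L2 L g \<and>
     (\<forall>x\<in>{0..L}. f x = f 0 + (LINT y:{0..x}|lborel. g y))"

definition H1 :: "real \<Rightarrow> (real \<Rightarrow> complex) set" where
  "H1 L = {f. \<exists>g. has_weak_deriv L f g}"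

text \<open>The weak derivative is unique only almost everywhere; it is used only under integrals.\<close>

definition weak_deriv :: "real \<Rightarrow> (real \<Rightarrow> complex) \<Rightarrow> real \<Rightarrow> complex" where
  "weak_deriv L f = (SOME g. has_weak_deriv L f g)"

definition H1_norm :: "real \<Rightarrow> (real \<Rightarrow> complex) \<Rightarrow> real" where
  "H1_norm L f = sqrt ((L2_norm L f)\<^sup>2 + (L2_norm L (weak_deriv L f))\<^sup>2)"

text \<open>\<open>H\<^sup>1\<^sub>k(0,L)\<close>, used for \<open>k = 0, 1\<close>.\<close>

definition H1k :: "nat \<Rightarrow> real \<Rightarrow> (real \<Rightarrow> complex) set" where
  "H1k k L = {f \<in> H1 L. f L = 0 \<and> (k = 0 \<longrightarrow> f 0 = 0)}"

text \<open>
  \<open>u t s\<close> is the value at time \<open>t\<close> and position \<open>s\<close>.  For data in \<open>H\<^sup>1\<^sub>k\<close> the equation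
  \<open>i \<partial>\<^sub>t u - \<partial>\<^sub>s\<^sup>2 u = 0\<close> on \<open>(0,T) \<times> (0,L)\<close> is understood in the usual variational sense,
  \<open>i (d/dt) \<langle>u, v\<rangle> + \<langle>\<partial>\<^sub>s u, \<partial>\<^sub>s v\<rangle> = 0\<close> for all \<open>v \<in> H\<^sup>1\<^sub>k\<close>.
  The Dirichlet conditions are part of membership in \<open>H\<^sup>1\<^sub>k\<close>; for \<open>k = 1\<close> the Neumann
  condition at \<open>s = 0\<close> is the natural boundary condition, since \<open>v 0\<close> is then arbitrary.
\<close>

definition schrodinger_solution ::
    "nat \<Rightarrow> real \<Rightarrow> real \<Rightarrow> (real \<Rightarrow> complex) \<Rightarrow> (real \<Rightarrow> real \<Rightarrow> complex) \<Rightarrow> bool" where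
  "schrodinger_solution k L T u0 u \<longleftrightarrow>
     (\<forall>t\<ge>0. u t \<in> H1k k L) \<and>
     (\<forall>t\<ge>0. ((\<lambda>\<tau>. H1_norm L (\<lambda>s. u \<tau> s - u t s)) \<longlongrightarrow> 0) (at t within {0..})) \<and>
     (\<forall>s\<in>{0..L}. u 0 s = u0 s) \<and>
     (\<forall>v\<in>H1k k L. \<forall>t\<in>{0<..<T}.
        \<exists>D. ((\<lambda>\<tau>. L2_inner L (u \<tau>) v) has_vector_derivative D) (at t) \<and>
            \<i> * D + L2_inner L (weak_deriv L (u t)) (weak_deriv L v) = 0)"

text \<open>
  \<open>g\<close> is the trace \<open>\<partial>\<^sub>s u|\<^sub>s\<^sub>=\<^sub>L \<in> L\<^sup>2(0,T)\<close>.  As \<open>u t\<close> is only in \<open>H\<^sup>1\<close>, the trace is taken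
  in the sense of Green's formula: for test functions with \<open>v 0 = 0\<close> but \<open>v L\<close> arbitrary,
  \<open>i (d/dt) \<langle>u, v\<rangle> + \<langle>\<partial>\<^sub>s u, \<partial>\<^sub>s v\<rangle> = g(t) cnj (v L)\<close>, here integrated in time.
  This determines \<open>g\<close> up to null sets and agrees with the classical derivative at \<open>s = L\<close>
  when \<open>u\<close> is regular.
\<close>

definition neumann_trace ::
    "real \<Rightarrow> real \<Rightarrow> (real \<Rightarrow> real \<Rightarrow> complex) \<Rightarrow> (real \<Rightarrow> complex) \<Rightarrow> bool" where
  "neumann_trace L T u g \<longleftrightarrow> L2 T g \<and>
     (\<forall>v\<in>H1 L. v 0 = 0 \<longrightarrow> (\<forall>t\<in>{0..T}.
        \<i> * (L2_inner L (u t) v - L2_inner L (u 0) v)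
          + (LINT \<tau>:{0..t}|lborel. L2_inner L (weak_deriv L (u \<tau>)) (weak_deriv L v))
        = (LINT \<tau>:{0..t}|lborel. g \<tau>) * cnj (v L)))"

definition observability_estimate :: "real \<Rightarrow> real \<Rightarrow> nat \<Rightarrow> real \<Rightarrow> real \<Rightarrow> bool" where
  "observability_estimate \<alpha> C k L T \<longleftrightarrow>
     (\<forall>u0\<in>H1k k L. \<forall>u g. schrodinger_solution k L T u0 u \<longrightarrow> neumann_trace L T u g \<longrightarrow>
        H1_norm L u0 \<le> C * exp (\<alpha> * L\<^sup>2 / T) * L2_norm T g)"

text \<open>
  \<open>C\<close> is uniform in \<open>k\<close>, \<open>T\<close>, \<open>u0\<close> and in \<open>L\<close> ranging over \<open>[L\<^sub>0, \<infinity>)\<close>, for every \<open>L\<^sub>0 > 0\<close>.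
  The condition with a single \<open>C\<close> for all \<open>L > 0\<close> holds for no \<open>\<alpha>\<close> at all, because the two
  norms scale differently as \<open>L\<close> tends to \<open>0\<close>; this is proved below as
  \<open>no_constant_uniform_for_small_L\<close>.
\<close>

definition observable_beyond :: "real \<Rightarrow> bool" where
  "observable_beyond a \<longleftrightarrow>
     (\<forall>\<alpha>>a. \<forall>L0>0. \<exists>C>0. \<forall>k\<in>{0,1}. \<forall>L\<ge>L0. \<forall>T. 0 < T \<and> T \<le> (min pi L)\<^sup>2 \<longrightarrow>
        observability_estimate \<alpha> C k L T)"

definition alpha_star :: real where
  "alpha_star = (LEAST a. 0 < a \<and> observable_beyond a)"

text \<open>
  The fundamental Dirichlet mode \<open>exp(i \<omega>\<^sup>2 t) sin(\<omega> s)\<close>, \<open>\<omega> = \<pi>/L\<close>, at time \<open>T = L\<^sup>2\<close> has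
  \<open>H\<^sup>1\<close> norm at least \<open>\<pi> / sqrt (2 L)\<close> and trace norm \<open>\<pi>\<close>, while \<open>L\<^sup>2/T = 1\<close>.  Hence no
  exponent \<open>\<alpha>\<close> admits a constant valid for all \<open>L > 0\<close> at once.
\<close>

lemma L2_set_integrable:
  assumes "L2 L g"
  shows "set_integrable lborel {0..L} g"
proof -
  have "set_integrable lborel {0..L} (\<lambda>x. 1 + (norm (g x))\<^sup>2 :: real)"
    using assms unfolding L2_def
    by (intro set_integral_add) (auto intro: borel_integrable_atLeastAtMost')
  moreover have "norm (g x) \<le> norm (1 + (norm (g x))\<^sup>2 :: real)" for x
    by (smt (verit, best) norm_ge_zero power2_eq_square mult_left_le_one_le real_norm_def
        mult_le_cancel_left1 self_le_power zero_le_power2 pos2 not_sum_power2_lt_zero)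
  ultimately show ?thesis
    using assms unfolding L2_def set_integrable_def set_borel_measurable_def
    by (elim Bochner_Integration.integrable_bound)
       (auto simp: indicator_def intro!: AE_I2)
qed

lemma L2_continuous:
  assumes "continuous_on {0..L} g"
  shows "L2 L g"
  unfolding L2_def
proof
  show "set_borel_measurable lborel {0..L} g"
    using borel_integrable_atLeastAtMost'[OF assms]
    unfolding set_integrable_def set_borel_measurable_def by auto
  show "set_integrable lborel {0..L} (\<lambda>x. (cmod (g x))\<^sup>2)"
    using assms by (intro borel_integrable_atLeastAtMost' continuous_intros)
qed

lemma AE_zero_of_integrals:
  fixes d :: "real \<Rightarrow> complex"
  assumes d: "integrable lborel d" and z: "\<And>x. (LINT y:{..x}|lborel. d y) = 0"
  shows "AE x in lborel. d x = 0"
proof -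
  have si: "set_integrable lborel A d" if "A \<in> sets borel" for A
    using d that unfolding set_integrable_def
    by (intro integrable_mult_indicator) auto
  have I: "d integrable_on cbox a b" "integral (cbox a b) d = 0" for a b
  proof -
    show "d integrable_on cbox a b"
      using set_borel_integral_eq_integral(1)[OF si[of "{a..b}"]] by simp
    have "integral (cbox a b) d = 0" if "a \<le> b"
    proof -
      have "integral {a..b} d = (LINT y:{a..b}|lborel. d y)"
        using set_borel_integral_eq_integral(2)[OF si[of "{a..b}"]] by simp
      also have "\<dots> = (LINT y:{a<..b}|lborel. d y)"
        unfolding set_lebesgue_integral_def
      proof (rule integral_cong_AE)
        show "AE y in lborel. indicator {a..b} y *\<^sub>R d y = indicator {a<..b} y *\<^sub>R d y"
          using AE_lborel_singleton[of a] by eventually_elim (auto simp: indicator_def)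
      qed (use si in \<open>auto simp: set_integrable_def\<close>)
      also have "\<dots> = 0"
        using set_integral_Un[of "{..a}" "{a<..b}" lborel d] z[of a] z[of b] that si
        by (simp add: ivl_disj_int ivl_disj_un)
      finally show ?thesis by simp
    qed
    then show "integral (cbox a b) d = 0" by (cases "a \<le> b") auto
  qed
  obtain N where N: "negligible N"
       "\<And>x e. \<lbrakk>x \<notin> N; 0 < e\<rbrakk> \<Longrightarrow>
               \<exists>h0>0. \<forall>h. 0 < h \<and> h < h0 \<longrightarrow>
                         norm(integral (cbox x (x + h *\<^sub>R One)) d /\<^sub>R h ^ DIM(real) - d x) < e"
    by (rule integrable_ccontinuous_explicit[OF I(1)]) blast
  have "d x = 0" if out: "x \<notin> N" for x
  proof (rule ccontr)
    assume "d x \<noteq> 0"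
    then obtain h0 where h: "h0 > 0" "\<And>h. 0 < h \<Longrightarrow> h < h0 \<Longrightarrow>
        norm(integral (cbox x (x + h *\<^sub>R One)) d /\<^sub>R h ^ DIM(real) - d x) < norm (d x)"
      using N(2)[OF out, of "norm (d x)"] by auto
    show False using h(2)[of "h0/2"] h(1) I(2) by auto
  qed
  then have "{x. d x \<noteq> 0} \<subseteq> N" by auto
  then have "negligible {x. d x \<noteq> 0}" using N(1) negligible_subset by blast
  then have "{x. d x \<noteq> 0} \<in> null_sets lebesgue" by (simp add: negligible_iff_null_sets)
  then have "AE x in lebesgue. d x = 0" by (auto dest: AE_not_in)
  then show ?thesis using d
    by (subst (asm) AE_completion_iff) auto
qed

lemma has_weak_deriv_L2: "has_weak_deriv L f g \<Longrightarrow> L2 L g"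
  unfolding has_weak_deriv_def by blast

lemma has_weak_deriv_integral:
  "has_weak_deriv L f g \<Longrightarrow> x \<in> {0..L} \<Longrightarrow> (LINT y:{0..x}|lborel. g y) = f x - f 0"
  unfolding has_weak_deriv_def by (metis add_diff_cancel_left')

lemma weak_deriv_AE:
  assumes "has_weak_deriv L f g"
  shows "AE x in lborel. x \<in> {0..L} \<longrightarrow> weak_deriv L f x = g x"
    and "has_weak_deriv L f (weak_deriv L f)"
proof -
  let ?h = "weak_deriv L f"
  show h: "has_weak_deriv L f ?h"
    unfolding weak_deriv_def using assms by (rule someI[of "has_weak_deriv L f"])
  have ig: "set_integrable lborel {0..L} g" and ih: "set_integrable lborel {0..L} ?h"
    using assms h by (blast intro: L2_set_integrable has_weak_deriv_L2)+
  let ?d = "\<lambda>x. indicator {0..L} x *\<^sub>R (?h x - g x)"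
  have "AE x in lborel. ?d x = 0"
  proof (rule AE_zero_of_integrals)
    show "integrable lborel ?d"
      using set_integral_diff(1)[OF ih ig] by (simp add: set_integrable_def)
    fix x
    show "(LINT y:{..x}|lborel. ?d y) = 0"
    proof (cases "0 \<le> x \<and> 0 \<le> L")
      case True
      define m where "m = min x L"
      have m: "m \<in> {0..L}" using True by (auto simp: m_def)
      have "(LINT y:{..x}|lborel. ?d y) = (LINT y:{0..m}|lborel. ?h y - g y)"
        unfolding set_lebesgue_integral_def
        by (intro Bochner_Integration.integral_cong) (auto simp: indicator_def m_def)
      also have "\<dots> = (LINT y:{0..m}|lborel. ?h y) - (LINT y:{0..m}|lborel. g y)"
        using m by (intro set_integral_diff set_integrable_subset[OF ih] set_integrable_subset[OF ig]) auto
      also have "\<dots> = 0"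
        by (simp add: has_weak_deriv_integral[OF assms m] has_weak_deriv_integral[OF h m])
      finally show ?thesis .
    next
      case False
      then have "(\<lambda>y. indicator {..x} y *\<^sub>R ?d y) = (\<lambda>_. 0)" 
        by (auto simp: indicator_def fun_eq_iff)
      then show ?thesis by (simp add: set_lebesgue_integral_def)
    qed
  qed
  then show "AE x in lborel. x \<in> {0..L} \<longrightarrow> ?h x = g x"
    by eventually_elim auto
qed

lemma has_weak_deriv_C1:
  assumes "\<And>x. (f has_vector_derivative f' x) (at x)" "continuous_on UNIV f'"
  shows "has_weak_deriv L f f'"
  unfolding has_weak_deriv_def
proof (intro conjI ballI)
  have c: "continuous_on A f'" for A using assms(2) continuous_on_subset by blast
  show "L2 L f'" by (rule L2_continuous[OF c])
  fix x assume "x \<in> {0..L}"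
  then have "(f' has_integral (f x - f 0)) {0..x}"
    by (intro fundamental_theorem_of_calculus)
       (auto intro: has_vector_derivative_at_within assms)
  then show "f x = f 0 + (LINT y:{0..x}|lborel. f' y)"
    using set_borel_integral_eq_integral(2)[OF borel_integrable_atLeastAtMost'[OF c, of 0 x]]
    by (simp add: integral_unique)
qed

lemma weak_by_parts:
  fixes p p' :: "real \<Rightarrow> complex"
  assumes v: "has_weak_deriv L v g" and L: "L \<ge> 0"
    and p: "\<And>x. (p has_vector_derivative p' x) (at x)" and p': "continuous_on UNIV p'"
  shows "L2_inner L p' v = p L * cnj (v L) - p 0 * cnj (v 0) - L2_inner L p g"
proof -
  have g: "set_integrable lborel {0..L} g" using v by (blast intro: L2_set_integrable has_weak_deriv_L2)
  have c: "continuous_on A p'" for A using p' continuous_on_subset by blast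
  have cp: "continuous_on A p" for A
    by (meson p continuous_at_imp_continuous_on has_vector_derivative_continuous)
  have ftc: "(LINT x:{a..b}|lborel. p' x) = p b - p a" if "a \<le> b" for a b
  proof -
    have "(p' has_integral (p b - p a)) {a..b}"
      using that by (intro fundamental_theorem_of_calculus)
         (auto intro: has_vector_derivative_at_within p)
    then show ?thesis
      using set_borel_integral_eq_integral(2)[OF borel_integrable_atLeastAtMost'[OF c, of a b]]
      by (simp add: integral_unique)
  qed
  define a where "a x = indicator {0..L} x *\<^sub>R p' x" for x
  define b where "b y = indicator {0..L} y *\<^sub>R cnj (g y)" for y
  have ia: "integrable lborel a"
    using borel_integrable_atLeastAtMost'[OF c, of 0 L] by (simp add: a_def[abs_def] set_integrable_def)
  have ib: "integrable lborel b"
    using integrable_cnj[of lborel "\<lambda>y. indicator {0..L} y *\<^sub>R g y"] g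
    by (simp add: b_def[abs_def] set_integrable_def)
  have [measurable]: "a \<in> borel_measurable borel" "b \<in> borel_measurable borel"
    using ia ib by auto
  define K where "K x y = (if y \<le> x then a x * b y else 0)" for x y
  have "integrable (lborel \<Otimes>\<^sub>M lborel) (\<lambda>(x,y). a x * b y)"
    using ia ib by (intro lborel_pair.Fubini_integrable) (auto simp: norm_mult)
  then have iK: "integrable (lborel \<Otimes>\<^sub>M lborel) (case_prod K)"
  proof (rule Bochner_Integration.integrable_bound)
    show "case_prod K \<in> borel_measurable (lborel \<Otimes>\<^sub>M lborel)"
      unfolding K_def by measurable
  qed (auto simp: K_def intro!: AE_I2)
  have 1: "(\<integral>y. K x y \<partial>lborel) = indicator {0..L} x *\<^sub>R (p' x * cnj (v x) - p' x * cnj (v 0))" for x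
  proof (cases "x \<in> {0..L}")
    case True
    have "(\<integral>y. K x y \<partial>lborel) = (\<integral>y. p' x * cnj (indicator {0..x} y *\<^sub>R g y) \<partial>lborel)"
      using True by (intro Bochner_Integration.integral_cong) (auto simp: K_def a_def b_def indicator_def)
    also have "\<dots> = p' x * cnj (LINT y:{0..x}|lborel. g y)"
      unfolding set_lebesgue_integral_def integral_mult_right_zero Bochner_Integration.integral_cnj ..
    also have "(LINT y:{0..x}|lborel. g y) = v x - v 0"
      using has_weak_deriv_integral[OF v True] .
    finally show ?thesis using True by (simp add: algebra_simps)
  next
    case False
    then have "a x = 0" by (simp add: a_def)
    then show ?thesis using False by (simp add: K_def cong: if_cong)
  qed
  have 2: "(\<integral>x. K x y \<partial>lborel) = indicator {0..L} y *\<^sub>R (p L * cnj (g y) - p y * cnj (g y))" for y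
  proof (cases "y \<in> {0..L}")
    case True
    have "(\<integral>x. K x y \<partial>lborel) = (\<integral>x. (indicator {y..L} x *\<^sub>R p' x) * cnj (g y) \<partial>lborel)"
      using True by (intro Bochner_Integration.integral_cong) (auto simp: K_def a_def b_def indicator_def)
    also have "\<dots> = (LINT x:{y..L}|lborel. p' x) * cnj (g y)"
      by (simp only: set_lebesgue_integral_def integral_mult_left_zero)
    finally show ?thesis using True by (simp add: ftc algebra_simps)
  next
    case False
    then have "b y = 0" by (simp add: b_def)
    then show ?thesis using False by (simp add: K_def cong: if_cong)
  qed
  have eq: "(LINT x:{0..L}|lborel. p' x * cnj (v x) - p' x * cnj (v 0))
     = (LINT y:{0..L}|lborel. p L * cnj (g y) - p y * cnj (g y))"
    using lborel_pair.Fubini_integral[OF iK] by (simp add: 1 2 set_lebesgue_integral_def)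
  have cv: "continuous_on {0..L} v"
  proof -
    have "continuous_on {0..L} (\<lambda>x. v 0 + integral {0..x} g)"
      using set_borel_integral_eq_integral(1)[OF g]
      by (intro continuous_intros indefinite_integral_continuous_1)
    moreover have "v x = v 0 + integral {0..x} g" if "x \<in> {0..L}" for x
      using has_weak_deriv_integral[OF v that] that
        set_borel_integral_eq_integral(2)[OF set_integrable_subset[OF g, of "{0..x}"]]
      by (auto simp: diff_eq_eq add.commute)
    ultimately show ?thesis by (metis (no_types, lifting) continuous_on_cong)
  qed
  have "(LINT x:{0..L}|lborel. p' x * cnj (v x) - p' x * cnj (v 0))
     = L2_inner L p' v - (LINT x:{0..L}|lborel. p' x * cnj (v 0))"
    unfolding L2_inner_def
    by (intro set_integral_diff borel_integrable_atLeastAtMost' continuous_intros c cv)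
  also have "(LINT x:{0..L}|lborel. p' x * cnj (v 0)) = (p L - p 0) * cnj (v 0)"
    by (simp add: ftc L)
  finally have l: "(LINT x:{0..L}|lborel. p' x * cnj (v x) - p' x * cnj (v 0))
     = L2_inner L p' v - (p L - p 0) * cnj (v 0)" .
  have ig: "set_integrable lborel {0..L} (\<lambda>y. cnj (g y))"
    using ib by (simp add: b_def[abs_def] set_integrable_def)
  have ipg: "set_integrable lborel {0..L} (\<lambda>y. p y * cnj (g y))"
  proof -
    obtain B where B: "\<And>y. y \<in> {0..L} \<Longrightarrow> norm (p y) \<le> B"
      using compact_imp_bounded[OF compact_continuous_image[OF cp compact_Icc], of 0 L]
      unfolding bounded_iff by blast
    have "p \<in> borel_measurable borel" using cp by (rule borel_measurable_continuous_onI)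
    then have "(\<lambda>y. p y * b y) \<in> borel_measurable lborel" by measurable
    moreover have "(\<lambda>y. p y * b y) = (\<lambda>y. indicator {0..L} y *\<^sub>R (p y * cnj (g y)))"
      by (auto simp: b_def)
    moreover have "integrable lborel (\<lambda>y. p y * b y)"
    proof (rule Bochner_Integration.integrable_bound)
      show "integrable lborel (\<lambda>y. of_real B * b y)" using ib by simp
      show "AE y in lborel. norm (p y * b y) \<le> norm (of_real B * b y)"
        by (intro AE_I2) (use B in \<open>force simp: b_def norm_mult indicator_def intro!: mult_right_mono\<close>)
    qed fact
    ultimately show ?thesis by (simp add: set_integrable_def)
  qed
  have "(LINT y:{0..L}|lborel. p L * cnj (g y) - p y * cnj (g y))
     = (LINT y:{0..L}|lborel. p L * cnj (g y)) - L2_inner L p g"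
    unfolding L2_inner_def using ig ipg by (intro set_integral_diff) auto
  also have "(LINT y:{0..L}|lborel. p L * cnj (g y)) = p L * cnj (LINT y:{0..L}|lborel. g y)"
    by (simp add: set_lebesgue_integral_def flip: Bochner_Integration.integral_cnj complex_cnj_scaleR)
  also have "(LINT y:{0..L}|lborel. g y) = v L - v 0"
    using has_weak_deriv_integral[OF v, of L] L by simp
  finally have r: "(LINT y:{0..L}|lborel. p L * cnj (g y) - p y * cnj (g y))
     = p L * cnj (v L - v 0) - L2_inner L p g" .
  show ?thesis using eq l r by (simp add: algebra_simps)
qed


lemma L2_inner_cong_AE:
  assumes "L2 L f" "L2 L f'" "AE x in lborel. x \<in> {0..L} \<longrightarrow> f x = f' x"
    and "L2 L g" "L2 L g'" "AE x in lborel. x \<in> {0..L} \<longrightarrow> g x = g' x"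
  shows "L2_inner L f g = L2_inner L f' g'"
proof -
  have m: "(\<lambda>x. indicator {0..L} x *\<^sub>R (f x * cnj (g x))) \<in> borel_measurable lborel" 
    if "L2 L f" "L2 L g" for f g :: "real \<Rightarrow> complex"
  proof -
    have [measurable]: "(\<lambda>x. indicator {0..L} x *\<^sub>R f x) \<in> borel_measurable borel"
      "(\<lambda>x. indicator {0..L} x *\<^sub>R g x) \<in> borel_measurable borel"
      using that by (auto simp: L2_def set_borel_measurable_def)
    have "(\<lambda>x. (indicator {0..L} x *\<^sub>R f x) * cnj (indicator {0..L} x *\<^sub>R g x)) \<in> borel_measurable borel"
      by (intro borel_measurable_times measurable_compose[OF _ borel_measurable_continuous_onI[of cnj]]
          continuous_intros) fact+
    also have "(\<lambda>x. (indicator {0..L} x *\<^sub>R f x) * cnj (indicator {0..L} x *\<^sub>R g x))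
        = (\<lambda>x. indicator {0..L} x *\<^sub>R (f x * cnj (g x)))"
      by (auto simp: indicator_def)
    finally show ?thesis by simp
  qed
  show ?thesis
    unfolding L2_inner_def set_lebesgue_integral_def
  proof (rule integral_cong_AE)
    show "AE x in lborel. indicator {0..L} x *\<^sub>R (f x * cnj (g x)) = indicator {0..L} x *\<^sub>R (f' x * cnj (g' x))"
      using assms(3,6) by eventually_elim (auto simp: indicator_def)
  qed (use m assms in auto)
qed

lemma L2_norm_eq_inner: "L2_norm L f = sqrt (Re (L2_inner L f f))"
proof -
  have "L2_inner L f f = (LINT x:{0..L}|lborel. of_real ((norm (f x))\<^sup>2))"
    unfolding L2_inner_def complex_norm_square ..
  also have "\<dots> = of_real (LINT x:{0..L}|lborel. (norm (f x))\<^sup>2)"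
    unfolding set_lebesgue_integral_def integral_complex_of_real[symmetric]
    by (simp add: scaleR_conv_of_real)
  finally show ?thesis by (simp add: L2_norm_def)
qed

lemma L2_inner_smult: "L2_inner L (\<lambda>x. c * f x) g = c * L2_inner L f g"
  by (simp add: L2_inner_def mult.assoc set_lebesgue_integral_def flip: mult_scaleR_right)

lemma L2_norm_smult: "L2_norm L (\<lambda>x. c * f x) = norm c * L2_norm L f"
  by (simp add: L2_norm_def norm_mult power_mult_distrib real_sqrt_mult)

context
  fixes L :: real
  assumes L: "0 < L"
begin

definition mode_freq :: real where "mode_freq = pi / L"
definition mode_fun :: "real \<Rightarrow> complex" where "mode_fun s = complex_of_real (sin (mode_freq * s))"
definition mode_fun_deriv :: "real \<Rightarrow> complex" where "mode_fun_deriv s = complex_of_real (mode_freq * cos (mode_freq * s))"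
definition mode_sol :: "real \<Rightarrow> real \<Rightarrow> complex" where "mode_sol t s = cis (mode_freq\<^sup>2 * t) * mode_fun s"

lemma mode_deriv: "has_weak_deriv L (\<lambda>s. c * mode_fun s) (\<lambda>s. c * mode_fun_deriv s)"
proof (rule has_weak_deriv_C1)
  show "((\<lambda>s. c * mode_fun s) has_vector_derivative c * mode_fun_deriv x) (at x)" for x
    unfolding mode_fun_def mode_fun_deriv_def has_real_derivative_iff_has_vector_derivative[symmetric]
    by (intro derivative_eq_intros has_vector_derivative_mult_right has_vector_derivative_of_real)
       (auto intro!: derivative_eq_intros simp flip: has_real_derivative_iff_has_vector_derivative)
  show "continuous_on UNIV (\<lambda>s. c * mode_fun_deriv s)"
    unfolding mode_fun_deriv_def by (intro continuous_intros)
qed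

lemma mode_deriv_AE:
  "AE x in lborel. x \<in> {0..L} \<longrightarrow> weak_deriv L (\<lambda>s. c * mode_fun s) x = c * mode_fun_deriv x"
  and mode_L2: "L2 L (\<lambda>s. c * mode_fun_deriv s)" "L2 L (weak_deriv L (\<lambda>s. c * mode_fun s))"
  using weak_deriv_AE[OF mode_deriv[of c]] mode_deriv[of c] has_weak_deriv_L2 by blast+

lemma mode_H1_norm: "H1_norm L (\<lambda>s. c * mode_fun s) = norm c * sqrt ((L2_norm L mode_fun)\<^sup>2 + (L2_norm L mode_fun_deriv)\<^sup>2)"
proof -
  have "L2_norm L (weak_deriv L (\<lambda>s. c * mode_fun s)) = L2_norm L (\<lambda>s. c * mode_fun_deriv s)"
    unfolding L2_norm_eq_inner
    by (simp add: L2_inner_cong_AE[OF mode_L2(2,1) mode_deriv_AE mode_L2(2,1) mode_deriv_AE])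
  then show ?thesis
    by (simp add: H1_norm_def L2_norm_smult power_mult_distrib real_sqrt_mult flip: distrib_left)
qed

lemma mode_H1k: "mode_sol t \<in> H1k 0 L"
  using mode_deriv[of "cis (mode_freq\<^sup>2 * t)"] L
  by (auto simp: H1k_def H1_def mode_sol_def[abs_def]) (auto simp: mode_fun_def mode_freq_def)

lemma mode_inner_deriv:
  assumes "v \<in> H1 L" "v 0 = 0"
  shows "L2_inner L (weak_deriv L (mode_sol t)) (weak_deriv L v)
    = cis (mode_freq\<^sup>2 * t) * mode_freq * (mode_freq * L2_inner L mode_fun v - cnj (v L))"
proof -
  obtain g where g: "has_weak_deriv L v g" using assms by (auto simp: H1_def)
  note g' = weak_deriv_AE[OF g]
  have g2: "L2 L (weak_deriv L v)" using g'(2) has_weak_deriv_L2 by blast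
  have "L2_inner L (\<lambda>s. - mode_freq * mode_fun s) v = 
     complex_of_real (cos (mode_freq * L)) * cnj (v L) - complex_of_real (cos (mode_freq * 0)) * cnj (v 0)
      - L2_inner L (\<lambda>s. complex_of_real (cos (mode_freq * s))) (weak_deriv L v)"
  proof (rule weak_by_parts[OF g'(2)])
    show "((\<lambda>s. complex_of_real (cos (mode_freq * s))) has_vector_derivative - mode_freq * mode_fun x) (at x)" for x
      unfolding mode_fun_def of_real_minus[symmetric] of_real_mult[symmetric]
      by (intro has_vector_derivative_of_real)
         (auto intro!: derivative_eq_intros simp flip: has_real_derivative_iff_has_vector_derivative)
    show "continuous_on UNIV (\<lambda>s. - mode_freq * mode_fun s)" unfolding mode_fun_def by (intro continuous_intros)
  qed (use L in auto)
  moreover have "cos (mode_freq * L) = -1" using L by (simp add: mode_freq_def)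
  moreover have "L2_inner L (\<lambda>s. - mode_freq * mode_fun s) v = - mode_freq * L2_inner L mode_fun v" 
    by (rule L2_inner_smult)
  ultimately have c: "L2_inner L (\<lambda>s. complex_of_real (cos (mode_freq * s))) (weak_deriv L v)
      = mode_freq * L2_inner L mode_fun v - cnj (v L)" 
    using assms by (simp add: algebra_simps)
  have "L2_inner L (weak_deriv L (mode_sol t)) (weak_deriv L v)
      = L2_inner L (\<lambda>s. cis (mode_freq\<^sup>2 * t) * mode_fun_deriv s) (weak_deriv L v)"
    unfolding mode_sol_def by (intro L2_inner_cong_AE mode_L2 mode_deriv_AE g2) auto
  also have "(\<lambda>s. cis (mode_freq\<^sup>2 * t) * mode_fun_deriv s) = (\<lambda>s. (cis (mode_freq\<^sup>2 * t) * mode_freq) * complex_of_real (cos (mode_freq * s)))"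
    by (simp add: mode_fun_deriv_def mult.assoc)
  finally show ?thesis by (simp only: L2_inner_smult c)
qed

lemma cis_deriv: "((\<lambda>t. cis (mode_freq\<^sup>2 * t)) has_vector_derivative (\<i> * mode_freq\<^sup>2 * cis (mode_freq\<^sup>2 * t))) (at t within A)"
proof -
  have "((\<lambda>t. exp (\<i> * mode_freq\<^sup>2 * of_real t)) has_vector_derivative (\<i> * mode_freq\<^sup>2 * exp (\<i> * mode_freq\<^sup>2 * of_real t)))
      (at t within A)"
    by (rule has_vector_derivative_real_field) (auto intro!: derivative_eq_intros)
  then show ?thesis by (simp add: cis_conv_exp mult.assoc)
qed

lemma mode_solution: "schrodinger_solution 0 L T (mode_sol 0) mode_sol"
  unfolding schrodinger_solution_def
proof (intro conjI allI ballI impI)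
  fix t :: real assume "t \<ge> 0"
  have "(\<lambda>s. mode_sol \<tau> s - mode_sol t s) = (\<lambda>s. (cis (mode_freq\<^sup>2 * \<tau>) - cis (mode_freq\<^sup>2 * t)) * mode_fun s)" for \<tau>
    by (simp add: mode_sol_def algebra_simps)
  then have "(\<lambda>\<tau>. H1_norm L (\<lambda>s. mode_sol \<tau> s - mode_sol t s)) = (\<lambda>\<tau>. norm (cis (mode_freq\<^sup>2 * \<tau>) - cis (mode_freq\<^sup>2 * t)) *
        sqrt ((L2_norm L mode_fun)\<^sup>2 + (L2_norm L mode_fun_deriv)\<^sup>2))"
    by (simp add: mode_H1_norm)
  moreover have "((\<lambda>\<tau>. cis (mode_freq\<^sup>2 * \<tau>)) \<longlongrightarrow> cis (mode_freq\<^sup>2 * t)) (at t within {0..})"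
    using has_vector_derivative_continuous[OF cis_deriv[of t "{0..}"]] by (simp add: continuous_within)
  then have "((\<lambda>\<tau>. norm (cis (mode_freq\<^sup>2 * \<tau>) - cis (mode_freq\<^sup>2 * t)) *
        sqrt ((L2_norm L mode_fun)\<^sup>2 + (L2_norm L mode_fun_deriv)\<^sup>2)) \<longlongrightarrow> 0) (at t within {0..})"
    by (intro tendsto_mult_left_zero tendsto_norm_zero) (simp add: LIM_zero)
  ultimately show "((\<lambda>\<tau>. H1_norm L (\<lambda>s. mode_sol \<tau> s - mode_sol t s)) \<longlongrightarrow> 0) (at t within {0..})" by simp
next
  fix v t assume v: "v \<in> H1k 0 L" and t: "t \<in> {0<..<T}"
  have e: "L2_inner L (mode_sol \<tau>) v = cis (mode_freq\<^sup>2 * \<tau>) * L2_inner L mode_fun v" for \<tau>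
    by (simp add: mode_sol_def[abs_def] L2_inner_smult)
  have "((\<lambda>\<tau>. L2_inner L (mode_sol \<tau>) v) has_vector_derivative (\<i> * mode_freq\<^sup>2 * cis (mode_freq\<^sup>2 * t) * L2_inner L mode_fun v)) (at t)"
    unfolding e by (intro has_vector_derivative_mult_left cis_deriv)
  moreover have "\<i> * (\<i> * mode_freq\<^sup>2 * cis (mode_freq\<^sup>2 * t) * L2_inner L mode_fun v) +
     L2_inner L (weak_deriv L (mode_sol t)) (weak_deriv L v) = 0"
    using v by (subst mode_inner_deriv) (auto simp: H1k_def power2_eq_square algebra_simps)
  ultimately show "\<exists>D. ((\<lambda>\<tau>. L2_inner L (mode_sol \<tau>) v) has_vector_derivative D) (at t) \<and>
            \<i> * D + L2_inner L (weak_deriv L (mode_sol t)) (weak_deriv L v) = 0" by blast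
qed (use mode_H1k in auto)

lemma mode_trace: "neumann_trace L T mode_sol (\<lambda>t. - mode_freq * cis (mode_freq\<^sup>2 * t))"
  unfolding neumann_trace_def
proof (intro conjI ballI impI)
  have c: "continuous_on A (\<lambda>t. cis (mode_freq\<^sup>2 * t))" for A by (intro continuous_intros)
  show "L2 T (\<lambda>t. - mode_freq * cis (mode_freq\<^sup>2 * t))"
    by (intro L2_continuous continuous_intros)
  fix v t assume v: "v \<in> H1 L" "v 0 = 0" and t: "t \<in> {0..T}"
  have w: "mode_freq \<noteq> 0" using L by (simp add: mode_freq_def)
  define I where "I = (LINT \<tau>:{0..t}|lborel. cis (mode_freq\<^sup>2 * \<tau>))"
  have "((\<lambda>\<tau>. \<i> * mode_freq\<^sup>2 * cis (mode_freq\<^sup>2 * \<tau>)) has_integral (cis (mode_freq\<^sup>2 * t) - cis (mode_freq\<^sup>2 * 0))) {0..t}"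
    using t by (intro fundamental_theorem_of_calculus cis_deriv) auto
  then have "integral {0..t} (\<lambda>\<tau>. \<i> * mode_freq\<^sup>2 * cis (mode_freq\<^sup>2 * \<tau>)) = cis (mode_freq\<^sup>2 * t) - cis (mode_freq\<^sup>2 * 0)"
    by (rule integral_unique)
  then have "cis (mode_freq\<^sup>2 * t) - 1 = (LINT \<tau>:{0..t}|lborel. (\<i> * mode_freq\<^sup>2) * cis (mode_freq\<^sup>2 * \<tau>))"
    by (subst set_borel_integral_eq_integral(2)[OF borel_integrable_atLeastAtMost'])
       (auto intro!: continuous_intros)
  then have I: "cis (mode_freq\<^sup>2 * t) - 1 = \<i> * mode_freq\<^sup>2 * I" 
    by (simp add: I_def)
  have e: "L2_inner L (mode_sol \<tau>) v = cis (mode_freq\<^sup>2 * \<tau>) * L2_inner L mode_fun v" for \<tau>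
    by (simp add: mode_sol_def[abs_def] L2_inner_smult)
  have 1: "(LINT \<tau>:{0..t}|lborel. L2_inner L (weak_deriv L (mode_sol \<tau>)) (weak_deriv L v))
     = I * (mode_freq * (mode_freq * L2_inner L mode_fun v - cnj (v L)))"
    unfolding mode_inner_deriv[OF v] I_def mult.assoc by simp
  have 2: "(LINT \<tau>:{0..t}|lborel. - mode_freq * cis (mode_freq\<^sup>2 * \<tau>)) = - mode_freq * I"
    unfolding I_def by (rule set_integral_mult_right)
  have "\<i> * (L2_inner L (mode_sol t) v - L2_inner L (mode_sol 0) v) = \<i> * ((cis (mode_freq\<^sup>2 * t) - 1) * L2_inner L mode_fun v)"
    by (simp add: e algebra_simps)
  also have "\<dots> = - (mode_freq\<^sup>2 * I * L2_inner L mode_fun v)" unfolding I by (simp add: algebra_simps)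
  finally show "\<i> * (L2_inner L (mode_sol t) v - L2_inner L (mode_sol 0) v)
          + (LINT \<tau>:{0..t}|lborel. L2_inner L (weak_deriv L (mode_sol \<tau>)) (weak_deriv L v))
        = (LINT \<tau>:{0..t}|lborel. - mode_freq * cis (mode_freq\<^sup>2 * \<tau>)) * cnj (v L)"
    unfolding 1 2 by (simp add: algebra_simps power2_eq_square)
qed

lemma mode_bound:
  assumes "observability_estimate \<alpha> C 0 L (L\<^sup>2)"
  shows "1 \<le> sqrt (2 * L) * (C * exp \<alpha>)"
proof -
  have w: "mode_freq > 0" using L by (simp add: mode_freq_def)
  have "H1_norm L (mode_sol 0) \<le> C * exp (\<alpha> * L\<^sup>2 / L\<^sup>2) * L2_norm (L\<^sup>2) (\<lambda>t. - mode_freq * cis (mode_freq\<^sup>2 * t))"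
    using assms mode_solution mode_trace mode_H1k unfolding observability_estimate_def by blast
  also have "L2_norm (L\<^sup>2) (\<lambda>t. - mode_freq * cis (mode_freq\<^sup>2 * t)) = mode_freq * L"
    using w L by (simp add: L2_norm_def norm_mult set_lebesgue_integral_def real_sqrt_mult)
  also have "mode_freq * L = pi" using L by (simp add: mode_freq_def)
  finally have 1: "H1_norm L (mode_sol 0) \<le> C * exp \<alpha> * pi" using L by simp
  have "(L2_norm L mode_fun_deriv)\<^sup>2 = (LINT x:{0..L}|lborel. mode_freq\<^sup>2 * (cos (mode_freq * x))\<^sup>2)"
    unfolding L2_norm_def mode_fun_deriv_def norm_of_real power_mult_distrib power2_abs
    by (subst real_sqrt_pow2) (auto simp: set_lebesgue_integral_def intro!: integral_nonneg_AE)
  also have "\<dots> = mode_freq\<^sup>2 * L / 2"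
  proof -
    let ?F = "\<lambda>x. mode_freq\<^sup>2 * x / 2 + mode_freq * sin (mode_freq * x) * cos (mode_freq * x) / 2"
    have "((\<lambda>x. mode_freq\<^sup>2 * (cos (mode_freq * x))\<^sup>2) has_integral (?F L - ?F 0)) {0..L}"
    proof (rule fundamental_theorem_of_calculus)
      fix x
      have s: "sin (x * mode_freq) * sin (x * mode_freq) = 1 - cos (x * mode_freq) * cos (x * mode_freq)"
        using sin_squared_eq[of "x * mode_freq"] by (simp add: power2_eq_square)
      show "(?F has_vector_derivative mode_freq\<^sup>2 * (cos (mode_freq * x))\<^sup>2) (at x within {0..L})"
        unfolding has_real_derivative_iff_has_vector_derivative[symmetric]
        by (rule derivative_eq_intros refl | simp)+ (simp add: algebra_simps power2_eq_square s, simp add: field_simps)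
    qed (use L in simp)
    then have "integral {0..L} (\<lambda>x. mode_freq\<^sup>2 * (cos (mode_freq * x))\<^sup>2) = ?F L - ?F 0"
      by (rule integral_unique)
    moreover have "sin (mode_freq * L) = 0" using L by (simp add: mode_freq_def)
    ultimately show ?thesis
      by (subst set_borel_integral_eq_integral(2)[OF borel_integrable_atLeastAtMost'])
         (auto intro!: continuous_intros)
  qed
  also have "\<dots> = (pi / sqrt (2 * L))\<^sup>2" using L by (simp add: mode_freq_def power2_eq_square field_simps)
  finally have "(pi / sqrt (2 * L))\<^sup>2 \<le> (L2_norm L mode_fun)\<^sup>2 + (L2_norm L mode_fun_deriv)\<^sup>2" by simp
  then have "pi / sqrt (2 * L) \<le> sqrt ((L2_norm L mode_fun)\<^sup>2 + (L2_norm L mode_fun_deriv)\<^sup>2)"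
    by (rule real_le_rsqrt)
  also have "\<dots> = H1_norm L (mode_sol 0)" using mode_H1_norm[of 1] by (simp add: mode_sol_def[abs_def])
  also note 1
  finally show ?thesis using L by (simp add: field_simps)
qed

end

lemma no_constant_uniform_for_small_L:
  "\<not> (\<exists>C. \<forall>k\<in>{0,1}. \<forall>L>0. \<forall>T. 0 < T \<and> T \<le> (min pi L)\<^sup>2 \<longrightarrow>
        observability_estimate \<alpha> C k L T)"
proof
  assume "\<exists>C. \<forall>k\<in>{0,1}. \<forall>L>0. \<forall>T. 0 < T \<and> T \<le> (min pi L)\<^sup>2 \<longrightarrow>
        observability_estimate \<alpha> C k L T"
  then obtain C where C: "\<And>L T. 0 < L \<Longrightarrow> 0 < T \<Longrightarrow> T \<le> (min pi L)\<^sup>2 \<Longrightarrow> observability_estimate \<alpha> C 0 L T"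
    by (metis insertI1)
  define q where "q = 1 + \<bar>C * exp \<alpha>\<bar>"
  define L where "L = 1 / (2 * q\<^sup>2)"
  have q: "q \<ge> 1" "C * exp \<alpha> < q" by (auto simp: q_def)
  have "q\<^sup>2 \<ge> 1" using q by (simp add: power2_eq_square) (metis mult_mono mult_1 order_trans zero_le_one)
  then have "L \<le> 1" by (simp add: L_def divide_simps)
  then have "min pi L = L" using pi_gt3 by simp
  moreover have L: "L > 0" using q by (simp add: L_def)
  ultimately have "1 \<le> sqrt (2 * L) * (C * exp \<alpha>)"
    by (intro mode_bound C) auto
  also have "sqrt (2 * L) = 1 / q" using q by (simp add: L_def real_sqrt_divide)
  finally show False using q by (simp add: field_simps)
qed

end

theory Submission
  imports Defs "HOL-Complex_Analysis.Complex_Analysis"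
begin

text \<open>
  Let \<open>\<omega>\<^sub>m = (m + k/2) \<pi> / L\<close> be the frequencies of the modes, \<open>c\<^sub>m\<close> the coefficients of the datum and
  \<open>\<kappa> = L\<^sup>2 / T\<close>.  The trace is, up to constants, the series of \<open>\<omega>\<^sub>m c\<^sub>m exp (i \<omega>\<^sub>m\<^sup>2 t)\<close>, and the question is
  how well it determines the coefficients on \<open>[0,T]\<close> when \<open>\<kappa>\<close> is large.

  \<^bold>\<open>Upper bound.\<close>  The trace is accessed through \<open>weak_deriv_L2_inner_u\<close>, which expresses the time
  derivative of \<open>\<langle>u(t), v\<rangle>\<close> by \<open>\<langle>u(t), v''\<rangle>\<close> and the trace.

  High frequencies are governed by the multiplier \<open>s \<partial>\<^sub>s\<close>: the test functions \<open>s e\<^sub>m'(s)\<close>, with \<open>e\<^sub>m\<close> the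
  modes, give an exact identity for each coefficient (\<open>mode_multiplier_identity\<close>), and their sum is
  \<open>T \<parallel>\<partial>u\<^sub>0\<parallel> \<le> L \<surd>L \<parallel>g\<parallel> + L \<parallel>u\<^sub>0\<parallel>\<close> (\<open>energy_bound\<close>).  Modes of frequency at least \<open>2 L / T\<close> contribute
  at most \<open>(T / 2 L) \<parallel>\<partial>u\<^sub>0\<parallel>\<close> to \<open>\<parallel>u\<^sub>0\<parallel>\<close>, so the last term is harmless except for the finitely many
  modes below \<open>2 L / T\<close>.

  For these the equation is read as an evolution in space.  Let \<open>v\<^sub>0\<close> be the mode and \<open>v\<^sub>j\<^sub>+\<^sub>1\<close> the twofold
  antiderivative of \<open>v\<^sub>j\<close> with vanishing data at \<open>0\<close>.  The time integral of \<open>\<langle>u, v\<^sub>j\<rangle>\<close> is the increment of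
  \<open>\<langle>u, v\<^sub>j\<^sub>+\<^sub>1\<rangle>\<close>, up to a factor, plus \<open>v\<^sub>j\<^sub>+\<^sub>1(L)\<close> times an observed quantity.  Averaging in time
  over a window of half width \<open>a\<close> makes this a recursion in which each step costs \<open>1 / a\<close>
  (\<open>lateral_step\<close>), whereas \<open>v\<^sub>j(L)\<close> is of size \<open>L\<^sup>2\<^sup>j / (2j)!\<close>.  With windows of half width \<open>L\<^sup>2 / (n + i)\<^sup>2\<close>
  for \<open>i = 1, 2, ...\<close>, where \<open>n\<close> is about \<open>2 \<kappa>\<close>, all of them fit into \<open>[0,T]\<close>, and the \<open>j\<close>-th term costs
  \<open>((n + j) choose j)\<^sup>2 / (2j choose j)\<close>, which is at most \<open>4 ^ n\<close> up to polynomial factors.  The averages damp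
  \<open>exp (i \<omega>\<^sup>2 t)\<close> by a product of sinc factors, at least \<open>exp (- 2 \<kappa> / 3)\<close> for low frequencies.  So a
  low coefficient costs \<open>exp ((4 ln 2 + 2/3) \<kappa>)\<close>, up to polynomial factors (\<open>low_mode_bound\<close>), and
  \<open>4 ln 2 + 2/3 < 3.45\<close> lies below \<open>4 (36/37)\<^sup>2\<close>, which exceeds \<open>3.78\<close>.

  \<^bold>\<open>Lower bound.\<close>  Take \<open>k = 1\<close> and \<open>L = 1\<close>.  The sums of \<open>(-1)\<^sup>m \<omega>\<^sub>m exp (- \<omega>\<^sub>m\<^sup>2 z)\<close> are residue sums of
  \<open>w exp (- w\<^sup>2 z) / cos w\<close>.  If \<open>Re z = T/2\<close> and \<open>\<bar>Im z\<bar> \<le> T/2\<close>, then moving the contour to the lines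
  \<open>Im w = \<plusminus>h\<close> gives the bound \<open>exp (h\<^sup>2 T - h)\<close>, which is \<open>exp (- 1 / (4 T))\<close> for \<open>h = 1 / (2 T)\<close>
  (\<open>norm_theta_sum_le\<close>).  These sums are traces of solutions whose data are bounded below.

  \<^bold>\<open>Conclusion.\<close>  The admissible rates are closed under infima, so \<open>alpha_star\<close> is one of them
  (\<open>alpha_star_attained\<close>).
\<close>

section \<open>The Hilbert space structure of square integrable functions\<close>

lemma L2_measurable:
  assumes "L2 L f"
  shows "(\<lambda>x. indicator {0..L} x *\<^sub>R f x) \<in> borel_measurable borel"
  using assms by (simp add: L2_def set_borel_measurable_def)

lemma L2_mult_measurable:
  assumes "L2 L f" "L2 L g"
  shows "(\<lambda>x. indicator {0..L} x *\<^sub>R (f x * cnj (g x))) \<in> borel_measurable borel"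
proof -
  note [measurable] = L2_measurable[OF assms(1)] L2_measurable[OF assms(2)]
  have "(\<lambda>x. (indicator {0..L} x *\<^sub>R f x) * cnj (indicator {0..L} x *\<^sub>R g x)) \<in> borel_measurable borel"
    by (intro borel_measurable_times measurable_compose[OF _ borel_measurable_continuous_onI[of cnj]]
        continuous_intros L2_measurable assms)
  also have "(\<lambda>x. (indicator {0..L} x *\<^sub>R f x) * cnj (indicator {0..L} x *\<^sub>R g x))
      = (\<lambda>x. indicator {0..L} x *\<^sub>R (f x * cnj (g x)))"
    by (auto simp: indicator_def)
  finally show ?thesis .
qed

lemma L2_sq_integrable: "L2 L f \<Longrightarrow> set_integrable lborel {0..L} (\<lambda>x. (norm (f x))\<^sup>2)"
  by (simp add: L2_def)

lemma L2_mult_integrable: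
  assumes "L2 L f" "L2 L g"
  shows "set_integrable lborel {0..L} (\<lambda>x. f x * cnj (g x))"
proof -
  have i: "set_integrable lborel {0..L} (\<lambda>x. (norm (f x))\<^sup>2 + (norm (g x))\<^sup>2)"
    using assms by (intro set_integral_add L2_sq_integrable)
  have b: "norm (f x * cnj (g x)) \<le> (norm (f x))\<^sup>2 + (norm (g x))\<^sup>2" for x
    using sum_squares_bound[of "norm (f x)" "norm (g x)"]
      mult_nonneg_nonneg[OF norm_ge_zero[of "f x"] norm_ge_zero[of "g x"]]
    unfolding norm_mult complex_mod_cnj by linarith
  show ?thesis
    using i unfolding set_integrable_def
    by (rule Bochner_Integration.integrable_bound)
       (use L2_mult_measurable[OF assms] b in \<open>auto simp: indicator_def intro!: AE_I2\<close>)
qed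

lemma L2_dominated:
  assumes m: "(\<lambda>x. indicator {0..L} x *\<^sub>R f x) \<in> borel_measurable borel"
    and w: "set_integrable lborel {0..L} w" and b: "\<And>x. (norm (f x))\<^sup>2 \<le> w x"
  shows "L2 L f"
proof -
  have b': "(norm (f x))\<^sup>2 \<le> \<bar>w x\<bar>" for x by (rule order_trans[OF b abs_ge_self])
  have "(\<lambda>x. (norm (indicator {0..L} x *\<^sub>R f x))\<^sup>2) \<in> borel_measurable borel"
    using m by measurable
  also have "(\<lambda>x. (norm (indicator {0..L} x *\<^sub>R f x))\<^sup>2) = (\<lambda>x. indicator {0..L} x *\<^sub>R (norm (f x))\<^sup>2)"
    by (auto simp: indicator_def)
  finally have m2: "(\<lambda>x. indicator {0..L} x *\<^sub>R (norm (f x))\<^sup>2) \<in> borel_measurable borel" .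
  have "set_integrable lborel {0..L} (\<lambda>x. (norm (f x))\<^sup>2)"
    using w unfolding set_integrable_def
    by (rule Bochner_Integration.integrable_bound)
       (use m2 b' in \<open>auto simp: indicator_def intro!: AE_I2\<close>)
  then show ?thesis using m by (simp add: L2_def set_borel_measurable_def)
qed

lemma L2_add:
  assumes "L2 L f" "L2 L g"
  shows "L2 L (\<lambda>x. f x + g x)"
proof (rule L2_dominated)
  note [measurable] = L2_measurable[OF assms(1)] L2_measurable[OF assms(2)]
  show "(\<lambda>x. indicator {0..L} x *\<^sub>R (f x + g x)) \<in> borel_measurable borel"
    unfolding scaleR_add_right by measurable
  show "set_integrable lborel {0..L} (\<lambda>x. 2 * (norm (f x))\<^sup>2 + 2 * (norm (g x))\<^sup>2)"
    using assms by (intro set_integral_add set_integrable_mult_right L2_sq_integrable impI)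
  fix x
  have "(norm (f x + g x))\<^sup>2 \<le> (norm (f x) + norm (g x))\<^sup>2"
    by (intro power_mono norm_triangle_ineq norm_ge_zero)
  also have "\<dots> \<le> 2 * (norm (f x))\<^sup>2 + 2 * (norm (g x))\<^sup>2"
    using sum_squares_bound[of "norm (f x)" "norm (g x)"] by (simp add: power2_sum)
  finally show "(norm (f x + g x))\<^sup>2 \<le> 2 * (norm (f x))\<^sup>2 + 2 * (norm (g x))\<^sup>2" .
qed

lemma L2_smult:
  assumes "L2 L f"
  shows "L2 L (\<lambda>x. c * f x)"
proof -
  note [measurable] = L2_measurable[OF assms]
  have "(\<lambda>x. c * (indicator {0..L} x *\<^sub>R f x)) \<in> borel_measurable borel" by measurable
  then have "set_borel_measurable lborel {0..L} (\<lambda>x. c * f x)"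
    by (simp add: set_borel_measurable_def)
  moreover have "set_integrable lborel {0..L} (\<lambda>x. (norm (c * f x))\<^sup>2)"
    using assms by (auto simp: L2_def norm_mult power_mult_distrib)
  ultimately show ?thesis by (simp add: L2_def)
qed

lemma L2_diff: "L2 L f \<Longrightarrow> L2 L g \<Longrightarrow> L2 L (\<lambda>x. f x - g x)"
  using L2_add[of L f "\<lambda>x. (-1) * g x"] L2_smult[of L g "-1"] by simp

lemma L2_zero: "L2 L (\<lambda>x. 0)"
  by (intro L2_continuous continuous_intros)

lemma L2_sum: "(\<And>i. i \<in> I \<Longrightarrow> L2 L (f i)) \<Longrightarrow> L2 L (\<lambda>x. \<Sum>i\<in>I. f i x)"
  by (induction I rule: infinite_finite_induct) (auto intro: L2_zero L2_add)

lemma L2_inner_cong: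
  assumes "\<And>x. x \<in> {0..L} \<Longrightarrow> f x = f' x" "\<And>x. x \<in> {0..L} \<Longrightarrow> g x = g' x"
  shows "L2_inner L f g = L2_inner L f' g'"
  unfolding L2_inner_def using assms by (intro set_lebesgue_integral_cong) auto

lemma L2_norm_cong:
  assumes "\<And>x. x \<in> {0..L} \<Longrightarrow> f x = f' x"
  shows "L2_norm L f = L2_norm L f'"
proof -
  have "L2_inner L f f = L2_inner L f' f'" by (rule L2_inner_cong) (auto simp: assms)
  then show ?thesis by (simp add: L2_norm_eq_inner)
qed

lemma L2_inner_cnj: "L2_inner L g f = cnj (L2_inner L f g)"
  unfolding L2_inner_def set_lebesgue_integral_def Bochner_Integration.integral_cnj[symmetric]
  by (simp add: mult.commute)

lemma L2_inner_smult_right: "L2_inner L f (\<lambda>x. c * g x) = cnj c * L2_inner L f g"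
  by (subst (1 2) L2_inner_cnj) (simp add: L2_inner_smult)

lemma L2_inner_add_left:
  "L2 L f \<Longrightarrow> L2 L g \<Longrightarrow> L2 L h \<Longrightarrow> L2_inner L (\<lambda>x. f x + g x) h = L2_inner L f h + L2_inner L g h"
  unfolding L2_inner_def distrib_right by (intro set_integral_add L2_mult_integrable)

lemma L2_inner_diff_left:
  "L2 L f \<Longrightarrow> L2 L g \<Longrightarrow> L2 L h \<Longrightarrow> L2_inner L (\<lambda>x. f x - g x) h = L2_inner L f h - L2_inner L g h"
  unfolding L2_inner_def left_diff_distrib by (intro set_integral_diff L2_mult_integrable)

lemma L2_inner_diff_right:
  "L2 L f \<Longrightarrow> L2 L g \<Longrightarrow> L2 L h \<Longrightarrow> L2_inner L h (\<lambda>x. f x - g x) = L2_inner L h f - L2_inner L h g"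
  by (subst (1 2 3) L2_inner_cnj) (simp add: L2_inner_diff_left)

lemma L2_inner_zero_left: "L2_inner L (\<lambda>x. 0) h = 0"
  by (simp add: L2_inner_def set_lebesgue_integral_def)

lemma L2_inner_sum_left:
  assumes "\<And>i. i \<in> I \<Longrightarrow> L2 L (f i)" "L2 L h"
  shows "L2_inner L (\<lambda>x. \<Sum>i\<in>I. f i x) h = (\<Sum>i\<in>I. L2_inner L (f i) h)"
  using assms
  by (induction I rule: infinite_finite_induct)
     (auto simp: L2_inner_zero_left L2_inner_add_left L2_sum)

lemma L2_inner_sum_right:
  assumes "\<And>i. i \<in> I \<Longrightarrow> L2 L (f i)" "L2 L h"
  shows "L2_inner L h (\<lambda>x. \<Sum>i\<in>I. f i x) = (\<Sum>i\<in>I. L2_inner L h (f i))"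
  by (subst (1 2) L2_inner_cnj) (simp add: L2_inner_sum_left assms)

lemma L2_norm_nonneg: "0 \<le> L2_norm L f"
  by (simp add: L2_norm_def set_lebesgue_integral_def integral_nonneg_AE)

lemma L2_norm_square: "(L2_norm L f)\<^sup>2 = (LINT x:{0..L}|lborel. (norm (f x))\<^sup>2)"
  by (simp add: L2_norm_def set_lebesgue_integral_def integral_nonneg_AE)

lemma L2_inner_self: "L2_inner L f f = of_real ((L2_norm L f)\<^sup>2)"
proof -
  have "L2_inner L f f = (LINT x:{0..L}|lborel. of_real ((norm (f x))\<^sup>2))"
    unfolding L2_inner_def complex_norm_square ..
  also have "\<dots> = of_real (LINT x:{0..L}|lborel. (norm (f x))\<^sup>2)"
    unfolding set_lebesgue_integral_def integral_complex_of_real[symmetric]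
    by (simp add: scaleR_conv_of_real)
  finally show ?thesis by (simp add: L2_norm_square)
qed

lemma L2_norm_sub_square:
  assumes "L2 L f" "L2 L g"
  shows "(L2_norm L (\<lambda>x. f x - g x))\<^sup>2 = (L2_norm L f)\<^sup>2 + (L2_norm L g)\<^sup>2 - 2 * Re (L2_inner L f g)"
proof -
  have "of_real ((L2_norm L (\<lambda>x. f x - g x))\<^sup>2) =
      L2_inner L f f - L2_inner L f g - (cnj (L2_inner L f g) - L2_inner L g g)"
    unfolding L2_inner_self[symmetric] using assms
    by (simp add: L2_inner_diff_left L2_inner_diff_right L2_diff L2_inner_cnj[of L g f] algebra_simps)
  from arg_cong[OF this, of Re] show ?thesis
    by (simp add: L2_inner_self)
qed

lemma L2_Cauchy_Schwarz:
  assumes f: "L2 L f" and g: "L2 L g"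
  shows "norm (L2_inner L f g) \<le> L2_norm L f * L2_norm L g"
proof -
  define z where "z = L2_inner L f g"
  define a b where "a = (L2_norm L f)\<^sup>2" and "b = (L2_norm L g)\<^sup>2"
  have q: "0 \<le> a + t\<^sup>2 * (norm z)\<^sup>2 * b - 2 * t * (norm z)\<^sup>2" for t
  proof -
    have "0 \<le> (L2_norm L (\<lambda>x. f x - (of_real t * z) * g x))\<^sup>2" by simp
    also have "\<dots> = a + t\<^sup>2 * (norm z)\<^sup>2 * b - 2 * t * Re (cnj z * z)"
      using f g by (simp add: L2_norm_sub_square L2_smult L2_norm_smult L2_inner_smult_right
          a_def b_def norm_mult power_mult_distrib algebra_simps flip: z_def)
    also have "cnj z * z = of_real ((norm z)\<^sup>2)" by (simp add: complex_norm_square[symmetric] mult.commute)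
    finally show ?thesis by simp
  qed
  have "(norm z)\<^sup>2 \<le> a * b"
  proof (cases "b = 0")
    case True
    have "norm z = 0"
    proof (rule ccontr)
      assume "norm z \<noteq> 0"
      then have p: "(norm z)\<^sup>2 > 0" by simp
      have "2 * ((a + 1) / (2 * (norm z)\<^sup>2)) * (norm z)\<^sup>2 = a + 1" using p by simp
      then show False using q[of "(a + 1) / (2 * (norm z)\<^sup>2)"] True by simp
    qed
    then show ?thesis using True by simp
  next
    case False
    then have b: "b > 0" by (simp add: b_def)
    have "0 \<le> a - (norm z)\<^sup>2 / b"
      using q[of "1 / b"] b by (simp add: power2_eq_square field_simps)
    then show ?thesis using b by (simp add: field_simps)
  qed
  then have "norm z \<le> sqrt (a * b)" by (rule real_le_rsqrt)
  then show ?thesis by (simp add: z_def a_def b_def real_sqrt_mult L2_norm_nonneg)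
qed

lemma L2_norm_triangle:
  assumes "L2 L f" "L2 L g"
  shows "L2_norm L f \<le> L2_norm L (\<lambda>x. f x - g x) + L2_norm L g"
proof -
  let ?h = "\<lambda>x. f x - g x"
  have h: "L2 L ?h" using assms by (rule L2_diff)
  have "(L2_norm L f)\<^sup>2 = (L2_norm L ?h)\<^sup>2 + (L2_norm L g)\<^sup>2 + 2 * Re (L2_inner L ?h g)"
    using L2_norm_sub_square[OF assms] L2_inner_self[of L g] by (simp add: L2_inner_diff_left assms)
  also have "\<dots> \<le> (L2_norm L ?h + L2_norm L g)\<^sup>2"
    using order_trans[OF complex_Re_le_cmod L2_Cauchy_Schwarz[OF h assms(2)]] by (simp add: power2_sum)
  finally show ?thesis
    using L2_norm_nonneg by (metis add_nonneg_nonneg power2_le_imp_le)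
qed

lemma L2_norm_bounded:
  assumes "L \<ge> 0" "L2 L f" "\<And>x. x \<in> {0..L} \<Longrightarrow> norm (f x) \<le> B" "B \<ge> 0"
  shows "L2_norm L f \<le> sqrt L * B"
proof -
  have "(LINT x:{0..L}|lborel. (norm (f x))\<^sup>2) \<le> (LINT x:{0..L}|lborel. B\<^sup>2)"
    using assms by (intro set_integral_mono L2_sq_integrable borel_integrable_atLeastAtMost'
        continuous_intros power_mono) auto
  also have "\<dots> = L * B\<^sup>2" using assms(1) by (simp add: set_lebesgue_integral_def)
  finally have "(LINT x:{0..L}|lborel. (norm (f x))\<^sup>2) \<le> L * B\<^sup>2" .
  then have "(L2_norm L f)\<^sup>2 \<le> (sqrt L * B)\<^sup>2"
    using assms(1) by (simp add: L2_norm_square power_mult_distrib)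
  then show ?thesis using assms by (auto intro: power2_le_imp_le)
qed

section \<open>Density of trigonometric sums\<close>

lemma L2_dominated_convergence:
  assumes f: "L2 L f" and h: "\<And>n. L2 L (h n)"
    and lim: "AE x in lborel. x \<in> {0..L} \<longrightarrow> (\<lambda>n. h n x) \<longlonglongrightarrow> f x"
    and w: "set_integrable lborel {0..L} w"
    and dom: "\<And>n x. x \<in> {0..L} \<Longrightarrow> (norm (f x - h n x))\<^sup>2 \<le> w x"
  shows "(\<lambda>n. L2_norm L (\<lambda>x. f x - h n x)) \<longlonglongrightarrow> 0"
proof -
  have "(\<lambda>n. LINT x|lborel. indicator {0..L} x *\<^sub>R (norm (f x - h n x))\<^sup>2) \<longlonglongrightarrow> (LINT x|(lborel :: real measure). 0)"
  proof (rule integral_dominated_convergence)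
    show "integrable lborel (\<lambda>x. indicator {0..L} x *\<^sub>R w x)" using w by (simp add: set_integrable_def)
    show "(\<lambda>x. indicator {0..L} x *\<^sub>R (norm (f x - h n x))\<^sup>2) \<in> borel_measurable lborel" for n
      using L2_sq_integrable[OF L2_diff[OF f h]] by (auto simp: set_integrable_def)
    show "AE x in lborel. (\<lambda>n. indicator {0..L} x *\<^sub>R (norm (f x - h n x))\<^sup>2) \<longlonglongrightarrow> 0"
      using lim
    proof eventually_elim
      case (elim x)
      show ?case
      proof (cases "x \<in> {0..L}")
        case True
        then have "(\<lambda>n. (norm (f x - h n x))\<^sup>2) \<longlonglongrightarrow> (norm (f x - f x))\<^sup>2"
          using elim by (intro tendsto_intros) auto
        then show ?thesis using True by simp
      qed simp
    qed
    show "AE x in lborel. norm (indicator {0..L} x *\<^sub>R (norm (f x - h n x))\<^sup>2) \<le> indicator {0..L} x *\<^sub>R w x" for n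
      using dom by (intro AE_I2) (auto simp: indicator_def)
  qed simp
  then have "(\<lambda>n. sqrt (LINT x|lborel. indicator {0..L} x *\<^sub>R (norm (f x - h n x))\<^sup>2)) \<longlonglongrightarrow> sqrt 0"
    by (intro tendsto_real_sqrt) simp
  then show ?thesis by (simp add: L2_norm_def set_lebesgue_integral_def)
qed

text \<open>Radial projection onto the disc of radius \<open>R\<close>, written without a case distinction so that its
  continuity is evident.\<close>

definition clip :: "real \<Rightarrow> complex \<Rightarrow> complex" where
  "clip R z = z / of_real (max 1 (norm z / R))"

lemma clip_continuous: "R > 0 \<Longrightarrow> continuous_on UNIV (clip R)"
  unfolding clip_def by (intro continuous_intros) auto

lemma norm_clip: "R > 0 \<Longrightarrow> norm (clip R z) \<le> R"
proof -
  assume R: "R > 0"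
  have "norm (clip R z) = norm z / max 1 (norm z / R)" by (simp add: clip_def norm_divide)
  also have "\<dots> \<le> R" 
    using R by (cases "norm z / R \<le> 1") (auto simp: max_def field_simps)
  finally show ?thesis .
qed

lemma clip_id: "R > 0 \<Longrightarrow> norm z \<le> R \<Longrightarrow> clip R z = z"
  by (simp add: clip_def max_def field_simps)

lemma norm_clip_le: "R > 0 \<Longrightarrow> norm (clip R z) \<le> norm z"
  by (simp add: clip_def norm_divide field_simps max_def mult_left_le)

lemma L2_clip:
  assumes f: "L2 L f" and R: "R > 0"
  shows "L2 L (\<lambda>x. clip R (f x))"
proof (rule L2_dominated[OF _ L2_sq_integrable[OF f]])
  have "(\<lambda>x. clip R (indicator {0..L} x *\<^sub>R f x)) \<in> borel_measurable borel"
    by (rule measurable_compose[OF L2_measurable[OF f]])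
       (intro borel_measurable_continuous_onI clip_continuous R)
  also have "(\<lambda>x. clip R (indicator {0..L} x *\<^sub>R f x)) = (\<lambda>x. indicator {0..L} x *\<^sub>R clip R (f x))"
    by (auto simp: indicator_def clip_def)
  finally show "(\<lambda>x. indicator {0..L} x *\<^sub>R clip R (f x)) \<in> borel_measurable borel" .
  show "(norm (clip R (f x)))\<^sup>2 \<le> (norm (f x))\<^sup>2" for x
    using norm_clip_le[OF R] by (intro power_mono) auto
qed

text \<open>Truncating \<open>f\<close> in size costs little in the \<open>L\<^sup>2\<close> norm.  The truncated function is a limit almost
  everywhere of continuous functions, and these may be truncated at the same height and multiplied by
  cutoffs that open up to \<open>(0,L)\<close>; a constant then dominates.  The approximant vanishes near both
  endpoints, so that it can later be divided by a weight whose only zeros are endpoints.\<close>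

lemma L2_approx_continuous:
  assumes f: "L2 L f" and L: "L > 0" and e: "e > 0"
  obtains h d where "continuous_on UNIV h" "\<And>x. x \<notin> {d<..<L-d} \<Longrightarrow> h x = 0" "d > 0" 
    "L2_norm L (\<lambda>x. f x - h x) < e"
proof -
  have R: "real (Suc n) > 0" for n by simp
  have "(\<lambda>n. L2_norm L (\<lambda>x. f x - clip (real (Suc n)) (f x))) \<longlonglongrightarrow> 0"
  proof (rule L2_dominated_convergence[OF f])
    show "L2 L (\<lambda>x. clip (real (Suc n)) (f x))" for n using f L by (intro L2_clip) auto
    show "set_integrable lborel {0..L} (\<lambda>x. (2 * norm (f x))\<^sup>2)"
      using L2_sq_integrable[OF f] by (simp add: power_mult_distrib)
    show "(norm (f x - clip (real (Suc n)) (f x)))\<^sup>2 \<le> (2 * norm (f x))\<^sup>2" for n x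
      using norm_triangle_ineq4[of "f x" "clip (real (Suc n)) (f x)"] norm_clip_le[OF R, of n "f x"]
      by (intro power_mono) auto
    have "(\<lambda>n. clip (real (Suc n)) (f x)) \<longlonglongrightarrow> f x" for x
    proof (rule tendsto_eventually)
      obtain N where N: "norm (f x) \<le> real N" using real_arch_simple by blast
      then show "\<forall>\<^sub>F n in sequentially. clip (real (Suc n)) (f x) = f x"
        by (intro eventually_sequentiallyI[of N] clip_id) auto
    qed
    then show "AE x in lborel. x \<in> {0..L} \<longrightarrow> (\<lambda>n. clip (real (Suc n)) (f x)) \<longlonglongrightarrow> f x" by simp
  qed
  then have "\<forall>\<^sub>F n in sequentially. L2_norm L (\<lambda>x. f x - clip (real (Suc n)) (f x)) < e / 2"
    using e by (intro order_tendstoD(2)) auto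
  then obtain n0 where n0: "L2_norm L (\<lambda>x. f x - clip (real (Suc n0)) (f x)) < e / 2"
    by (auto simp: eventually_sequentially)
  define R where "R = real (Suc n0)"
  have Rp: "R > 0" by (simp add: R_def)
  define F where "F x = clip R (f x)" for x
  have FL: "L2 L F" unfolding F_def using f L Rp by (intro L2_clip) auto
  have "(\<lambda>x. indicator {0..L} x *\<^sub>R f x) \<in> borel_measurable lebesgue"
    using L2_measurable[OF f] by (simp add: measurable_completion)
  then have "(\<lambda>x. indicator {0..L} x *\<^sub>R f x) measurable_on UNIV"
    by (intro lebesgue_measurable_imp_measurable_on) auto
  then obtain N g where N: "negligible N" and g: "\<And>n. continuous_on UNIV (g n)"
    and lim: "\<And>x. x \<notin> N \<Longrightarrow> (\<lambda>n. g n x) \<longlonglongrightarrow> indicator {0..L} x *\<^sub>R f x"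
    unfolding measurable_on_def by auto
  \<comment> \<open>A trapezoid: \<open>0\<close> up to distance \<open>1 / (n + 1)\<close> from the endpoints, \<open>1\<close> from twice that distance on.\<close>
  define cut where "cut n x = max 0 (min 1 (real (Suc n) * min x (L - x) - 1))" for n x
  define h where "h n x = of_real (cut n x) * clip R (g n x)" for n x
  have cutc: "continuous_on UNIV (cut n)" for n unfolding cut_def by (intro continuous_intros)
  have hc: "continuous_on UNIV (h n)" for n
    unfolding h_def using Rp g
    by (intro continuous_intros cutc continuous_on_compose2[OF clip_continuous]) auto
  have cutb: "0 \<le> cut n x" "cut n x \<le> 1" for n x by (auto simp: cut_def)
  have hb: "norm (h n x) \<le> R" for n x
    unfolding h_def norm_mult using cutb[of n x] norm_clip[OF Rp, of "g n x"]
    by (simp add: mult_le_one mult_left_le_one_le order_trans[OF mult_left_le_one_le])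
  have hL: "L2 L (h n)" for n using hc by (intro L2_continuous) (auto intro: continuous_on_subset)
  have "(\<lambda>n. L2_norm L (\<lambda>x. F x - h n x)) \<longlonglongrightarrow> 0"
  proof (rule L2_dominated_convergence[OF FL hL])
    show "set_integrable lborel {0..L} (\<lambda>x. (2 * R)\<^sup>2)"
      by (intro borel_integrable_atLeastAtMost' continuous_intros)
    show "(norm (F x - h n x))\<^sup>2 \<le> (2 * R)\<^sup>2" for n x
      using norm_triangle_ineq4[of "F x" "h n x"] hb[of n x] norm_clip[OF Rp, of "f x"]
      by (intro power_mono) (auto simp: F_def)
    have ptw: "(\<lambda>n. h n x) \<longlonglongrightarrow> F x" if x: "x \<notin> N" "x \<in> {0<..<L}" for x
    proof -
      have "(\<lambda>n. clip R (g n x)) \<longlonglongrightarrow> clip R (f x)"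
        using lim[OF x(1)] x(2)
        by (intro continuous_on_tendsto_compose[OF clip_continuous[OF Rp]]) auto
      moreover have "(\<lambda>n. cut n x) \<longlonglongrightarrow> 1"
      proof (rule tendsto_eventually)
        have m: "min x (L - x) > 0" using x(2) by auto
        obtain K where K: "2 / min x (L - x) \<le> real K" using real_arch_simple by blast
        have "cut n x = 1" if "n \<ge> K" for n
        proof -
          have "2 / min x (L - x) \<le> real (Suc n)" using K that by simp
          then have "2 \<le> real (Suc n) * min x (L - x)" using m by (simp add: pos_divide_le_eq)
          then show ?thesis by (simp add: cut_def)
        qed
        then show "\<forall>\<^sub>F n in sequentially. cut n x = 1" by (intro eventually_sequentiallyI)
      qed
      ultimately have "(\<lambda>n. of_real (cut n x) * clip R (g n x)) \<longlonglongrightarrow> of_real 1 * clip R (f x)"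
        by (intro tendsto_intros)
      then show ?thesis by (simp add: h_def F_def)
    qed
    have "negligible (N \<union> {0, L})" using N by (simp add: negligible_Un)
    then have "N \<union> {0, L} \<in> null_sets lebesgue" by (simp add: negligible_iff_null_sets)
    then have "AE x in lebesgue. x \<notin> N \<union> {0, L}" by (rule AE_not_in)
    then have "AE x in lebesgue. x \<in> {0..L} \<longrightarrow> (\<lambda>n. h n x) \<longlonglongrightarrow> F x"
    proof eventually_elim
      case (elim x)
      then show ?case using ptw[of x] by auto
    qed
    then show "AE x in lborel. x \<in> {0..L} \<longrightarrow> (\<lambda>n. h n x) \<longlonglongrightarrow> F x"
      by (simp add: AE_completion_iff)
  qed
  then have "\<forall>\<^sub>F n in sequentially. L2_norm L (\<lambda>x. F x - h n x) < e / 2"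
    using e by (intro order_tendstoD(2)) auto
  then obtain n1 where n1: "L2_norm L (\<lambda>x. F x - h n1 x) < e / 2"
    by (auto simp: eventually_sequentially)
  show thesis
  proof (rule that[of "h n1" "1 / real (Suc n1)"])
    show "h n1 x = 0" if "x \<notin> {1 / real (Suc n1)<..<L - 1 / real (Suc n1)}" for x
    proof -
      have "min x (L - x) \<le> 1 / real (Suc n1)" using that by auto
      then have "real (Suc n1) * min x (L - x) \<le> real (Suc n1) * (1 / real (Suc n1))"
        by (intro mult_left_mono) auto
      also have "\<dots> = 1" by simp
      finally show ?thesis by (simp add: h_def cut_def)
    qed
    have "L2_norm L (\<lambda>x. f x - h n1 x) \<le> L2_norm L (\<lambda>x. (f x - h n1 x) - (F x - h n1 x)) + L2_norm L (\<lambda>x. F x - h n1 x)"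
      using f hL FL by (intro L2_norm_triangle L2_diff)
    then show "L2_norm L (\<lambda>x. f x - h n1 x) < e" using n0 n1 by (simp add: R_def F_def)
  qed (use hc in auto)
qed

text \<open>The substitution \<open>y = cos (\<pi> (L - s) / L)\<close> maps \<open>[0,L]\<close> homeomorphically onto \<open>[-1,1]\<close>.  Hence
  Weierstrass' theorem approximates \<open>h / \<psi> m0\<close>, for continuous \<open>h\<close> vanishing near the endpoints, by
  polynomials in that cosine.  By the product formulas the span of the family is closed under
  multiplication by the cosine, so \<open>\<psi> m0\<close> times such a polynomial is a finite sum of the family.  This
  covers all four systems of sines and cosines at once.\<close>

lemma L2_approx_trig_sum:
  fixes \<psi> :: "nat \<Rightarrow> real \<Rightarrow> complex"
  assumes f: "L2 L f" and L: "L > 0" and e: "e > 0"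
    and cont: "\<And>m. continuous_on UNIV (\<psi> m)"
    and step: "\<And>m. \<exists>a i b j. \<forall>s. of_real (cos (pi * (L - s) / L)) * \<psi> m s = a * \<psi> i s + b * \<psi> j s"
    and nz: "\<And>s. 0 < s \<Longrightarrow> s < L \<Longrightarrow> \<psi> m0 s \<noteq> 0"
  obtains M \<alpha> where "L2_norm L (\<lambda>s. f s - (\<Sum>m<M. \<alpha> m * \<psi> m s)) < e"
proof -
  \<comment> \<open>The coefficients are required to vanish from \<open>M\<close> on so that sums of different lengths can be added.\<close>
  define V where "V = {h. \<exists>M \<alpha>. (\<forall>m\<ge>M. \<alpha> m = 0) \<and> (\<forall>s. h s = (\<Sum>m<M. \<alpha> m * \<psi> m s))}"
  have V_add: "(\<lambda>s. g s + h s) \<in> V" if "g \<in> V" "h \<in> V" for g h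
  proof -
    obtain M \<alpha> where a: "\<forall>m\<ge>M. \<alpha> m = 0" "\<forall>s. g s = (\<Sum>m<M. \<alpha> m * \<psi> m s)"
      using \<open>g \<in> V\<close> unfolding V_def mem_Collect_eq by (elim exE conjE)
    obtain N \<beta> where b: "\<forall>m\<ge>N. \<beta> m = 0" "\<forall>s. h s = (\<Sum>m<N. \<beta> m * \<psi> m s)"
      using \<open>h \<in> V\<close> unfolding V_def mem_Collect_eq by (elim exE conjE)
    have "g s = (\<Sum>m<max M N. \<alpha> m * \<psi> m s)" for s
      unfolding a(2)[rule_format] by (rule sum.mono_neutral_left) (auto simp: a(1))
    moreover have "h s = (\<Sum>m<max M N. \<beta> m * \<psi> m s)" for s
      unfolding b(2)[rule_format] by (rule sum.mono_neutral_left) (auto simp: b(1))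
    ultimately have "g s + h s = (\<Sum>m<max M N. (\<alpha> m + \<beta> m) * \<psi> m s)" for s
      by (simp add: sum.distrib distrib_right)
    then show ?thesis
      unfolding V_def using a(1) b(1)
      by (intro CollectI exI[of _ "max M N"] exI[of _ "\<lambda>m. \<alpha> m + \<beta> m"]) auto
  qed
  have V_smult: "(\<lambda>s. c * h s) \<in> V" if "h \<in> V" for h c
  proof -
    obtain M \<alpha> where a: "\<forall>m\<ge>M. \<alpha> m = 0" "\<forall>s. h s = (\<Sum>m<M. \<alpha> m * \<psi> m s)"
      using \<open>h \<in> V\<close> unfolding V_def mem_Collect_eq by (elim exE conjE)
    show ?thesis
      unfolding V_def using a
      by (intro CollectI exI[of _ M] exI[of _ "\<lambda>m. c * \<alpha> m"]) (auto simp: sum_distrib_left mult.assoc)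
  qed
  have V_sum: "(\<lambda>s. \<Sum>i\<in>I. h i s) \<in> V" if "finite I" "\<And>i. i \<in> I \<Longrightarrow> h i \<in> V" for I :: "nat set" and h
    using that
  proof (induction I rule: finite_induct)
    case empty
    show ?case unfolding V_def by (intro CollectI exI[of _ 0] exI[of _ "\<lambda>_. 0"]) auto
  next
    case (insert i I)
    then show ?case using V_add[of "h i" "\<lambda>s. \<Sum>i\<in>I. h i s"] by simp
  qed
  have V_mode: "\<psi> m \<in> V" for m
    unfolding V_def
  proof (intro CollectI exI[of _ "Suc m"] exI[of _ "\<lambda>i. if i = m then 1 else 0"] conjI allI impI)
    have "(\<Sum>i<m. (if i = m then 1 else 0) * \<psi> i s) = 0" for s by (intro sum.neutral) auto
    then show "\<psi> m s = (\<Sum>i<Suc m. (if i = m then 1 else 0) * \<psi> i s)" for s by simp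
  qed auto
  define C where "C s = cos (pi * (L - s) / L)" for s
  have V_cos: "(\<lambda>s. of_real (C s) * h s) \<in> V" if "h \<in> V" for h
  proof -
    obtain M \<alpha> where a: "\<forall>s. h s = (\<Sum>m<M. \<alpha> m * \<psi> m s)"
      using \<open>h \<in> V\<close> unfolding V_def mem_Collect_eq by (elim exE conjE)
    have "(\<lambda>s. of_real (C s) * \<psi> m s) \<in> V" for m
    proof -
      obtain a i b j where "\<And>s. of_real (C s) * \<psi> m s = a * \<psi> i s + b * \<psi> j s"
        using step[of m] by (auto simp: C_def)
      then show ?thesis using V_add[OF V_smult[OF V_mode] V_smult[OF V_mode], of a i b j] by simp
    qed
    then have "(\<lambda>s. \<Sum>m<M. \<alpha> m * (of_real (C s) * \<psi> m s)) \<in> V"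
      by (intro V_sum V_smult) auto
    then show ?thesis unfolding a[rule_format] by (simp add: sum_distrib_left mult_ac)
  qed
  have V_pow: "(\<lambda>s. of_real (C s) ^ i * \<psi> m0 s) \<in> V" for i
  proof (induction i)
    case (Suc i)
    then show ?case using V_cos[OF Suc] by (simp add: mult.assoc)
  qed (simp add: V_mode)
  obtain h d where h: "continuous_on UNIV h" "\<And>x. x \<notin> {d<..<L-d} \<Longrightarrow> h x = 0" "d > 0"
    and he: "L2_norm L (\<lambda>x. f x - h x) < e / 2"
    by (rule L2_approx_continuous[OF f L half_gt_zero[OF e]]) blast
  \<comment> \<open>\<open>\<psi> m0\<close> may vanish at the endpoints, where \<open>h\<close> is already zero.\<close>
  define q where "q s = (if s \<in> {d..L-d} then h s / \<psi> m0 s else 0)" for s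
  have "continuous_on ({d..L-d} \<union> ({..d} \<union> {L-d..})) q"
    unfolding q_def
  proof (rule continuous_on_cases)
    show "continuous_on {d..L - d} (\<lambda>s. h s / \<psi> m0 s)"
      using nz h(3) by (intro continuous_intros continuous_on_subset[OF h(1)] continuous_on_subset[OF cont]) auto
    have "h d = 0" "h (L - d) = 0" using h(2) by auto
    then show "\<forall>x. x \<in> {d..L - d} \<and> x \<notin> {d..L - d} \<or> x \<in> {..d} \<union> {L - d..} \<and> x \<in> {d..L - d} \<longrightarrow>
        h x / \<psi> m0 x = 0"
      using h(2) by auto
  qed (auto intro: closed_Un)
  then have q: "continuous_on {0..L} q" 
    by (rule continuous_on_subset) auto
  have hq: "h s = \<psi> m0 s * q s" if "s \<in> {0..L}" for s
    using nz[of s] h(2)[of s] h(3) by (cases "s \<in> {d..L-d}") (auto simp: q_def)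
  define r where "r y = q (L - L * arccos y / pi)" for y
  have r: "continuous_on {-1..1} r"
    unfolding r_def
  proof (rule continuous_on_compose2[OF q])
    show "continuous_on {-1..1} (\<lambda>y. L - L * arccos y / pi)"
      by (intro continuous_intros) auto
    show "(\<lambda>y. L - L * arccos y / pi) ` {-1..1} \<subseteq> {0..L}"
      using L arccos_lbound arccos_ubound by (auto simp: field_simps)
  qed
  have rC: "r (C s) = q s" if "s \<in> {0..L}" for s
  proof -
    have "pi * (L - s) / L \<ge> 0" "pi * (L - s) / L \<le> pi"
      using that L by (auto simp: field_simps)
    then have "arccos (C s) = pi * (L - s) / L" unfolding C_def by (rule arccos_cos)
    then show ?thesis using L by (simp add: r_def)
  qed
  obtain B where B: "\<And>s. s \<in> {0..L} \<Longrightarrow> norm (\<psi> m0 s) \<le> B"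
    using compact_imp_bounded[OF compact_continuous_image[OF continuous_on_subset[OF cont subset_UNIV, of _ m0]  compact_Icc], of 0 L]
    unfolding bounded_iff by blast
  have B0: "B \<ge> 0" using order_trans[OF norm_ge_zero B[of 0]] L by simp
  define \<eta> where "\<eta> = e / (8 * (sqrt L * (B + 1)))"
  have \<eta>: "\<eta> > 0" using e L B0 by (simp add: \<eta>_def)
  have "\<exists>a n. \<forall>y\<in>{-1..1}. \<bar>g y - (\<Sum>i\<le>n. a i * y ^ i)\<bar> < \<eta>" if "continuous_on {-1..1} g" for g :: "real \<Rightarrow> real"
  proof -
    have "\<exists>p. real_polynomial_function p \<and> (\<forall>y\<in>{-1..1}. \<bar>g y - p y\<bar> < \<eta>)"
      by (rule Stone_Weierstrass_real_polynomial_function[OF compact_Icc that \<eta>]) blast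
    then obtain p where p: "real_polynomial_function p" "\<forall>y\<in>{-1..1}. \<bar>g y - p y\<bar> < \<eta>" by blast
    then obtain a n where "p = (\<lambda>x. \<Sum>i\<le>n. a i * x ^ i)"
      by (auto simp: real_polynomial_function_iff_sum)
    then show ?thesis using p(2) by blast
  qed
  note poly = this
  obtain a n where a: "\<And>y. y \<in> {-1..1} \<Longrightarrow> \<bar>Re (r y) - (\<Sum>i\<le>n. a i * y ^ i)\<bar> < \<eta>"
    using poly[OF continuous_on_Re[OF r]] by blast
  obtain b n' where b: "\<And>y. y \<in> {-1..1} \<Longrightarrow> \<bar>Im (r y) - (\<Sum>i\<le>n'. b i * y ^ i)\<bar> < \<eta>"
    using poly[OF continuous_on_Im[OF r]] by blast
  define P where "P y = complex_of_real (\<Sum>i\<le>n. a i * y ^ i) + \<i> * complex_of_real (\<Sum>i\<le>n'. b i * y ^ i)" for y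
  have rP: "norm (r y - P y) \<le> 2 * \<eta>" if "y \<in> {-1..1}" for y
    using order_trans[OF cmod_le, of "r y - P y" "2 * \<eta>"] a[OF that] b[OF that] by (simp add: P_def)
  have PV: "(\<lambda>s. \<psi> m0 s * P (C s)) \<in> V"
  proof -
    have "(\<lambda>s. (\<Sum>i\<le>n. of_real (a i) * (of_real (C s) ^ i * \<psi> m0 s)) + \<i> * (\<Sum>i\<le>n'. of_real (b i) * (of_real (C s) ^ i * \<psi> m0 s))) \<in> V"
      by (intro V_add V_smult V_sum V_pow) auto
    then show ?thesis by (simp add: P_def algebra_simps sum_distrib_left)
  qed
  then obtain M \<alpha> where al: "\<forall>s. \<psi> m0 s * P (C s) = (\<Sum>m<M. \<alpha> m * \<psi> m s)"
    unfolding V_def mem_Collect_eq by (elim exE conjE)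
  have contS: "continuous_on UNIV (\<lambda>s. \<Sum>m<M. \<alpha> m * \<psi> m s)" by (intro continuous_intros cont)
  have S2: "L2 L (\<lambda>s. \<Sum>m<M. \<alpha> m * \<psi> m s)" and h2: "L2 L h"
    using contS h(1) by (auto intro: L2_continuous continuous_on_subset)
  have "L2_norm L (\<lambda>s. h s - (\<Sum>m<M. \<alpha> m * \<psi> m s)) \<le> sqrt L * (B * (2 * \<eta>))"
  proof (rule L2_norm_bounded)
    show "L2 L (\<lambda>s. h s - (\<Sum>m<M. \<alpha> m * \<psi> m s))" using h2 S2 by (rule L2_diff)
    fix s assume s: "s \<in> {0..L}"
    have "h s - (\<Sum>m<M. \<alpha> m * \<psi> m s) = \<psi> m0 s * (r (C s) - P (C s))"
      by (simp add: al[rule_format, symmetric] hq[OF s] rC[OF s] algebra_simps)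
    also have "norm \<dots> \<le> B * (2 * \<eta>)"
      unfolding norm_mult using B[OF s] rP[of "C s"] B0 by (intro mult_mono) (auto simp: C_def)
    finally show "norm (h s - (\<Sum>m<M. \<alpha> m * \<psi> m s)) \<le> B * (2 * \<eta>)" .
  qed (use L B0 \<eta> in auto)
  also have "\<dots> = B / (B + 1) * (e / 4)" using L B0 by (simp add: \<eta>_def)
  also have "\<dots> \<le> 1 * (e / 4)" using B0 e by (intro mult_right_mono) auto
  finally have he2: "L2_norm L (\<lambda>s. h s - (\<Sum>m<M. \<alpha> m * \<psi> m s)) < e / 2" using e by simp
  have "L2_norm L (\<lambda>s. f s - (\<Sum>m<M. \<alpha> m * \<psi> m s)) \<le>
      L2_norm L (\<lambda>s. (f s - (\<Sum>m<M. \<alpha> m * \<psi> m s)) - (h s - (\<Sum>m<M. \<alpha> m * \<psi> m s)))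
       + L2_norm L (\<lambda>s. h s - (\<Sum>m<M. \<alpha> m * \<psi> m s))"
    by (intro L2_norm_triangle L2_diff f h2 S2)
  then show thesis using he he2 by (intro that[where M=M and \<alpha>=\<alpha>]) simp
qed

lemma L2_norm_orthogonal_sum:
  fixes \<psi> :: "nat \<Rightarrow> real \<Rightarrow> complex"
  assumes \<psi>: "\<And>m. L2 L (\<psi> m)"
    and orth: "\<And>i j. i \<noteq> j \<Longrightarrow> L2_inner L (\<psi> i) (\<psi> j) = 0"
  shows "(L2_norm L (\<lambda>s. \<Sum>m<M. \<alpha> m * \<psi> m s))\<^sup>2 = (\<Sum>m<M. (norm (\<alpha> m))\<^sup>2 * (L2_norm L (\<psi> m))\<^sup>2)"
proof -
  let ?p = "\<lambda>s. \<Sum>m<M. \<alpha> m * \<psi> m s"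
  have "L2_inner L ?p ?p = (\<Sum>m<M. \<Sum>n<M. cnj (\<alpha> m) * (\<alpha> n * L2_inner L (\<psi> n) (\<psi> m)))"
    using \<psi>
    by (simp add: L2_inner_sum_right L2_inner_sum_left L2_sum L2_smult L2_inner_smult_right L2_inner_smult sum_distrib_left)
  also have "\<dots> = (\<Sum>m<M. \<Sum>n<M. if n = m then of_real ((norm (\<alpha> m))\<^sup>2 * (L2_norm L (\<psi> m))\<^sup>2) else 0)"
  proof (intro sum.cong refl)
    fix m n
    have "cnj (\<alpha> m) * (\<alpha> m * L2_inner L (\<psi> m) (\<psi> m)) = of_real ((norm (\<alpha> m))\<^sup>2 * (L2_norm L (\<psi> m))\<^sup>2)"
      unfolding L2_inner_self of_real_mult complex_norm_square by (simp only: mult_ac)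
    then show "cnj (\<alpha> m) * (\<alpha> n * L2_inner L (\<psi> n) (\<psi> m)) = (if n = m then of_real ((norm (\<alpha> m))\<^sup>2 * (L2_norm L (\<psi> m))\<^sup>2) else 0)"
      using orth[of n m] by auto
  qed
  also have "\<dots> = of_real (\<Sum>m<M. (norm (\<alpha> m))\<^sup>2 * (L2_norm L (\<psi> m))\<^sup>2)"
    unfolding of_real_sum by (intro sum.cong refl) (simp add: sum.delta del: of_real_mult of_real_power)
  finally show "(L2_norm L ?p)\<^sup>2 = (\<Sum>m<M. (norm (\<alpha> m))\<^sup>2 * (L2_norm L (\<psi> m))\<^sup>2)"
    unfolding L2_inner_self of_real_eq_iff .
qed

text \<open>Completing the square.  A member of the family need not be normalized if its coefficient vanishes:
  this admits the null function among the sines and the constant among the cosines for \<open>k = 0\<close>, so that all modes can be indexed by \<open>0, 1, 2, ...\<close> for both boundary conditions.\<close>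

lemma L2_norm_expansion_error:
  fixes \<psi> :: "nat \<Rightarrow> real \<Rightarrow> complex"
  assumes f: "L2 L f" and \<psi>: "\<And>m. L2 L (\<psi> m)"
    and orth: "\<And>i j. i \<noteq> j \<Longrightarrow> L2_inner L (\<psi> i) (\<psi> j) = 0"
    and nrm: "\<And>m. L2_norm L (\<psi> m) = 1 \<or> L2_inner L f (\<psi> m) = 0"
  shows "(L2_norm L f)\<^sup>2 - (\<Sum>m<M. (norm (L2_inner L f (\<psi> m)))\<^sup>2) \<le> 
      (L2_norm L (\<lambda>s. f s - (\<Sum>m<M. \<alpha> m * \<psi> m s)))\<^sup>2"
    and "\<alpha> = (\<lambda>m. L2_inner L f (\<psi> m)) \<Longrightarrow> (L2_norm L f)\<^sup>2 - (\<Sum>m<M. (norm (L2_inner L f (\<psi> m)))\<^sup>2) =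
      (L2_norm L (\<lambda>s. f s - (\<Sum>m<M. \<alpha> m * \<psi> m s)))\<^sup>2"
proof -
  define c where "c m = L2_inner L f (\<psi> m)" for m
  define p where "p s = (\<Sum>m<M. \<alpha> m * \<psi> m s)" for s
  have p: "L2 L p" unfolding p_def by (intro L2_sum L2_smult \<psi>)
  have fp: "L2_inner L f p = (\<Sum>m<M. cnj (\<alpha> m) * c m)"
    unfolding p_def using f \<psi> by (simp add: L2_inner_sum_right L2_smult L2_inner_smult_right c_def)
  have pp: "(L2_norm L p)\<^sup>2 = (\<Sum>m<M. (norm (\<alpha> m))\<^sup>2 * (L2_norm L (\<psi> m))\<^sup>2)"
    unfolding p_def using \<psi> orth by (rule L2_norm_orthogonal_sum)
  have eq: "(L2_norm L (\<lambda>s. f s - p s))\<^sup>2 = (L2_norm L f)\<^sup>2 - (\<Sum>m<M. (norm (c m))\<^sup>2) +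
      (\<Sum>m<M. (norm (\<alpha> m))\<^sup>2 * (L2_norm L (\<psi> m))\<^sup>2 - 2 * Re (cnj (\<alpha> m) * c m) + (norm (c m))\<^sup>2)"
    unfolding L2_norm_sub_square[OF f p] pp fp by (simp add: sum.distrib sum_subtractf sum_distrib_left)
  have trm: "(norm (\<alpha> m))\<^sup>2 * (L2_norm L (\<psi> m))\<^sup>2 - 2 * Re (cnj (\<alpha> m) * c m) + (norm (c m))\<^sup>2
      = (if c m = 0 then (norm (\<alpha> m))\<^sup>2 * (L2_norm L (\<psi> m))\<^sup>2 else (norm (\<alpha> m - c m))\<^sup>2)" for m
    using nrm[of m] unfolding cmod_power2 by (auto simp: c_def power2_eq_square algebra_simps)
  show "(L2_norm L f)\<^sup>2 - (\<Sum>m<M. (norm (L2_inner L f (\<psi> m)))\<^sup>2) \<le> 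
      (L2_norm L (\<lambda>s. f s - (\<Sum>m<M. \<alpha> m * \<psi> m s)))\<^sup>2"
    using eq unfolding trm p_def c_def[symmetric] by (simp add: sum_nonneg)
  show "(L2_norm L f)\<^sup>2 - (\<Sum>m<M. (norm (L2_inner L f (\<psi> m)))\<^sup>2) =
      (L2_norm L (\<lambda>s. f s - (\<Sum>m<M. \<alpha> m * \<psi> m s)))\<^sup>2" if a: "\<alpha> = (\<lambda>m. L2_inner L f (\<psi> m))"
  proof -
    have "(\<Sum>m<M. if c m = 0 then (norm (\<alpha> m))\<^sup>2 * (L2_norm L (\<psi> m))\<^sup>2 else (norm (\<alpha> m - c m))\<^sup>2) = 0"
      by (intro sum.neutral) (auto simp: a c_def)
    then show ?thesis using eq unfolding trm p_def c_def[symmetric] by simp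
  qed
qed

lemma Parseval_of_density:
  fixes \<psi> :: "nat \<Rightarrow> real \<Rightarrow> complex"
  assumes f: "L2 L f" and \<psi>: "\<And>m. L2 L (\<psi> m)"
    and orth: "\<And>i j. i \<noteq> j \<Longrightarrow> L2_inner L (\<psi> i) (\<psi> j) = 0"
    and nrm: "\<And>m. L2_norm L (\<psi> m) = 1 \<or> L2_inner L f (\<psi> m) = 0"
    and dense: "\<And>e. e > 0 \<Longrightarrow> \<exists>M \<alpha>. L2_norm L (\<lambda>s. f s - (\<Sum>m<M. \<alpha> m * \<psi> m s)) < e"
  shows "(\<lambda>m. (norm (L2_inner L f (\<psi> m)))\<^sup>2) sums (L2_norm L f)\<^sup>2"
  unfolding sums_def
proof (rule increasing_LIMSEQ)
  let ?S = "\<lambda>M. \<Sum>m<M. (norm (L2_inner L f (\<psi> m)))\<^sup>2"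
  show "?S n \<le> ?S (Suc n)" for n by simp
  show "?S M \<le> (L2_norm L f)\<^sup>2" for M
    using L2_norm_expansion_error(2)[where f=f and \<psi>=\<psi> and M=M, OF f \<psi> orth nrm refl]
      zero_le_power2[of "L2_norm L (\<lambda>s. f s - (\<Sum>m<M. L2_inner L f (\<psi> m) * \<psi> m s))"] by linarith
  fix e :: real assume e: "e > 0"
  then obtain M \<alpha> where "L2_norm L (\<lambda>s. f s - (\<Sum>m<M. \<alpha> m * \<psi> m s)) < sqrt e"
    using dense[of "sqrt e"] by auto
  then have "(L2_norm L (\<lambda>s. f s - (\<Sum>m<M. \<alpha> m * \<psi> m s)))\<^sup>2 \<le> e"
    using L2_norm_nonneg e by (metis less_imp_le power_mono real_sqrt_pow2)
  then show "\<exists>n. (L2_norm L f)\<^sup>2 \<le> ?S n + e"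
    using L2_norm_expansion_error(1)[where f=f and \<psi>=\<psi> and M=M and \<alpha>=\<alpha>, OF f \<psi> orth nrm] by (intro exI[of _ M]) linarith
qed

section \<open>The eigenmodes\<close>

text \<open>Frequencies for the Dirichlet (\<open>k = 0\<close>) and the Neumann (\<open>k = 1\<close>) condition at \<open>0\<close>.  For \<open>k = 0\<close> the
  index \<open>0\<close> belongs to the null function.\<close>

definition freq :: "nat \<Rightarrow> real \<Rightarrow> nat \<Rightarrow> real" where
  "freq k L m = (real m + real k / 2) * pi / L"

text \<open>The modes are written in terms of the distance to the observed endpoint \<open>L\<close>, where both boundary
  conditions look the same.\<close>

definition smode :: "nat \<Rightarrow> real \<Rightarrow> nat \<Rightarrow> real \<Rightarrow> complex" where
  "smode k L m s = of_real (sqrt (2 / L) * sin (freq k L m * (L - s)))"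

definition cmode :: "nat \<Rightarrow> real \<Rightarrow> nat \<Rightarrow> real \<Rightarrow> complex" where
  "cmode k L m s = of_real (sqrt (2 / L) * cos (freq k L m * (L - s)))"

lemma LINT_FTC:
  fixes p p' :: "real \<Rightarrow> complex"
  assumes "\<And>x. (p has_vector_derivative p' x) (at x)" "continuous_on UNIV p'" "a \<le> b"
  shows "(LINT x:{a..b}|lborel. p' x) = p b - p a"
proof -
  have "(p' has_integral (p b - p a)) {a..b}"
    using assms(3) by (intro fundamental_theorem_of_calculus)
       (auto intro: has_vector_derivative_at_within assms)
  then show ?thesis
    using set_borel_integral_eq_integral(2)[OF borel_integrable_atLeastAtMost'[OF continuous_on_subset[OF assms(2) subset_UNIV], of a b]]
    by (simp add: integral_unique)
qed

lemma of_real_has_vector_derivative: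
  assumes "(f has_real_derivative f') (at x within A)"
  shows "((\<lambda>x. complex_of_real (f x)) has_vector_derivative of_real f') (at x within A)"
  using assms by (intro has_vector_derivative_of_real) (simp add: has_real_derivative_iff_has_vector_derivative)

lemma smode_deriv: "(smode k L m has_vector_derivative - of_real (freq k L m) * cmode k L m s) (at s)"
proof -
  have "((\<lambda>s. sqrt (2 / L) * sin (freq k L m * (L - s))) has_real_derivative
      - freq k L m * (sqrt (2 / L) * cos (freq k L m * (L - s)))) (at s)"
    by (auto intro!: derivative_eq_intros)
  from of_real_has_vector_derivative[OF this] show ?thesis
    by (simp add: smode_def[abs_def] cmode_def)
qed

lemma cmode_deriv: "(cmode k L m has_vector_derivative of_real (freq k L m) * smode k L m s) (at s)"
proof -
  have "((\<lambda>s. sqrt (2 / L) * cos (freq k L m * (L - s))) has_real_derivative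
      freq k L m * (sqrt (2 / L) * sin (freq k L m * (L - s)))) (at s)"
    by (auto intro!: derivative_eq_intros)
  from of_real_has_vector_derivative[OF this] show ?thesis
    by (simp add: cmode_def[abs_def] smode_def)
qed

lemma mode_continuous: "continuous_on A (smode k L m)" "continuous_on A (cmode k L m)"
  unfolding smode_def cmode_def by (intro continuous_intros)+

lemma L2_modes: "L2 L (smode k L m)" "L2 L (cmode k L m)"
  by (intro L2_continuous mode_continuous)+

lemma LINT_cos_multiple:
  fixes j :: int
  assumes "L > 0"
  shows "(LINT s:{0..L}|lborel. complex_of_real (cos (of_int j * pi / L * (L - s)))) = (if j = 0 then of_real L else 0)"
proof (cases "j = 0")
  case True
  then show ?thesis using assms by (simp add: set_lebesgue_integral_def scaleR_conv_of_real)
next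
  case False
  define c where "c = of_int j * pi / L"
  have c: "c \<noteq> 0" using False assms by (simp add: c_def)
  have "(LINT s:{0..L}|lborel. complex_of_real (cos (c * (L - s)))) =
      of_real (- sin (c * (L - L)) / c) - of_real (- sin (c * (L - 0)) / c)"
  proof (rule LINT_FTC)
    show "((\<lambda>s. complex_of_real (- sin (c * (L - s)) / c)) has_vector_derivative complex_of_real (cos (c * (L - x)))) (at x)" for x
      using c by (intro of_real_has_vector_derivative) (auto intro!: derivative_eq_intros)
  qed (use assms in \<open>auto intro!: continuous_intros\<close>)
  also have "c * (L - 0) = pi * of_int j" using assms by (simp add: c_def)
  then have "sin (c * (L - 0)) = 0" by (simp add: sin_times_pi_eq_0)
  finally show ?thesis using False by (simp add: c_def)
qed

lemma mode_inner:
  assumes L: "L > 0" and k: "k \<in> {0, 1}"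
  shows "L2_inner L (smode k L m) (smode k L n) = (if m = n \<and> m + k \<noteq> 0 then 1 else 0)"
    and "L2_inner L (cmode k L m) (cmode k L n) = (if m = n then if m + k = 0 then 2 else 1 else 0)"
proof -
  define u where "u j s = complex_of_real (cos (of_int j * pi / L * (L - s)))" for j s
  have I: "set_integrable lborel {0..L} (\<lambda>s. c * u j s)" for c j
    unfolding u_def by (intro borel_integrable_atLeastAtMost' continuous_intros)
  have U: "(LINT s:{0..L}|lborel. u j s) = (if j = 0 then of_real L else 0)" for j
    unfolding u_def by (rule LINT_cos_multiple[OF L])
  have sq: "sqrt (2 / L) * sqrt (2 / L) = 2 / L" using L by simp
  have a1: "freq k L m * r - freq k L n * r = of_int (int m - int n) * pi / L * r"
    and a2: "freq k L m * r + freq k L n * r = of_int (int m + int n + int k) * pi / L * r" for r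
    using L by (simp_all add: freq_def field_simps)
  have "smode k L m s * cnj (smode k L n s) = (1 / of_real L) * u (int m - int n) s - (1 / of_real L) * u (int m + int n + int k) s" for s
  proof -
    have "smode k L m s * cnj (smode k L n s) = of_real ((sqrt (2 / L) * sqrt (2 / L)) * (sin (freq k L m * (L - s)) * sin (freq k L n * (L - s))))"
      unfolding smode_def complex_cnj_complex_of_real of_real_mult[symmetric] by (simp only: mult_ac)
    also have "\<dots> = of_real ((2 / L) * ((cos (freq k L m * (L - s) - freq k L n * (L - s)) - cos (freq k L m * (L - s) + freq k L n * (L - s))) / 2))"
      unfolding sq sin_times_sin ..
    also have "\<dots> = (1 / of_real L) * u (int m - int n) s - (1 / of_real L) * u (int m + int n + int k) s"
      unfolding a1 a2 u_def using L by (simp add: field_simps)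
    finally show ?thesis .
  qed
  then have "L2_inner L (smode k L m) (smode k L n) = (1 / of_real L) * (LINT s:{0..L}|lborel. u (int m - int n) s)
      - (1 / of_real L) * (LINT s:{0..L}|lborel. u (int m + int n + int k) s)"
    unfolding L2_inner_def by (simp only: set_integral_diff[OF I I] set_integral_mult_right)
  then show "L2_inner L (smode k L m) (smode k L n) = (if m = n \<and> m + k \<noteq> 0 then 1 else 0)"
    unfolding U using L by auto
  have "cmode k L m s * cnj (cmode k L n s) = (1 / of_real L) * u (int m - int n) s + (1 / of_real L) * u (int m + int n + int k) s" for s
  proof -
    have "cmode k L m s * cnj (cmode k L n s) = of_real ((sqrt (2 / L) * sqrt (2 / L)) * (cos (freq k L m * (L - s)) * cos (freq k L n * (L - s))))"
      unfolding cmode_def complex_cnj_complex_of_real of_real_mult[symmetric] by (simp only: mult_ac)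
    also have "\<dots> = of_real ((2 / L) * ((cos (freq k L m * (L - s) - freq k L n * (L - s)) + cos (freq k L m * (L - s) + freq k L n * (L - s))) / 2))"
      unfolding sq cos_times_cos ..
    also have "\<dots> = (1 / of_real L) * u (int m - int n) s + (1 / of_real L) * u (int m + int n + int k) s"
      unfolding a1 a2 u_def using L by (simp add: field_simps)
    finally show ?thesis .
  qed
  then have "L2_inner L (cmode k L m) (cmode k L n) = (1 / of_real L) * (LINT s:{0..L}|lborel. u (int m - int n) s)
      + (1 / of_real L) * (LINT s:{0..L}|lborel. u (int m + int n + int k) s)"
    unfolding L2_inner_def by (simp only: set_integral_add[OF I I] set_integral_mult_right)
  then show "L2_inner L (cmode k L m) (cmode k L n) = (if m = n then if m + k = 0 then 2 else 1 else 0)"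
    unfolding U using L by auto
qed

lemma freq_pos: "L > 0 \<Longrightarrow> m + k \<noteq> 0 \<Longrightarrow> freq k L m > 0"
  by (auto simp: freq_def field_simps add_nonneg_pos add_pos_nonneg)

lemma freq_zero: "freq 0 L 0 = 0" by (simp add: freq_def)

lemma mode_boundary:
  assumes L: "L > 0" and k: "k \<in> {0, 1}"
  shows "smode k L m L = 0" "cmode k L m L = of_real (sqrt (2 / L))"
    and "k = 0 \<Longrightarrow> smode k L m 0 = 0" "k = 1 \<Longrightarrow> cmode k L m 0 = 0"
proof -
  show "smode k L m L = 0" "cmode k L m L = of_real (sqrt (2 / L))" by (simp_all add: smode_def cmode_def)
  have "freq 0 L m * L = of_int (int m) * pi" using L by (simp add: freq_def)
  then have "sin (freq 0 L m * L) = 0" by (auto simp: sin_zero_iff_int2 simp del: of_int_of_nat_eq)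
  then show "k = 0 \<Longrightarrow> smode k L m 0 = 0" by (simp add: smode_def)
  have "freq 1 L m * L = of_int (int m) * pi + pi / 2" using L by (simp add: freq_def field_simps)
  then have "cos (freq 1 L m * L) = 0" by (auto simp: cos_zero_iff_int2 simp del: of_int_of_nat_eq)
  then show "k = 1 \<Longrightarrow> cmode k L m 0 = 0" by (simp add: cmode_def)
qed

text \<open>The third identity treats the index below \<open>0\<close>, where the frequency is reflected back.\<close>

lemma freq_shift:
  assumes L: "L > 0"
  shows "pi * (L - s) / L + freq k L m * (L - s) = freq k L (Suc m) * (L - s)"
    "pi * (L - s) / L - freq k L (Suc m) * (L - s) = - (freq k L m * (L - s))"
    "k \<in> {0,1} \<Longrightarrow> pi * (L - s) / L - freq k L 0 * (L - s) = freq k L (if k = 0 then 1 else 0) * (L - s)"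
  using L by (auto simp: freq_def field_simps)

lemma smode_step:
  assumes L: "L > 0" and k: "k \<in> {0, 1}"
  shows "\<exists>a i b j. \<forall>s. of_real (cos (pi * (L - s) / L)) * smode k L m s = a * smode k L i s + b * smode k L j s"
proof (cases m)
  case 0
  have "of_real (cos (pi * (L - s) / L)) * smode k L m s = (1/2) * smode k L 1 s + (-1/2) * smode k L (if k = 0 then 1 else 0) s" for s
  proof -
    have "of_real (cos (pi * (L - s) / L)) * smode k L m s = of_real (sqrt (2/L) * (cos (pi * (L - s) / L) * sin (freq k L 0 * (L - s))))"
      by (simp add: smode_def 0 mult_ac)
    also have "\<dots> = (1/2) * smode k L 1 s + (-1/2) * smode k L (if k = 0 then 1 else 0) s"
      unfolding cos_times_sin freq_shift(1)[OF L] freq_shift(3)[OF L k] by (simp add: smode_def field_simps)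
    finally show ?thesis .
  qed
  then show ?thesis by blast
next
  case (Suc n)
  have "of_real (cos (pi * (L - s) / L)) * smode k L m s = (1/2) * smode k L (Suc m) s + (1/2) * smode k L n s" for s
  proof -
    have "of_real (cos (pi * (L - s) / L)) * smode k L m s = of_real (sqrt (2/L) * (cos (pi * (L - s) / L) * sin (freq k L (Suc n) * (L - s))))"
      by (simp add: smode_def Suc mult_ac)
    also have "\<dots> = (1/2) * smode k L (Suc m) s + (1/2) * smode k L n s"
      unfolding cos_times_sin freq_shift(1,2)[OF L] sin_minus by (simp add: smode_def Suc field_simps)
    finally show ?thesis .
  qed
  then show ?thesis by blast
qed

lemma cmode_step:
  assumes L: "L > 0" and k: "k \<in> {0, 1}"
  shows "\<exists>a i b j. \<forall>s. of_real (cos (pi * (L - s) / L)) * cmode k L m s = a * cmode k L i s + b * cmode k L j s"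
proof (cases m)
  case 0
  have "of_real (cos (pi * (L - s) / L)) * cmode k L m s = (1/2) * cmode k L (if k = 0 then 1 else 0) s + (1/2) * cmode k L 1 s" for s
  proof -
    have "of_real (cos (pi * (L - s) / L)) * cmode k L m s = of_real (sqrt (2/L) * (cos (pi * (L - s) / L) * cos (freq k L 0 * (L - s))))"
      by (simp add: cmode_def 0 mult_ac)
    also have "\<dots> = (1/2) * cmode k L (if k = 0 then 1 else 0) s + (1/2) * cmode k L 1 s"
      unfolding cos_times_cos freq_shift(1)[OF L] freq_shift(3)[OF L k] by (simp add: cmode_def field_simps)
    finally show ?thesis .
  qed
  then show ?thesis by blast
next
  case (Suc n)
  have "of_real (cos (pi * (L - s) / L)) * cmode k L m s = (1/2) * cmode k L n s + (1/2) * cmode k L (Suc m) s" for s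
  proof -
    have "of_real (cos (pi * (L - s) / L)) * cmode k L m s = of_real (sqrt (2/L) * (cos (pi * (L - s) / L) * cos (freq k L (Suc n) * (L - s))))"
      by (simp add: cmode_def Suc mult_ac)
    also have "\<dots> = (1/2) * cmode k L n s + (1/2) * cmode k L (Suc m) s"
      unfolding cos_times_cos freq_shift(1,2)[OF L] cos_minus by (simp add: cmode_def Suc field_simps)
    finally show ?thesis .
  qed
  then show ?thesis by blast
qed

lemma smode_nonzero:
  assumes L: "L > 0" and k: "k \<in> {0, 1}" and s: "0 < s" "s < L"
  shows "smode k L (1 - k) s \<noteq> 0" "cmode k L 0 s \<noteq> 0"
proof -
  have r: "0 < (L - s) / L" "(L - s) / L < 1" using L s by auto
  have "0 < freq k L (1 - k) * (L - s)" 
    using freq_pos[OF L, of "1 - k" k] k s by (auto intro!: mult_pos_pos)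
  moreover have "freq k L (1 - k) * (L - s) \<le> pi * ((L - s) / L)"
    using k L s by (auto simp: freq_def field_simps)
  moreover have "pi * ((L - s) / L) < pi * 1" by (intro mult_strict_left_mono r) auto
  ultimately have "sin (freq k L (1 - k) * (L - s)) > 0" by (intro sin_gt_zero) auto
  then show "smode k L (1 - k) s \<noteq> 0" using L by (simp add: smode_def)
  have "0 \<le> freq k L 0 * (L - s)" using L s by (simp add: freq_def)
  moreover have "freq k L 0 * (L - s) \<le> pi / 2 * ((L - s) / L)"
    using k L s by (auto simp: freq_def field_simps)
  moreover have "pi / 2 * ((L - s) / L) < pi / 2 * 1" by (intro mult_strict_left_mono r) auto
  ultimately have "0 \<le> freq k L 0 * (L - s)" "freq k L 0 * (L - s) < pi / 2" by linarith+
  then have "cos (freq k L 0 * (L - s)) > 0" using pi_gt_zero by (intro cos_gt_zero_pi) linarith+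
  then show "cmode k L 0 s \<noteq> 0" using L by (simp add: cmode_def)
qed

lemma Parseval_smode:
  assumes L: "L > 0" and k: "k \<in> {0, 1}" and f: "L2 L f"
  shows "(\<lambda>m. (norm (L2_inner L f (smode k L m)))\<^sup>2) sums (L2_norm L f)\<^sup>2"
proof (rule Parseval_of_density[OF f L2_modes(1)])
  show "i \<noteq> j \<Longrightarrow> L2_inner L (smode k L i) (smode k L j) = 0" for i j
    by (simp add: mode_inner[OF L k])
  fix m
  show "L2_norm L (smode k L m) = 1 \<or> L2_inner L f (smode k L m) = 0"
  proof (cases "m + k = 0")
    case True
    then have "smode k L m = (\<lambda>s. 0)" by (auto simp: smode_def freq_def)
    then show ?thesis by (simp add: L2_inner_def set_lebesgue_integral_def)
  next
    case False
    then show ?thesis by (simp add: L2_norm_eq_inner mode_inner[OF L k])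
  qed
next
  fix e :: real assume "e > 0"
  then obtain M \<alpha> where "L2_norm L (\<lambda>s. f s - (\<Sum>m<M. \<alpha> m * smode k L m s)) < e"
    by (rule L2_approx_trig_sum[OF f L _ mode_continuous(1) smode_step[OF L k] smode_nonzero(1)[OF L k]])
  then show "\<exists>M \<alpha>. L2_norm L (\<lambda>s. f s - (\<Sum>m<M. \<alpha> m * smode k L m s)) < e" by blast
qed

lemma Parseval_cmode:
  assumes L: "L > 0" and k: "k \<in> {0, 1}" and f: "L2 L f" 
    and 0: "k = 0 \<Longrightarrow> L2_inner L f (cmode k L 0) = 0"
  shows "(\<lambda>m. (norm (L2_inner L f (cmode k L m)))\<^sup>2) sums (L2_norm L f)\<^sup>2"
proof (rule Parseval_of_density[OF f L2_modes(2)])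
  show "i \<noteq> j \<Longrightarrow> L2_inner L (cmode k L i) (cmode k L j) = 0" for i j
    by (simp add: mode_inner[OF L k])
  show "L2_norm L (cmode k L m) = 1 \<or> L2_inner L f (cmode k L m) = 0" for m
    using 0 by (cases "m + k = 0") (auto simp: L2_norm_eq_inner mode_inner[OF L k])
next
  fix e :: real assume "e > 0"
  then obtain M \<alpha> where "L2_norm L (\<lambda>s. f s - (\<Sum>m<M. \<alpha> m * cmode k L m s)) < e"
    by (rule L2_approx_trig_sum[OF f L _ mode_continuous(2) cmode_step[OF L k] smode_nonzero(2)[OF L k]])
  then show "\<exists>M \<alpha>. L2_norm L (\<lambda>s. f s - (\<Sum>m<M. \<alpha> m * cmode k L m s)) < e" by blast
qed

section \<open>Weak solutions in terms of their modes\<close>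

lemma H1_continuous:
  assumes "has_weak_deriv L f g"
  shows "continuous_on {0..L} f"
proof -
  have g: "set_integrable lborel {0..L} g" using assms by (blast intro: L2_set_integrable has_weak_deriv_L2)
  have "continuous_on {0..L} (\<lambda>x. f 0 + integral {0..x} g)"
    using set_borel_integral_eq_integral(1)[OF g]
    by (intro continuous_intros indefinite_integral_continuous_1)
  moreover have "f x = f 0 + integral {0..x} g" if "x \<in> {0..L}" for x
    using has_weak_deriv_integral[OF assms that] that
      set_borel_integral_eq_integral(2)[OF set_integrable_subset[OF g, of "{0..x}"]]
    by (auto simp: diff_eq_eq add.commute)
  ultimately show ?thesis by (metis (no_types, lifting) continuous_on_cong)
qed

lemma cis_linear_deriv: "((\<lambda>t. cis (w * t)) has_vector_derivative (\<i> * of_real w * cis (w * t))) (at t within A)"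
proof -
  have "((\<lambda>t. exp (\<i> * w * of_real t)) has_vector_derivative (\<i> * w * exp (\<i> * w * of_real t))) (at t within A)"
    by (rule has_vector_derivative_real_field) (auto intro!: derivative_eq_intros)
  then show ?thesis by (simp add: cis_conv_exp mult.assoc)
qed

lemma weak_by_parts_left:
  fixes p p' :: "real \<Rightarrow> complex"
  assumes v: "has_weak_deriv L v g" and L: "L \<ge> 0"
    and p: "\<And>x. (p has_vector_derivative p' x) (at x)" and p': "continuous_on UNIV p'"
  shows "L2_inner L g p = v L * cnj (p L) - v 0 * cnj (p 0) - L2_inner L v p'"
  using arg_cong[OF weak_by_parts[OF assms], of cnj]
  by (simp add: L2_inner_cnj[of L p g] L2_inner_cnj[of L p' v])

lemma L2_inner_weak_deriv_smooth:
  assumes f: "has_weak_deriv L f f'" 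
    and p: "\<And>x. (p has_vector_derivative p' x) (at x)" and p': "continuous_on UNIV p'"
  shows "L2_inner L (weak_deriv L f) (weak_deriv L p) = L2_inner L (weak_deriv L f) p'"
proof -
  note pw = has_weak_deriv_C1[OF p p', of L]
  show ?thesis
    using weak_deriv_AE[OF f] weak_deriv_AE[OF pw] has_weak_deriv_L2[OF pw]
    by (intro L2_inner_cong_AE) (auto intro: has_weak_deriv_L2)
qed

locale observed_solution =
  fixes k :: nat and L T :: real and u0 :: "real \<Rightarrow> complex" and u :: "real \<Rightarrow> real \<Rightarrow> complex"
    and g :: "real \<Rightarrow> complex"
  assumes k: "k \<in> {0, 1}" and L: "L > 0" and T: "T > 0"
    and sol: "schrodinger_solution k L T u0 u" and trace: "neumann_trace L T u g"
begin

lemma u_H1k: "t \<ge> 0 \<Longrightarrow> u t \<in> H1k k L"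
  using sol by (simp add: schrodinger_solution_def)

lemma u_weak_deriv: "t \<ge> 0 \<Longrightarrow> has_weak_deriv L (u t) (weak_deriv L (u t))"
  using u_H1k[of t] weak_deriv_AE(2) by (auto simp: H1k_def H1_def)

lemma u_boundary: "t \<ge> 0 \<Longrightarrow> u t L = 0" "t \<ge> 0 \<Longrightarrow> k = 0 \<Longrightarrow> u t 0 = 0"
  using u_H1k[of t] by (auto simp: H1k_def)

lemma u_L2: "t \<ge> 0 \<Longrightarrow> L2 L (u t)"
  using H1_continuous[OF u_weak_deriv] L2_continuous by blast

lemma g_L2: "L2 T g"
  using trace by (simp add: neumann_trace_def)

lemma L2_inner_u_continuous:
  assumes v: "L2 L v"
  shows "continuous_on {0..} (\<lambda>t. L2_inner L (u t) v)"
  unfolding continuous_on_def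
proof
  fix t :: real assume "t \<in> {0..}"
  then have t: "t \<ge> 0" by simp
  have lim: "((\<lambda>\<tau>. H1_norm L (\<lambda>s. u \<tau> s - u t s)) \<longlongrightarrow> 0) (at t within {0..})"
    using sol t by (simp add: schrodinger_solution_def)
  have "((\<lambda>\<tau>. L2_inner L (u \<tau>) v - L2_inner L (u t) v) \<longlongrightarrow> 0) (at t within {0..})"
  proof (rule Lim_null_comparison)
    show "\<forall>\<^sub>F \<tau> in at t within {0..}. norm (L2_inner L (u \<tau>) v - L2_inner L (u t) v)
        \<le> H1_norm L (\<lambda>s. u \<tau> s - u t s) * L2_norm L v"
      unfolding eventually_at_filter
    proof (intro always_eventually allI impI)
      fix \<tau> :: real assume "\<tau> \<in> {0..}"
      then have "\<tau> \<ge> 0" by simp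
      then have "L2_inner L (u \<tau>) v - L2_inner L (u t) v = L2_inner L (\<lambda>s. u \<tau> s - u t s) v"
        using t v by (simp add: L2_inner_diff_left u_L2)
      also have "norm \<dots> \<le> L2_norm L (\<lambda>s. u \<tau> s - u t s) * L2_norm L v"
        using t v \<open>\<tau> \<ge> 0\<close> by (intro L2_Cauchy_Schwarz L2_diff u_L2)
      also have "\<dots> \<le> H1_norm L (\<lambda>s. u \<tau> s - u t s) * L2_norm L v"
        by (intro mult_right_mono) (auto simp: H1_norm_def L2_norm_nonneg intro: real_le_rsqrt)
      finally show "norm (L2_inner L (u \<tau>) v - L2_inner L (u t) v)
        \<le> H1_norm L (\<lambda>s. u \<tau> s - u t s) * L2_norm L v" .
    qed
    show "((\<lambda>\<tau>. H1_norm L (\<lambda>s. u \<tau> s - u t s) * L2_norm L v) \<longlongrightarrow> 0) (at t within {0..})"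
      using tendsto_mult_right[OF lim, of "L2_norm L v"] by simp
  qed
  then show "((\<lambda>t. L2_inner L (u t) v) \<longlongrightarrow> L2_inner L (u t) v) (at t within {0..})"
    by (simp add: LIM_zero_iff)
qed

text \<open>With both spatial derivatives moved to the test function, the trace identity says that
  \<open>t \<mapsto> \<langle>u(t), v\<rangle>\<close> is absolutely continuous, and it gives the derivative.  The boundary terms at \<open>0\<close>
  vanish by the hypotheses on \<open>v\<close>.  Both halves of the upper bound access the trace through this fact, with two
  kinds of test functions.\<close>

lemma weak_deriv_L2_inner_u:
  assumes v: "\<And>x. (v has_vector_derivative v' x) (at x)" "\<And>x. (v' has_vector_derivative v'' x) (at x)"
    and c: "continuous_on UNIV v''" and v0: "v 0 = 0" "k = 0 \<or> v' 0 = 0"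
  shows "has_weak_deriv T (\<lambda>t. L2_inner L (u t) v) (\<lambda>t. - \<i> * (cnj (v L) * g t + L2_inner L (u t) v''))"
  unfolding has_weak_deriv_def
proof (intro conjI ballI)
  have c': "continuous_on UNIV v'"
    using v(2) by (meson continuous_at_imp_continuous_on has_vector_derivative_continuous)
  have v2: "L2 L v''" by (intro L2_continuous continuous_on_subset[OF c]) auto
  have cF: "continuous_on {0..t} (\<lambda>t. L2_inner L (u t) v'')" for t
    by (rule continuous_on_subset[OF L2_inner_u_continuous[OF v2]]) auto
  show "L2 T (\<lambda>t. - \<i> * (cnj (v L) * g t + L2_inner L (u t) v''))"
    by (intro L2_smult L2_add g_L2 L2_continuous cF)
  fix t assume t: "t \<in> {0..T}"
  have "v \<in> H1 L" using has_weak_deriv_C1[OF v(1) c'] by (auto simp: H1_def)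
  then have eq: "\<i> * (L2_inner L (u t) v - L2_inner L (u 0) v)
          + (LINT \<tau>:{0..t}|lborel. L2_inner L (weak_deriv L (u \<tau>)) (weak_deriv L v))
        = (LINT \<tau>:{0..t}|lborel. g \<tau>) * cnj (v L)"
    using trace v0(1) t by (simp add: neumann_trace_def)
  have "(LINT \<tau>:{0..t}|lborel. L2_inner L (weak_deriv L (u \<tau>)) (weak_deriv L v))
      = (LINT \<tau>:{0..t}|lborel. (-1) * L2_inner L (u \<tau>) v'')"
  proof (rule set_lebesgue_integral_cong)
    show "\<forall>\<tau>. \<tau> \<in> {0..t} \<longrightarrow> L2_inner L (weak_deriv L (u \<tau>)) (weak_deriv L v) = (-1) * L2_inner L (u \<tau>) v''"
    proof (intro allI impI)
      fix \<tau> assume "\<tau> \<in> {0..t}"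
      then have \<tau>: "\<tau> \<ge> 0" by simp
      show "L2_inner L (weak_deriv L (u \<tau>)) (weak_deriv L v) = (-1) * L2_inner L (u \<tau>) v''"
        using L2_inner_weak_deriv_smooth[OF u_weak_deriv[OF \<tau>] v(1) c']
          weak_by_parts_left[OF u_weak_deriv[OF \<tau>] _ v(2) c] L u_boundary[OF \<tau>] v0(2) by auto
    qed
  qed simp
  also have "\<dots> = (-1) * (LINT \<tau>:{0..t}|lborel. L2_inner L (u \<tau>) v'')" by (rule set_integral_mult_right)
  finally have e2: "\<i> * (L2_inner L (u t) v - L2_inner L (u 0) v) =
      cnj (v L) * (LINT \<tau>:{0..t}|lborel. g \<tau>) + (LINT \<tau>:{0..t}|lborel. L2_inner L (u \<tau>) v'')"
    using eq by (simp add: algebra_simps)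
  have gi: "set_integrable lborel {0..t} g"
    by (rule set_integrable_subset[OF L2_set_integrable[OF g_L2]]) (use t in auto)
  have "(LINT \<tau>:{0..t}|lborel. - \<i> * (cnj (v L) * g \<tau> + L2_inner L (u \<tau>) v'')) =
      - \<i> * (cnj (v L) * (LINT \<tau>:{0..t}|lborel. g \<tau>) + (LINT \<tau>:{0..t}|lborel. L2_inner L (u \<tau>) v''))"
    by (subst set_integral_mult_right, subst set_integral_add)
       (auto intro!: gi borel_integrable_atLeastAtMost'[OF cF])
  also have "\<dots> = L2_inner L (u t) v - L2_inner L (u 0) v"
    unfolding e2[symmetric] by (simp flip: mult.assoc)
  finally show "L2_inner L (u t) v = L2_inner L (u 0) v +
      (LINT \<tau>:{0..t}|lborel. - \<i> * (cnj (v L) * g \<tau> + L2_inner L (u \<tau>) v''))" by simp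
qed

definition coef :: "nat \<Rightarrow> complex" where
  "coef m = L2_inner L (u 0) (smode k L m)"

lemma smode_H1k: "smode k L m \<in> H1k k L"
proof -
  have "has_weak_deriv L (smode k L m) (\<lambda>s. - of_real (freq k L m) * cmode k L m s)"
    by (intro has_weak_deriv_C1 smode_deriv continuous_intros mode_continuous)
  then show ?thesis using mode_boundary(1,3)[OF L k] by (auto simp: H1k_def H1_def)
qed

lemma inner_weak_deriv_cmode:
  assumes "t \<ge> 0"
  shows "L2_inner L (weak_deriv L (u t)) (cmode k L m) = - of_real (freq k L m) * L2_inner L (u t) (smode k L m)"
proof -
  have "L2_inner L (weak_deriv L (u t)) (cmode k L m) = u t L * cnj (cmode k L m L) - u t 0 * cnj (cmode k L m 0)
     - L2_inner L (u t) (\<lambda>s. of_real (freq k L m) * smode k L m s)"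
    using L by (intro weak_by_parts_left u_weak_deriv assms cmode_deriv) (auto intro!: continuous_intros mode_continuous)
  also have "u t L * cnj (cmode k L m L) - u t 0 * cnj (cmode k L m 0) = 0"
    using u_boundary[OF assms] mode_boundary(4)[OF L k] k by auto
  finally show ?thesis by (simp add: L2_inner_smult_right)
qed

text \<open>The equation tested with a mode is a scalar linear ODE on \<open>(0,T)\<close>; continuity reaches the
  endpoints.\<close>

lemma coef_evolution:
  assumes t: "t \<in> {0..T}"
  shows "L2_inner L (u t) (smode k L m) = cis ((freq k L m)\<^sup>2 * t) * coef m"
proof -
  define w where "w = freq k L m"
  define c where "c t = L2_inner L (u t) (smode k L m)" for t
  define h where "h t = exp (- (\<i> * w\<^sup>2 * of_real t)) * c t" for t
  have cc: "continuous_on {0..T} c"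
    unfolding c_def by (rule continuous_on_subset[OF L2_inner_u_continuous[OF L2_modes(1)]]) auto
  have dc: "(c has_vector_derivative \<i> * w\<^sup>2 * c \<tau>) (at \<tau>)" if \<tau>: "\<tau> \<in> {0<..<T}" for \<tau>
  proof -
    obtain D where D: "(c has_vector_derivative D) (at \<tau>)"
        "\<i> * D + L2_inner L (weak_deriv L (u \<tau>)) (weak_deriv L (smode k L m)) = 0"
      using sol \<tau> smode_H1k[of m] unfolding schrodinger_solution_def c_def by blast
    have t0: "\<tau> \<ge> 0" using \<tau> by simp
    have "L2_inner L (weak_deriv L (u \<tau>)) (weak_deriv L (smode k L m)) = 
        L2_inner L (weak_deriv L (u \<tau>)) (\<lambda>s. - of_real w * cmode k L m s)"
      unfolding w_def
      by (rule L2_inner_weak_deriv_smooth[OF u_weak_deriv[OF t0] smode_deriv]) (intro continuous_intros mode_continuous)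
    also have "\<dots> = w\<^sup>2 * c \<tau>"
      by (subst L2_inner_smult_right, subst inner_weak_deriv_cmode[OF t0]) (simp add: w_def c_def power2_eq_square)
    finally have "\<i> * D = - (w\<^sup>2 * c \<tau>)" using D(2) by (simp add: eq_neg_iff_add_eq_0)
    then have "\<i> * (\<i> * D) = \<i> * (- (w\<^sup>2 * c \<tau>))" by simp
    then have "D = \<i> * w\<^sup>2 * c \<tau>" by (simp flip: mult.assoc)
    then show ?thesis using D(1) by simp
  qed
  have e: "((\<lambda>t. exp (- (\<i> * w\<^sup>2 * of_real t))) has_vector_derivative - (\<i> * w\<^sup>2) * exp (- (\<i> * w\<^sup>2 * of_real \<tau>))) (at \<tau>)" for \<tau>
    by (rule has_vector_derivative_real_field) (auto intro!: derivative_eq_intros)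
  have "h t = h 0"
  proof (rule has_derivative_zero_unique_strong_interval[where k="{0, T}" and a=0 and b=T])
    show "continuous_on {0..T} h" unfolding h_def by (intro continuous_intros cc)
    fix \<tau> assume "\<tau> \<in> {0..T} - {0, T}"
    then have \<tau>: "\<tau> \<in> {0<..<T}" by auto
    have "(h has_vector_derivative (exp (- (\<i> * w\<^sup>2 * of_real \<tau>)) * (\<i> * w\<^sup>2 * c \<tau>) + - (\<i> * w\<^sup>2) * exp (- (\<i> * w\<^sup>2 * of_real \<tau>)) * c \<tau>)) (at \<tau>)"
      unfolding h_def by (rule has_vector_derivative_mult[OF e dc[OF \<tau>]])
    then have "(h has_vector_derivative 0) (at \<tau>)" by (simp add: mult_ac)
    then show "(h has_derivative (\<lambda>h. 0)) (at \<tau> within {0..T})"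
      by (auto simp: has_vector_derivative_def intro: has_derivative_at_withinI)
  qed (use t in auto)
  then have "exp (\<i> * w\<^sup>2 * of_real t) * h t = exp (\<i> * w\<^sup>2 * of_real t) * c 0" by (simp add: h_def)
  then have "c t = exp (\<i> * w\<^sup>2 * of_real t) * c 0"
    by (simp add: h_def flip: mult.assoc exp_add)
  then show ?thesis by (simp add: c_def w_def coef_def cis_conv_exp mult.assoc)
qed

lemma coef_sums:
  assumes "t \<in> {0..T}"
  shows "(\<lambda>m. (norm (coef m))\<^sup>2) sums (L2_norm L (u t))\<^sup>2"
  using Parseval_smode[OF L k u_L2, of t] assms by (simp add: coef_evolution norm_mult)

lemma L2_norm_u:
  assumes "t \<in> {0..T}"
  shows "L2_norm L (u t) = L2_norm L (u 0)"
proof -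
  have "0 \<in> {0..T}" using T by simp
  then have "(L2_norm L (u t))\<^sup>2 = (L2_norm L (u 0))\<^sup>2"
    using sums_unique2 coef_sums assms by blast
  then show ?thesis using L2_norm_nonneg by (simp only: power2_eq_iff_nonneg)
qed

lemma coef_deriv_sums: "(\<lambda>m. (freq k L m)\<^sup>2 * (norm (coef m))\<^sup>2) sums (L2_norm L (weak_deriv L (u 0)))\<^sup>2"
proof -
  have "(\<lambda>m. (norm (L2_inner L (weak_deriv L (u 0)) (cmode k L m)))\<^sup>2) sums (L2_norm L (weak_deriv L (u 0)))\<^sup>2"
  proof (rule Parseval_cmode[OF L k has_weak_deriv_L2[OF u_weak_deriv]])
    show "L2_inner L (weak_deriv L (u 0)) (cmode k L 0) = 0" if "k = 0"
      using that inner_weak_deriv_cmode[of 0 0] by (simp add: freq_zero)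
  qed simp
  then show ?thesis by (simp add: inner_weak_deriv_cmode norm_mult power_mult_distrib coef_def)
qed

section \<open>High frequencies\<close>

text \<open>The multiplier \<open>s \<partial>\<^sub>s\<close> for one mode: for \<open>v s = s * cmode k L m s\<close> one has
  \<open>v'' = 2 \<omega> smode - \<omega>\<^sup>2 v\<close> with \<open>\<omega> = freq k L m\<close>.  So \<open>exp (- i \<omega>\<^sup>2 t) \<langle>u(t), v\<rangle>\<close> has a derivative
  that contains only the trace and a constant multiple of \<open>coef m\<close>; integration over \<open>[0,T]\<close> gives
  the identity.\<close>

lemma mode_multiplier_identity:
  defines "v \<equiv> \<lambda>m s. of_real s * cmode k L m s"
  shows "of_real (sqrt (2 * L)) * L2_inner T g (\<lambda>t. cis ((freq k L m)\<^sup>2 * t)) =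
    \<i> * (cis (- ((freq k L m)\<^sup>2 * T)) * L2_inner L (u T) (v m) - L2_inner L (u 0) (v m)) - 2 * freq k L m * T * coef m"
proof -
  define w where "w = freq k L m"
  define F where "F t = L2_inner L (u t) (v m)" for t
  define p where "p t = cis (w\<^sup>2 * t)" for t
  define v' where "v' s = cmode k L m s + of_real s * (of_real w * smode k L m s)" for s
  define v'' where "v'' s = 2 * of_real w * smode k L m s - of_real (w\<^sup>2) * v m s" for s
  have id: "(complex_of_real has_vector_derivative 1) (at x)" for x
    using of_real_has_vector_derivative[OF DERIV_ident, of x UNIV] by simp
  have 1: "(v m has_vector_derivative v' x) (at x)" for x
    unfolding v_def v'_def using has_vector_derivative_mult[OF id cmode_deriv[of k L m x]] by (simp add: w_def add.commute)
  have 2: "(v' has_vector_derivative v'' x) (at x)" for x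
  proof -
    have "(v' has_vector_derivative (of_real w * smode k L m x + (of_real x * (of_real w * (- of_real w * cmode k L m x)) + 1 * (of_real w * smode k L m x)))) (at x)"
      unfolding v'_def w_def
      by (intro has_vector_derivative_add cmode_deriv has_vector_derivative_mult id
          has_vector_derivative_mult_right smode_deriv)
    then show ?thesis by (simp add: v''_def v_def power2_eq_square algebra_simps)
  qed
  have vc: "continuous_on UNIV (v m)" unfolding v_def by (intro continuous_intros mode_continuous)
  have v2: "L2 L (v m)" by (intro L2_continuous continuous_on_subset[OF vc]) auto
  have vL: "v m L = of_real (sqrt (2 * L))"
  proof -
    have "L\<^sup>2 * (2 / L) = 2 * L" using L by (simp add: power2_eq_square)
    then have "sqrt (2 * L) = sqrt (L\<^sup>2) * sqrt (2 / L)" by (simp only: real_sqrt_mult[symmetric])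
    then have "L * sqrt (2 / L) = sqrt (2 * L)" using L by (simp only: real_sqrt_abs abs_of_pos)
    then show ?thesis unfolding v_def mode_boundary(2)[OF L k] of_real_mult[symmetric] by simp
  qed
  have v''c: "continuous_on UNIV v''"
    unfolding v''_def by (intro continuous_intros mode_continuous vc)
  \<comment> \<open>Integrating this weak derivative against \<open>p\<close> cancels both occurrences of \<open>\<langle>F, p\<rangle>\<close>.\<close>
  have hwd: "has_weak_deriv T (\<lambda>t. L2_inner L (u t) (v m)) (\<lambda>t. - \<i> * (cnj (v m L) * g t + L2_inner L (u t) v''))"
  proof (rule weak_deriv_L2_inner_u)
    show "v m 0 = 0" by (simp add: v_def)
    show "k = 0 \<or> v' 0 = 0" using k mode_boundary(4)[OF L k] by (auto simp: v'_def)
  qed (fact 1 2 v''c)+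
  have Fc: "continuous_on {0..T} F"
    unfolding F_def by (rule continuous_on_subset[OF L2_inner_u_continuous[OF v2]]) auto
  have F2: "L2 T F" by (rule L2_continuous[OF Fc])
  have pc: "continuous_on UNIV p" unfolding p_def by (intro continuous_intros)
  have p2: "L2 T p" by (intro L2_continuous continuous_on_subset[OF pc]) auto
  have pd: "(p has_vector_derivative \<i> * w\<^sup>2 * p x) (at x)" for x
    unfolding p_def by (rule cis_linear_deriv)
  have parts: "L2_inner T (\<lambda>t. - \<i> * (cnj (v m L) * g t + L2_inner L (u t) v'')) p
      = F T * cnj (p T) - F 0 * cnj (p 0) - L2_inner T F (\<lambda>t. \<i> * w\<^sup>2 * p t)"
    unfolding F_def
    using T by (intro weak_by_parts_left[OF hwd _ pd]) (auto intro!: continuous_intros pc)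
  have "L2_inner T (\<lambda>t. - \<i> * (cnj (v m L) * g t + L2_inner L (u t) v'')) p
      = L2_inner T (\<lambda>t. - \<i> * (of_real (sqrt (2 * L)) * g t + (2 * of_real w * coef m * p t - of_real (w\<^sup>2) * F t))) p"
  proof (rule L2_inner_cong)
    fix t assume t: "t \<in> {0..T}"
    have "L2_inner L (u t) v'' = cnj (2 * of_real w) * L2_inner L (u t) (smode k L m) - cnj (of_real (w\<^sup>2)) * F t"
      unfolding v''_def F_def L2_inner_smult_right[symmetric]
      using t by (intro L2_inner_diff_right L2_smult L2_modes v2 u_L2) auto
    then show "- \<i> * (cnj (v m L) * g t + L2_inner L (u t) v'') =
        - \<i> * (of_real (sqrt (2 * L)) * g t + (2 * of_real w * coef m * p t - of_real (w\<^sup>2) * F t))"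
      by (simp add: vL coef_evolution[OF t] p_def w_def)
  qed simp
  also have "\<dots> = - \<i> * (of_real (sqrt (2 * L)) * L2_inner T g p + (2 * of_real w * coef m * L2_inner T p p - of_real (w\<^sup>2) * L2_inner T F p))"
    unfolding L2_inner_smult[symmetric]
    by (subst L2_inner_smult, subst L2_inner_add_left, insert g_L2 p2 F2)
       (auto intro!: L2_smult L2_diff simp: L2_inner_diff_left L2_smult)
  also have "L2_inner T p p = T"
  proof -
    have "L2_inner T p p = (LINT t:{0..T}|lborel. 1)"
      unfolding L2_inner_def p_def by (simp add: cis_cnj cis_mult)
    then show ?thesis using T by (simp add: set_lebesgue_integral_def scaleR_conv_of_real)
  qed
  finally have "- \<i> * (of_real (sqrt (2 * L)) * L2_inner T g p + (2 * of_real w * coef m * T - of_real (w\<^sup>2) * L2_inner T F p))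
     = F T * cnj (p T) - F 0 + \<i> * w\<^sup>2 * L2_inner T F p"
    unfolding parts by (subst (asm) L2_inner_smult_right) (simp add: p_def)
  then have "- \<i> * (of_real (sqrt (2 * L)) * L2_inner T g p + 2 * of_real w * coef m * T) = F T * cnj (p T) - F 0"
    by (simp add: algebra_simps)
  then have "\<i> * (- \<i> * (of_real (sqrt (2 * L)) * L2_inner T g p + 2 * of_real w * coef m * T)) = \<i> * (F T * cnj (p T) - F 0)"
    by (rule arg_cong)
  then have "of_real (sqrt (2 * L)) * L2_inner T g p + 2 * of_real w * coef m * T = \<i> * (F T * cnj (p T) - F 0)"
    by (simp add: add.commute flip: mult.assoc)
  then show ?thesis
    unfolding F_def p_def w_def[symmetric] cis_cnj by (simp add: algebra_simps)
qed

end

lemma L2_norm_mono_interval: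
  assumes "L2 Q f" "T \<le> Q"
  shows "L2_norm T f \<le> L2_norm Q f"
proof -
  have i: "integrable lborel (\<lambda>x. indicator {0..Q} x *\<^sub>R (norm (f x))\<^sup>2)"
    using L2_sq_integrable[OF assms(1)] by (simp add: set_integrable_def)
  have "set_integrable lborel {0..T} (\<lambda>x. (norm (f x))\<^sup>2)"
    by (rule set_integrable_subset[OF L2_sq_integrable[OF assms(1)]]) (use assms(2) in auto)
  then have "(LINT x|lborel. indicator {0..T} x *\<^sub>R (norm (f x))\<^sup>2) \<le> (LINT x|lborel. indicator {0..Q} x *\<^sub>R (norm (f x))\<^sup>2)"
    unfolding set_integrable_def
    by (intro integral_mono i) (use assms(2) in \<open>auto simp: indicator_def\<close>)
  then show ?thesis by (simp add: L2_norm_def set_lebesgue_integral_def)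
qed

lemma L2_norm_mult_bounded:
  assumes "L2 L f" "L2 L (\<lambda>x. c x * f x)" "B \<ge> 0" "\<And>x. x \<in> {0..L} \<Longrightarrow> norm (c x) \<le> B"
  shows "L2_norm L (\<lambda>x. c x * f x) \<le> B * L2_norm L f"
proof -
  have "(LINT x:{0..L}|lborel. (norm (c x * f x))\<^sup>2) \<le> (LINT x:{0..L}|lborel. B\<^sup>2 * (norm (f x))\<^sup>2)"
  proof (rule set_integral_mono)
    show "set_integrable lborel {0..L} (\<lambda>x. B\<^sup>2 * (norm (f x))\<^sup>2)"
      using L2_sq_integrable[OF assms(1)] by auto
    show "(norm (c x * f x))\<^sup>2 \<le> B\<^sup>2 * (norm (f x))\<^sup>2" if "x \<in> {0..L}" for x
      unfolding norm_mult power_mult_distrib using assms(4)[OF that] by (intro mult_right_mono power_mono) auto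
  qed (use assms L2_sq_integrable in auto)
  then have "(L2_norm L (\<lambda>x. c x * f x))\<^sup>2 \<le> (B * L2_norm L f)\<^sup>2"
    by (simp add: L2_norm_square power_mult_distrib)
  then show ?thesis by (rule power2_le_imp_le) (simp add: assms(3) L2_norm_nonneg)
qed

text \<open>Differences of squared frequencies are integer multiples of \<open>\<pi>\<^sup>2 / L\<^sup>2\<close>, for both boundary
  conditions, so the time exponentials are orthogonal over \<open>4 L\<^sup>2 / \<pi>\<close>, which exceeds \<open>L\<^sup>2\<close>.\<close>

lemma time_modes_orthogonal:
  assumes L: "L > 0" and mn: "m \<noteq> n"
  shows "L2_inner (4 * L\<^sup>2 / pi) (\<lambda>t. cis ((freq k L m)\<^sup>2 * t)) (\<lambda>t. cis ((freq k L n)\<^sup>2 * t)) = 0"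
proof -
  define j where "j = (int m - int n) * (int m + int n + int k)"
  define c where "c = of_int j * pi\<^sup>2 / L\<^sup>2"
  have j: "j \<noteq> 0" using mn by (auto simp: j_def)
  then have c: "c \<noteq> 0" using L by (simp add: c_def)
  have cd: "(freq k L m)\<^sup>2 - (freq k L n)\<^sup>2 = c"
    using L by (simp add: freq_def c_def j_def field_simps power2_eq_square)
  have "L2_inner (4 * L\<^sup>2 / pi) (\<lambda>t. cis ((freq k L m)\<^sup>2 * t)) (\<lambda>t. cis ((freq k L n)\<^sup>2 * t)) =
      (LINT t:{0..4 * L\<^sup>2 / pi}|lborel. cis (c * t))"
    unfolding L2_inner_def cis_cnj cis_mult cd[symmetric] by (simp add: algebra_simps)
  also have "\<dots> = cis (c * (4 * L\<^sup>2 / pi)) / (\<i> * c) - cis (c * 0) / (\<i> * c)"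
  proof (rule LINT_FTC)
    show "((\<lambda>t. cis (c * t) / (\<i> * c)) has_vector_derivative cis (c * x)) (at x)" for x
      using has_vector_derivative_mult_left[OF cis_linear_deriv[of c x UNIV], of "1 / (\<i> * c)"] c by simp
  qed (auto intro!: continuous_intros)
  also have "c * (4 * L\<^sup>2 / pi) = 2 * pi * of_int (2 * j)"
    using L by (simp add: c_def field_simps power2_eq_square)
  also have "cis (2 * pi * of_int (2 * j)) = 1" by (rule cis_multiple_2pi) auto
  finally show ?thesis by simp
qed

lemma norm_time_sum_le:
  assumes L: "L > 0" and T: "T \<le> L\<^sup>2"
  shows "L2_norm T (\<lambda>t. \<Sum>m<M. \<alpha> m * cis ((freq k L m)\<^sup>2 * t)) \<le> sqrt (4 * L\<^sup>2 / pi * (\<Sum>m<M. (norm (\<alpha> m))\<^sup>2))"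
proof -
  define Q where "Q = 4 * L\<^sup>2 / pi"
  have "L\<^sup>2 * pi \<le> L\<^sup>2 * 4" using pi_less_4 by (intro mult_left_mono) auto
  then have "L\<^sup>2 \<le> Q" by (simp add: Q_def pos_le_divide_eq mult.commute)
  then have TQ: "T \<le> Q" and Q: "Q \<ge> 0" using T by (simp_all add: Q_def)
  have c: "L2 Q (\<lambda>t. cis (w * t))" for w by (intro L2_continuous continuous_intros)
  have "(L2_norm Q (\<lambda>t. \<Sum>m<M. \<alpha> m * cis ((freq k L m)\<^sup>2 * t)))\<^sup>2 =
      (\<Sum>m<M. (norm (\<alpha> m))\<^sup>2 * (L2_norm Q (\<lambda>t. cis ((freq k L m)\<^sup>2 * t)))\<^sup>2)"
    using time_modes_orthogonal[OF L, of _ _ k] by (intro L2_norm_orthogonal_sum c) (simp add: Q_def)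
  moreover have "(L2_norm Q (\<lambda>t. cis ((freq k L m)\<^sup>2 * t)))\<^sup>2 = Q" for m
    using Q by (simp add: L2_norm_square set_lebesgue_integral_def)
  ultimately have "(L2_norm Q (\<lambda>t. \<Sum>m<M. \<alpha> m * cis ((freq k L m)\<^sup>2 * t)))\<^sup>2 = Q * (\<Sum>m<M. (norm (\<alpha> m))\<^sup>2)"
    by (simp add: sum_distrib_left mult.commute)
  then have "L2_norm Q (\<lambda>t. \<Sum>m<M. \<alpha> m * cis ((freq k L m)\<^sup>2 * t)) = sqrt (Q * (\<Sum>m<M. (norm (\<alpha> m))\<^sup>2))"
    by (rule real_sqrt_unique[OF _ L2_norm_nonneg, symmetric])
  moreover have "L2_norm T (\<lambda>t. \<Sum>m<M. \<alpha> m * cis ((freq k L m)\<^sup>2 * t)) \<le> L2_norm Q (\<lambda>t. \<Sum>m<M. \<alpha> m * cis ((freq k L m)\<^sup>2 * t))"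
    by (intro L2_norm_mono_interval[OF _ TQ] L2_sum L2_smult c)
  ultimately show ?thesis by (simp add: Q_def)
qed

context observed_solution
begin

text \<open>Multiply the identity of each mode by the conjugate of \<open>\<omega> * coef m\<close> and add.  The left hand sides
  become the pairing of \<open>g\<close> with the trace of a partial sum of the solution, whose norm is at most a
  multiple of the partial energy by orthogonality in time; the endpoint terms are bounded by the
  conserved \<open>L\<^sup>2\<close> norm times the partial energy.  One factor \<open>D M\<close> cancels.\<close>

lemma partial_energy_bound:
  assumes TL: "T \<le> L\<^sup>2"
  defines "D \<equiv> \<lambda>M. sqrt (\<Sum>m<M. (freq k L m)\<^sup>2 * (norm (coef m))\<^sup>2)"
  shows "T * D M \<le> L * sqrt L * L2_norm T g + L * L2_norm L (u 0)"
proof -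
  define w where "w m = freq k L m" for m
  define v where "v m s = of_real s * cmode k L m s" for m s
  define p where "p m t = cis ((w m)\<^sup>2 * t)" for m t
  define b where "b t m = of_real (w m) * coef m * p m t" for t m
  \<comment> \<open>\<open>s\<close> times the spatial derivative of the \<open>M\<close>-th partial sum of the solution, up to sign.\<close>
  define q where "q t s = (\<Sum>m<M. b t m * v m s)" for t s
  let ?P = "\<lambda>t. \<Sum>m<M. (of_real (w m) * coef m) * p m t"
  have v2: "L2 L (v m)" for m
    unfolding v_def by (intro L2_continuous continuous_intros mode_continuous)
  have p2: "L2 T (p m)" for m unfolding p_def by (intro L2_continuous continuous_intros)
  have D2: "(D M)\<^sup>2 = (\<Sum>m<M. (w m)\<^sup>2 * (norm (coef m))\<^sup>2)"
    by (simp add: D_def w_def sum_nonneg)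
  have D0: "D M \<ge> 0" by (simp add: D_def sum_nonneg)
  have q2: "L2 L (q t)" for t unfolding q_def by (intro L2_sum L2_smult v2)
  have qn: "L2_norm L (q t) \<le> L * D M" for t
  proof -
    have e: "q t = (\<lambda>s. of_real s * (\<Sum>m<M. b t m * cmode k L m s))"
      by (simp add: q_def v_def fun_eq_iff sum_distrib_left mult_ac)
    have c: "continuous_on A (\<lambda>s. \<Sum>m<M. b t m * cmode k L m s)" for A
      by (intro continuous_intros mode_continuous)
    have le: "L2_norm L (q t) \<le> L * L2_norm L (\<lambda>s. \<Sum>m<M. b t m * cmode k L m s)"
      unfolding e using L by (intro L2_norm_mult_bounded L2_continuous continuous_intros c) auto
    have "(L2_norm L (\<lambda>s. \<Sum>m<M. b t m * cmode k L m s))\<^sup>2 = (\<Sum>m<M. (norm (b t m))\<^sup>2 * (L2_norm L (cmode k L m))\<^sup>2)"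
      by (intro L2_norm_orthogonal_sum L2_modes) (simp add: mode_inner[OF L k])
    also have "\<dots> = (\<Sum>m<M. (w m)\<^sup>2 * (norm (coef m))\<^sup>2)"
    proof (intro sum.cong refl)
      fix m
      have "norm (b t m) = \<bar>w m\<bar> * norm (coef m)" by (simp add: b_def p_def norm_mult)
      moreover have "w m = 0 \<or> L2_norm L (cmode k L m) = 1"
        by (cases "m + k = 0") (auto simp: w_def freq_def L2_norm_eq_inner mode_inner[OF L k])
      ultimately show "(norm (b t m))\<^sup>2 * (L2_norm L (cmode k L m))\<^sup>2 = (w m)\<^sup>2 * (norm (coef m))\<^sup>2"
        by (auto simp: power_mult_distrib)
    qed
    finally have "(L2_norm L (\<lambda>s. \<Sum>m<M. b t m * cmode k L m s))\<^sup>2 = (D M)\<^sup>2" by (simp add: D2)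
    then have "L2_norm L (\<lambda>s. \<Sum>m<M. b t m * cmode k L m s) = D M"
      using D0 L2_norm_nonneg by (simp only: power2_eq_iff_nonneg)
    then show ?thesis using le by simp
  qed
  have "of_real (2 * T * (D M)\<^sup>2) = (\<Sum>m<M. (of_real (w m) * cnj (coef m)) * (2 * w m * T * coef m))"
  proof -
    have "complex_of_real (2 * T * ((w m)\<^sup>2 * (norm (coef m))\<^sup>2)) = (of_real (w m) * cnj (coef m)) * (2 * w m * T * coef m)" for m
      unfolding of_real_mult complex_norm_square by (simp add: power2_eq_square mult_ac)
    then show ?thesis unfolding D2 sum_distrib_left of_real_sum by (intro sum.cong refl)
  qed
  also have "\<dots> = (\<Sum>m<M. (of_real (w m) * cnj (coef m)) * (\<i> * (cis (- ((w m)\<^sup>2 * T)) * L2_inner L (u T) (v m) - L2_inner L (u 0) (v m))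
      - of_real (sqrt (2 * L)) * L2_inner T g (p m)))"
  proof -
    have "of_real (2 * w m * T) * coef m = \<i> * (cis (- ((w m)\<^sup>2 * T)) * L2_inner L (u T) (v m) - L2_inner L (u 0) (v m))
      - of_real (sqrt (2 * L)) * L2_inner T g (p m)" for m
      using mode_multiplier_identity[of m] unfolding w_def v_def p_def by (simp only: eq_diff_eq diff_eq_eq) (simp only: add.commute)
    then show ?thesis by (simp only:)
  qed
  also have "\<dots> = (\<Sum>m<M. \<i> * (cnj (b T m) * L2_inner L (u T) (v m)) - \<i> * (cnj (b 0 m) * L2_inner L (u 0) (v m))
      - of_real (sqrt (2 * L)) * (cnj (of_real (w m) * coef m) * L2_inner T g (p m)))"
    by (intro sum.cong refl) (simp add: b_def p_def cis_cnj algebra_simps)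
  also have "\<dots> = \<i> * L2_inner L (u T) (q T) - \<i> * L2_inner L (u 0) (q 0) 
      - of_real (sqrt (2 * L)) * L2_inner T g ?P"
  proof -
    have "L2_inner L (u t) (q t) = (\<Sum>m<M. cnj (b t m) * L2_inner L (u t) (v m))" if "t \<ge> 0" for t
      unfolding q_def using that v2 by (simp add: L2_inner_sum_right L2_smult u_L2 L2_inner_smult_right)
    moreover have "L2_inner T g ?P = 
        (\<Sum>m<M. cnj (of_real (w m) * coef m) * L2_inner T g (p m))"
      using p2 g_L2 by (simp add: L2_inner_sum_right L2_smult L2_inner_smult_right)
    ultimately show ?thesis using T by (simp add: sum_subtractf sum_distrib_left)
  qed
  finally have eq: "of_real (2 * T * (D M)\<^sup>2) = \<i> * L2_inner L (u T) (q T) - \<i> * L2_inner L (u 0) (q 0) 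
      - of_real (sqrt (2 * L)) * L2_inner T g ?P" .
  have u: "norm (L2_inner L (u t) (q t)) \<le> L2_norm L (u 0) * (L * D M)" if "t \<in> {0..T}" for t
  proof -
    have "norm (L2_inner L (u t) (q t)) \<le> L2_norm L (u t) * L2_norm L (q t)"
      using that by (intro L2_Cauchy_Schwarz u_L2 q2) auto
    also have "\<dots> \<le> L2_norm L (u 0) * (L * D M)"
      unfolding L2_norm_u[OF that] by (intro mult_left_mono qn L2_norm_nonneg)
    finally show ?thesis .
  qed
  have gb: "sqrt (2 * L) * norm (L2_inner T g ?P) \<le> L2_norm T g * (2 * L * sqrt L * D M)"
  proof -
    have "norm (L2_inner T g ?P) \<le>
        L2_norm T g * L2_norm T ?P"
      by (intro L2_Cauchy_Schwarz g_L2 L2_sum L2_smult p2)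
    also have "\<dots> \<le> L2_norm T g * sqrt (4 * L\<^sup>2 / pi * (\<Sum>m<M. (norm (of_real (w m) * coef m))\<^sup>2))"
      unfolding p_def w_def by (intro mult_left_mono norm_time_sum_le L TL L2_norm_nonneg)
    also have "(\<Sum>m<M. (norm (of_real (w m) * coef m))\<^sup>2) = (D M)\<^sup>2"
      by (simp add: D2 norm_mult power_mult_distrib)
    finally have "sqrt (2 * L) * norm (L2_inner T g ?P) \<le>
        sqrt (2 * L) * (L2_norm T g * sqrt (4 * L\<^sup>2 / pi * (D M)\<^sup>2))"
      by (intro mult_left_mono) (use L in auto)
    also have "\<dots> = L2_norm T g * sqrt ((2 * L) * (4 * L\<^sup>2 / pi * (D M)\<^sup>2))"
      by (simp only: real_sqrt_mult mult_ac)
    also have "\<dots> \<le> L2_norm T g * sqrt ((2 * L * D M)\<^sup>2 * L)"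
    proof (intro mult_left_mono real_sqrt_le_mono L2_norm_nonneg)
      have "8 / pi * (L * L\<^sup>2 * (D M)\<^sup>2) \<le> 4 * (L * L\<^sup>2 * (D M)\<^sup>2)"
        using pi_gt3 L by (intro mult_right_mono) (auto simp: field_simps)
      then show "(2 * L) * (4 * L\<^sup>2 / pi * (D M)\<^sup>2) \<le> (2 * L * D M)\<^sup>2 * L"
        by (simp add: power2_eq_square field_simps)
    qed
    also have "sqrt ((2 * L * D M)\<^sup>2 * L) = 2 * L * sqrt L * D M"
      using L D0 by (simp add: real_sqrt_mult)
    finally show ?thesis .
  qed
  have "2 * T * (D M)\<^sup>2 = norm (of_real (2 * T * (D M)\<^sup>2) :: complex)" using T by (simp add: norm_mult norm_power)
  also have "\<dots> \<le> norm (L2_inner L (u T) (q T)) + norm (L2_inner L (u 0) (q 0)) 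
      + sqrt (2 * L) * norm (L2_inner T g ?P)"
    unfolding eq using L
    by (intro order_trans[OF norm_triangle_ineq4] add_mono) (auto simp: norm_mult)
  also have "\<dots> \<le> L2_norm L (u 0) * (L * D M) + L2_norm L (u 0) * (L * D M) + L2_norm T g * (2 * L * sqrt L * D M)"
    using T by (intro add_mono u gb) auto
  finally have "D M * (T * D M) \<le> D M * (L * sqrt L * L2_norm T g + L * L2_norm L (u 0))"
    by (simp add: power2_eq_square algebra_simps)
  then show ?thesis
    using D0 L T L2_norm_nonneg by (cases "D M = 0") (auto simp: mult_le_cancel_left_pos)
qed

text \<open>The trace controls the energy up to the \<open>L\<^sup>2\<close> norm of the datum, a term of lower order.\<close>

lemma energy_bound:
  assumes TL: "T \<le> L\<^sup>2"
  shows "T * L2_norm L (weak_deriv L (u 0)) \<le> L * sqrt L * L2_norm T g + L * L2_norm L (u 0)"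
proof (rule LIMSEQ_le_const2)
  have "(\<lambda>M. sqrt (\<Sum>m<M. (freq k L m)\<^sup>2 * (norm (coef m))\<^sup>2)) \<longlonglongrightarrow> sqrt ((L2_norm L (weak_deriv L (u 0)))\<^sup>2)"
    using coef_deriv_sums unfolding sums_def by (rule tendsto_real_sqrt)
  then show "(\<lambda>M. T * sqrt (\<Sum>m<M. (freq k L m)\<^sup>2 * (norm (coef m))\<^sup>2)) \<longlonglongrightarrow> T * L2_norm L (weak_deriv L (u 0))"
    using L2_norm_nonneg by (intro tendsto_mult_left) simp
qed (use partial_energy_bound[OF TL] in auto)

text \<open>For frequencies above \<open>\<Omega>\<close> the square of a coefficient is weighted in the energy by at least \<open>\<Omega>\<^sup>2\<close>.\<close>

lemma low_mode_split:
  assumes B: "\<And>m. m < N \<Longrightarrow> freq k L m < \<Omega> \<Longrightarrow> norm (coef m) \<le> B" and N: "\<And>m. m \<ge> N \<Longrightarrow> freq k L m \<ge> \<Omega>"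
    and \<Omega>: "\<Omega> > 0" and B0: "B \<ge> 0"
  shows "L2_norm L (u 0) \<le> sqrt (real N) * B + L2_norm L (weak_deriv L (u 0)) / \<Omega>"
proof -
  define D where "D = L2_norm L (weak_deriv L (u 0))"
  have "(L2_norm L (u 0))\<^sup>2 \<le> real N * B\<^sup>2 + D\<^sup>2 / \<Omega>\<^sup>2"
  proof (rule sums_le)
    show "(\<lambda>m. (norm (coef m))\<^sup>2) sums (L2_norm L (u 0))\<^sup>2" using T by (intro coef_sums) auto
    have "(\<lambda>m. if m \<in> {..<N} then B\<^sup>2 else 0) sums (\<Sum>m<N. B\<^sup>2)" by (rule sums_If_finite_set) simp
    then show "(\<lambda>m. (if m \<in> {..<N} then B\<^sup>2 else 0) + ((freq k L m)\<^sup>2 * (norm (coef m))\<^sup>2) / \<Omega>\<^sup>2) sums (real N * B\<^sup>2 + D\<^sup>2 / \<Omega>\<^sup>2)"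
      unfolding D_def by (intro sums_add sums_divide coef_deriv_sums) simp
    fix m
    show "(norm (coef m))\<^sup>2 \<le> (if m \<in> {..<N} then B\<^sup>2 else 0) + ((freq k L m)\<^sup>2 * (norm (coef m))\<^sup>2) / \<Omega>\<^sup>2"
    proof (cases "freq k L m < \<Omega>")
      case True
      then have "m < N" using N[of m] by (meson leD not_le_imp_less)
      moreover from this have "(norm (coef m))\<^sup>2 \<le> B\<^sup>2" using B True by (intro power_mono) auto
      ultimately show ?thesis by (simp add: add_increasing2)
    next
      case False
      then have "\<Omega>\<^sup>2 \<le> (freq k L m)\<^sup>2" using \<Omega> by (intro power_mono) auto
      then have "\<Omega>\<^sup>2 * (norm (coef m))\<^sup>2 \<le> (freq k L m)\<^sup>2 * (norm (coef m))\<^sup>2" by (rule mult_right_mono) simp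
      then have "(norm (coef m))\<^sup>2 \<le> ((freq k L m)\<^sup>2 * (norm (coef m))\<^sup>2) / \<Omega>\<^sup>2"
        using \<Omega> by (simp add: field_simps)
      then show ?thesis by (simp add: add_increasing)
    qed
  qed
  also have "\<dots> \<le> (sqrt (real N) * B + D / \<Omega>)\<^sup>2"
    using B0 \<Omega> L2_norm_nonneg[of L "weak_deriv L (u 0)"]
    by (simp add: power2_sum power_mult_distrib power_divide D_def)
  finally have "(L2_norm L (u 0))\<^sup>2 \<le> (sqrt (real N) * B + D / \<Omega>)\<^sup>2" .
  moreover have "0 \<le> sqrt (real N) * B + D / \<Omega>" using B0 \<Omega> by (simp add: D_def L2_norm_nonneg)
  ultimately show ?thesis unfolding D_def by (rule power2_le_imp_le)
qed

end

section \<open>Iterated antiderivatives\<close>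

lemma antiderivative_exists:
  fixes f :: "real \<Rightarrow> complex"
  assumes "continuous_on UNIV f"
  shows "\<exists>P. (\<forall>x. (P has_vector_derivative f x) (at x)) \<and> P 0 = 0"
proof -
  have "\<exists>P :: real \<Rightarrow> complex. \<forall>x::real. -\<infinity> < ereal x \<longrightarrow> ereal x < \<infinity> \<longrightarrow> (P has_vector_derivative f x) (at x)"
    by (rule einterval_antiderivative) (use assms in \<open>auto simp: continuous_on_eq_continuous_at\<close>)
  then obtain P :: "real \<Rightarrow> complex" where P: "\<And>x. (P has_vector_derivative f x) (at x)" by auto
  have "((\<lambda>x. P x - P 0) has_vector_derivative f x) (at x)" for x
    by (rule has_vector_derivative_eq_rhs[OF has_vector_derivative_diff[OF P has_vector_derivative_const]]) simp
  then show ?thesis by (intro exI[of _ "\<lambda>x. P x - P 0"]) auto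
qed

text \<open>Iterated antiderivatives that vanish at \<open>0\<close>, as global functions on the line.\<close>

primrec iterint :: "(real \<Rightarrow> complex) \<Rightarrow> nat \<Rightarrow> real \<Rightarrow> complex" where
  "iterint f 0 = f"
| "iterint f (Suc n) = (SOME P. (\<forall>x. (P has_vector_derivative iterint f n x) (at x)) \<and> P 0 = 0)"

lemma iterint_properties:
  assumes "continuous_on UNIV f"
  shows iterint_deriv: "(iterint f (Suc n) has_vector_derivative iterint f n x) (at x)"
    and iterint_at_0: "iterint f (Suc n) 0 = 0"
    and iterint_continuous: "continuous_on UNIV (iterint f n)"
proof -
  have c: "continuous_on UNIV (iterint f n)" for n
  proof (induction n)
    case (Suc n)
    have "\<forall>x. (iterint f (Suc n) has_vector_derivative iterint f n x) (at x)"
      using someI_ex[OF antiderivative_exists[OF Suc]] by simp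
    then show ?case
      by (meson continuous_at_imp_continuous_on has_vector_derivative_continuous)
  qed (use assms in simp)
  then show "continuous_on UNIV (iterint f n)" .
  show "(iterint f (Suc n) has_vector_derivative iterint f n x) (at x)" "iterint f (Suc n) 0 = 0"
    using someI_ex[OF antiderivative_exists[OF c]] by simp_all
qed

lemma norm_iterint_le:
  assumes f: "continuous_on UNIV f" and B: "\<And>x. x \<in> {0..L} \<Longrightarrow> norm (f x) \<le> B" and x: "x \<in> {0..L}"
  shows "norm (iterint f n x) \<le> B * x ^ n / fact n"
  using x
proof (induction n arbitrary: x)
  case (Suc n)
  let ?g = "\<lambda>y. B * y ^ n / fact n"
  have 1: "(iterint f n has_integral (iterint f (Suc n) x - iterint f (Suc n) 0)) {0..x}"
    using Suc.prems by (intro fundamental_theorem_of_calculus has_vector_derivative_at_within[OF iterint_deriv[OF f]]) auto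
  have 2: "(?g has_integral (B * x ^ Suc n / fact (Suc n) - B * 0 ^ Suc n / fact (Suc n))) {0..x}"
  proof (rule fundamental_theorem_of_calculus)
    fix y
    have "((\<lambda>y. B * y ^ Suc n / fact (Suc n)) has_real_derivative B * (real (Suc n) * y ^ n) / fact (Suc n)) (at y within {0..x})"
      using DERIV_pow[of "Suc n" y "{0..x}"] by (intro DERIV_cdivide DERIV_cmult) simp
    then show "((\<lambda>y. B * y ^ Suc n / fact (Suc n)) has_vector_derivative B * y ^ n / fact n) (at y within {0..x})"
      by (simp add: has_real_derivative_iff_has_vector_derivative[symmetric] field_simps del: of_nat_Suc)
  qed (use Suc.prems in auto)
  have "norm (integral {0..x} (iterint f n)) \<le> integral {0..x} ?g"
    by (rule integral_norm_bound_integral)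
       (use 1 2 Suc in \<open>auto simp: has_integral_integrable\<close>)
  then show ?case using integral_unique[OF 1] integral_unique[OF 2] iterint_at_0[OF f, of n] by simp
qed (use B in simp)

section \<open>Iterated means\<close>

definition window_mean :: "real \<Rightarrow> (real \<Rightarrow> complex) \<Rightarrow> real \<Rightarrow> complex" where
  "window_mean a F x = integral {x - a..x + a} F / of_real (2 * a)"

fun mean :: "real list \<Rightarrow> (real \<Rightarrow> complex) \<Rightarrow> real \<Rightarrow> complex" where
  "mean [] F t = F t"
| "mean (a # as) F t = mean as (window_mean a F) t"

lemma window_mean_continuous:
  assumes F: "continuous_on UNIV F" and a: "a > 0"
  shows "continuous_on UNIV (window_mean a F)"
proof -
  obtain P where P: "\<And>x. (P has_vector_derivative F x) (at x)"
    using antiderivative_exists[OF F] by blast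
  have "integral {x - a..x + a} F = P (x + a) - P (x - a)" for x
    using a by (intro integral_unique fundamental_theorem_of_calculus has_vector_derivative_at_within[OF P]) auto
  then have e: "window_mean a F = (\<lambda>x. (P (x + a) - P (x - a)) * inverse (of_real (2 * a)))"
    by (simp only: fun_eq_iff window_mean_def divide_inverse simp_thms)
  have "continuous_on UNIV P"
    by (meson P continuous_at_imp_continuous_on has_vector_derivative_continuous)
  then have "continuous_on UNIV (\<lambda>x. P (x + d))" for d
    by (rule continuous_on_compose2) (auto intro!: continuous_intros)
  from this[of a] this[of "-a"] show ?thesis
    unfolding e by (auto intro!: continuous_intros)
qed

lemma continuous_integrable_on: "continuous_on UNIV F \<Longrightarrow> (F :: real \<Rightarrow> complex) integrable_on {a..b}"
  by (rule integrable_continuous_real) (auto intro: continuous_on_subset)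

lemma window_mean_linear:
  assumes "continuous_on UNIV F" "continuous_on UNIV G"
  shows "window_mean a (\<lambda>x. c * F x + d * G x) = (\<lambda>x. c * window_mean a F x + d * window_mean a G x)"
  unfolding window_mean_def fun_eq_iff using assms
  by (subst integral_add) (auto intro!: integrable_on_mult_right continuous_integrable_on continuous_intros simp: add_divide_distrib)

lemma window_mean_shift:
  assumes "continuous_on UNIV F"
  shows "window_mean a (\<lambda>x. F (x + c)) = (\<lambda>x. window_mean a F (x + c))"
proof
  fix x
  have "integral {x - a..x + a} (\<lambda>x. F (x + c)) = integral {(x + c) - a..(x + c) + a} F"
    using integral_shift_real_ivl[of "(x + c) - a" c "(x + c) + a" F] by simp
  then show "window_mean a (\<lambda>x. F (x + c)) x = window_mean a F (x + c)"
    by (simp add: window_mean_def)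
qed

lemma norm_window_mean_le:
  assumes "continuous_on UNIV F" "a > 0" "\<And>y. y \<in> {x - a..x + a} \<Longrightarrow> norm (F y) \<le> B"
  shows "norm (window_mean a F x) \<le> B"
proof -
  have "norm (integral {x - a..x + a} F) \<le> B * (x + a - (x - a))"
    using assms by (intro integral_bound continuous_on_subset[OF assms(1)]) auto
  then show ?thesis using assms(2) by (simp add: window_mean_def norm_divide field_simps)
qed

lemma mean_linear:
  assumes "continuous_on UNIV F" "continuous_on UNIV G" "\<forall>a\<in>set as. a > 0"
  shows "mean as (\<lambda>x. c * F x + d * G x) t = c * mean as F t + d * mean as G t"
  using assms
proof (induction as arbitrary: F G)
  case (Cons a as)
  then show ?case
    using Cons.IH[of "window_mean a F" "window_mean a G"]
    by (simp add: window_mean_linear window_mean_continuous)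
qed simp

lemma mean_shift:
  assumes "continuous_on UNIV F" "\<forall>a\<in>set as. a > 0"
  shows "mean as (\<lambda>x. F (x + c)) t = mean as F (t + c)"
  using assms
proof (induction as arbitrary: F)
  case (Cons a as)
  then show ?case 
    using Cons.IH[of "window_mean a F"] by (simp add: window_mean_shift window_mean_continuous)
qed simp

lemma mean_cong:
  assumes "\<And>x. x \<in> {t - sum_list as..t + sum_list as} \<Longrightarrow> F x = G x"
  shows "mean as F t = mean as G t"
  using assms
proof (induction as arbitrary: F G)
  case (Cons a as)
  have "window_mean a F x = window_mean a G x" if "x \<in> {t - sum_list as..t + sum_list as}" for x
  proof -
    have "integral {x - a..x + a} F = integral {x - a..x + a} G"
      using that by (intro integral_cong Cons.prems) auto
    then show ?thesis by (simp add: window_mean_def)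
  qed
  then show ?case using Cons.IH[of "window_mean a F" "window_mean a G"] by simp
qed simp

lemma norm_mean_le:
  assumes "continuous_on UNIV F" "\<And>x. x \<in> {t - sum_list as..t + sum_list as} \<Longrightarrow> norm (F x) \<le> B" "\<forall>a\<in>set as. a > 0"
  shows "norm (mean as F t) \<le> B"
  using assms
proof (induction as arbitrary: F)
  case (Cons a as)
  have "norm (window_mean a F x) \<le> B" if "x \<in> {t - sum_list as..t + sum_list as}" for x
    using that Cons.prems by (intro norm_window_mean_le Cons.prems(1,2)) auto
  then show ?case using Cons.IH[of "window_mean a F"] Cons.prems
    by (simp add: window_mean_continuous)
qed simp

definition sinc :: "real \<Rightarrow> real" where
  "sinc x = (if x = 0 then 1 else sin x / x)"

text \<open>Averaging a pure oscillation over windows multiplies it by the Fourier transforms of the windows.\<close>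

lemma mean_cis:
  assumes "\<forall>a\<in>set as. a > 0"
  shows "mean as (\<lambda>t. c * cis (w * t)) t = c * of_real (\<Prod>a\<leftarrow>as. sinc (a * w)) * cis (w * t)"
  using assms
proof (induction as arbitrary: c)
  case (Cons a as)
  have a: "a > 0" using Cons.prems by simp
  have "window_mean a (\<lambda>t. c * cis (w * t)) x = (c * sinc (a * w)) * cis (w * x)" for x
  proof (cases "w = 0")
    case True
    then show ?thesis using a by (simp add: window_mean_def sinc_def scaleR_conv_of_real)
  next
    case False
    have "((\<lambda>t. c * cis (w * t)) has_integral (c / (\<i> * w) * cis (w * (x + a)) - c / (\<i> * w) * cis (w * (x - a)))) {x - a..x + a}"
    proof (rule fundamental_theorem_of_calculus)
      show "((\<lambda>t. c / (\<i> * w) * cis (w * t)) has_vector_derivative c * cis (w * y)) (at y within {x - a..x + a})" for y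
        using has_vector_derivative_mult_right[OF cis_linear_deriv[of w y], of "c / (\<i> * w)"] False by simp
    qed (use a in auto)
    then have "integral {x - a..x + a} (\<lambda>t. c * cis (w * t)) = c / (\<i> * w) * (cis (w * (x + a)) - cis (w * (x - a)))"
      unfolding right_diff_distrib by (rule integral_unique)
    also have "cis (w * (x + a)) - cis (w * (x - a)) = cis (w * x) * (2 * \<i> * sin (a * w))"
      by (simp add: complex_eq_iff sin_add cos_add sin_diff cos_diff algebra_simps)
    finally show ?thesis using a False by (simp add: window_mean_def sinc_def field_simps)
  qed
  then have "window_mean a (\<lambda>t. c * cis (w * t)) = (\<lambda>x. (c * sinc (a * w)) * cis (w * x))" by (rule ext)
  then show ?case using Cons.IH[of "c * sinc (a * w)"] Cons.prems by (simp add: mult_ac)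
qed simp

lemma sinc_lower_bound:
  assumes "0 \<le> x" "x \<le> 1"
  shows "exp (- x / 3) \<le> sinc x"
proof (cases "x = 0")
  case False
  then have x: "x > 0" using assms by simp
  have "\<bar>sin x - (\<Sum>m<3. sin_coeff m * x ^ m)\<bar> \<le> inverse (fact 3) * \<bar>x\<bar> ^ 3"
    by (rule Maclaurin_sin_bound)
  then have "\<bar>sin x - x\<bar> \<le> x ^ 3 / 6"
    using x by (simp add: eval_nat_numeral sin_coeff_def)
  then have "x - x ^ 3 / 6 \<le> sin x" by linarith
  then have "(x - x ^ 3 / 6) / x \<le> sin x / x" using x by (intro divide_right_mono) auto
  moreover have "(x - x ^ 3 / 6) / x = 1 - x\<^sup>2 / 6" using x by (simp add: field_simps eval_nat_numeral)
  ultimately have 1: "1 - x\<^sup>2 / 6 \<le> sinc x" using False by (simp add: sinc_def)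
  have "x\<^sup>2 \<le> x" using assms by (simp add: power2_eq_square mult_left_le)
  moreover have "exp (- (x / 3)) \<le> 1 - (x / 3) / 2"
  proof -
    have "exp (- (x / 3)) * exp (x / 3) = 1" by (simp flip: exp_add)
    moreover have "1 \<le> (1 - (x / 3) / 2) * (1 + x / 3)" using assms 
      by (simp add: algebra_simps mult_left_mono)
    moreover have "(1 - (x / 3) / 2) * (1 + x / 3) \<le> (1 - (x / 3) / 2) * exp (x / 3)"
      using assms by (intro mult_left_mono) (auto intro: exp_ge_add_one_self)
    ultimately have "exp (- (x / 3)) * exp (x / 3) \<le> (1 - (x / 3) / 2) * exp (x / 3)" by linarith
    then show ?thesis by simp
  qed
  ultimately show ?thesis using 1 by simp
qed (simp add: sinc_def)

section \<open>Low frequencies\<close>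

lemma L2_mono_interval:
  assumes "L2 Q f" "T \<le> Q"
  shows "L2 T f"
proof -
  note [measurable] = L2_measurable[OF assms(1)]
  have "(\<lambda>x. indicator {0..T} x *\<^sub>R (indicator {0..Q} x *\<^sub>R f x)) \<in> borel_measurable borel" by measurable
  also have "(\<lambda>x. indicator {0..T} x *\<^sub>R (indicator {0..Q} x *\<^sub>R f x)) = (\<lambda>x. indicator {0..T} x *\<^sub>R f x)"
    using assms(2) by (auto simp: indicator_def)
  finally have "set_borel_measurable lborel {0..T} f" by (simp add: set_borel_measurable_def)
  moreover have "set_integrable lborel {0..T} (\<lambda>x. (norm (f x))\<^sup>2)"
    by (rule set_integrable_subset[OF L2_sq_integrable[OF assms(1)]]) (use assms(2) in auto)
  ultimately show ?thesis by (simp add: L2_def)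
qed

lemma norm_LINT_le_L2_norm:
  assumes "L2 T g" "t \<in> {0..T}"
  shows "norm (LINT x:{0..t}|lborel. g x) \<le> sqrt T * L2_norm T g"
proof -
  have c: "L2 t (\<lambda>_. 1)" by (intro L2_continuous continuous_intros)
  have "norm (L2_inner t g (\<lambda>_. 1)) \<le> L2_norm t g * L2_norm t (\<lambda>_. 1)"
    using assms by (intro L2_Cauchy_Schwarz c L2_mono_interval[OF assms(1)]) auto
  also have "L2_norm t (\<lambda>_. 1) = sqrt t"
    using assms by (simp add: L2_norm_def set_lebesgue_integral_def)
  also have "L2_norm t g * sqrt t \<le> L2_norm T g * sqrt T"
    using assms by (intro mult_mono L2_norm_mono_interval L2_norm_nonneg) auto
  finally show ?thesis by (simp add: L2_inner_def mult.commute)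
qed

text \<open>A single term of the binomial expansion of \<open>(x + (1 - x)) ^ (n + J)\<close>.\<close>

lemma binomial_power_le:
  assumes "0 < x" "x < (1::real)"
  shows "real ((n + J) choose J) * x ^ J \<le> (1 / (1 - x)) ^ n"
proof -
  have "real ((n + J) choose J) * x ^ J * (1 - x) ^ (n + J - J) \<le> (\<Sum>j\<le>n + J. real ((n + J) choose j) * x ^ j * (1 - x) ^ (n + J - j))"
    using assms by (intro member_le_sum) auto
  also have "\<dots> = (x + (1 - x)) ^ (n + J)" by (rule binomial_ring[symmetric])
  finally have "real ((n + J) choose J) * x ^ J * (1 - x) ^ n \<le> 1" by simp
  then show ?thesis using assms by (simp add: power_divide field_simps)
qed

text \<open>The cost of \<open>J\<close> steps of the lateral iteration in units in which \<open>L\<close> drops out: the product of the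
  inverse window widths against the decay \<open>1 / (2 J)!\<close> of the test functions.\<close>

definition rising_ratio :: "nat \<Rightarrow> nat \<Rightarrow> real" where
  "rising_ratio n J = (\<Prod>i=1..J. real (n + i))\<^sup>2 / fact (2 * J)"

text \<open>The ratio equals \<open>((n + J) choose J)\<^sup>2 / (2 J choose J)\<close>, and the denominator is about \<open>4 ^ J\<close>.  In
  the bound of the binomial coefficient \<open>x = 1/2\<close> absorbs \<open>4 ^ J\<close> completely, which is the right choice
  for the sum over \<open>J\<close>; \<open>x = 3/4\<close> has a larger constant but leaves geometric decay, for the remainder.\<close>

lemma rising_ratio_bounds:
  assumes "J \<ge> 1"
  shows "rising_ratio n J \<le> 2 * real J * 4 ^ n" "rising_ratio n J \<le> 2 * real J * 16 ^ n * (4 / 9) ^ J"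
proof -
  define b where "b = real ((n + J) choose J)"
  have "(\<Prod>i=1..j. real (n + i)) * fact n = fact (n + j)" for j
  proof (induction j)
    case (Suc j)
    have "(\<Prod>i=1..Suc j. real (n + i)) * fact n = real (n + Suc j) * ((\<Prod>i=1..j. real (n + i)) * fact n)"
      by (simp add: mult_ac)
    then show ?case unfolding Suc by simp
  qed simp
  then have "(\<Prod>i=1..J. real (n + i)) = fact (n + J) / fact n" by (simp add: field_simps)
  also have "\<dots> = fact J * b" by (simp add: b_def binomial_fact)
  finally have "rising_ratio n J = b\<^sup>2 * ((fact J)\<^sup>2 / fact (2 * J))"
    by (simp add: rising_ratio_def power_mult_distrib)
  moreover have "(fact J)\<^sup>2 / fact (2 * J) = 1 / real (2 * J choose J)"
    by (simp add: binomial_fact power2_eq_square mult_2)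
  moreover have "1 / real (2 * J choose J) \<le> 1 / (4 ^ J / (2 * real J))"
    using central_binomial_lower_bound[of J] assms by (intro divide_left_mono) auto
  ultimately have "rising_ratio n J \<le> b\<^sup>2 * (1 / (4 ^ J / (2 * real J)))"
    by (simp only: mult_left_mono zero_le_power2)
  then have r: "rising_ratio n J \<le> 2 * real J * (b\<^sup>2 / 4 ^ J)"
    by (simp add: mult_ac)
  have x: "b\<^sup>2 / 4 ^ J \<le> ((1 / (1 - x)) ^ n)\<^sup>2 * (1 / (4 * x\<^sup>2)) ^ J" if "0 < x" "x < 1" for x
  proof -
    have "(b * x ^ J)\<^sup>2 \<le> ((1 / (1 - x)) ^ n)\<^sup>2"
      unfolding b_def by (intro power_mono binomial_power_le that mult_nonneg_nonneg) (use that in auto)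
    then have "(b * x ^ J)\<^sup>2 * (1 / (4 * x\<^sup>2)) ^ J \<le> ((1 / (1 - x)) ^ n)\<^sup>2 * (1 / (4 * x\<^sup>2)) ^ J"
      by (intro mult_right_mono) auto
    also have "(b * x ^ J)\<^sup>2 * (1 / (4 * x\<^sup>2)) ^ J = b\<^sup>2 / 4 ^ J"
    proof -
      have "(x ^ J)\<^sup>2 = (x\<^sup>2) ^ J" by (simp add: power_mult[symmetric] mult.commute)
      then show ?thesis using that(1) by (simp add: power_mult_distrib power_divide)
    qed
    finally show ?thesis .
  qed
  have p: "((c::real) ^ n)\<^sup>2 = (c\<^sup>2) ^ n" for c by (simp add: power_mult[symmetric] mult.commute)
  have "b\<^sup>2 / 4 ^ J \<le> 4 ^ n"
    using x[of "1/2"] unfolding p by (simp add: power2_eq_square)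
  then show "rising_ratio n J \<le> 2 * real J * 4 ^ n"
    using r by (intro order_trans[OF r] mult_left_mono) auto
  have "b\<^sup>2 / 4 ^ J \<le> 16 ^ n * (4 / 9) ^ J"
    using x[of "3/4"] unfolding p by (simp add: power2_eq_square)
  then show "rising_ratio n J \<le> 2 * real J * 16 ^ n * (4 / 9) ^ J"
    unfolding mult.assoc[of _ "16 ^ n"] using r by (intro order_trans[OF r] mult_left_mono) auto
qed

lemma sum_inverse_squares_le:
  assumes "n \<ge> 1"
  shows "(\<Sum>i=1..K. 1 / (real (n + i))\<^sup>2) \<le> 1 / real n - 1 / real (n + K)"
proof (induction K)
  case (Suc K)
  have "1 / (real (n + Suc K))\<^sup>2 \<le> 1 / (real (n + K) * real (n + Suc K))"
    using assms by (intro divide_left_mono) (auto simp: power2_eq_square intro!: mult_right_mono)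
  also have "\<dots> = 1 / real (n + K) - 1 / real (n + Suc K)"
    using assms by (simp add: field_simps)
  finally have "1 / (real (n + Suc K))\<^sup>2 \<le> 1 / real (n + K) - 1 / real (n + Suc K)" .
  then show ?case using Suc by (simp del: of_nat_add of_nat_Suc)
qed simp

context observed_solution
begin

definition clamp_time :: "real \<Rightarrow> real" where "clamp_time t = max 0 (min T t)"

text \<open>Extended to all times by constancy outside \<open>[0,T]\<close>, so that iterated means are means of continuous
  functions on the line.\<close>

definition pairing :: "(real \<Rightarrow> complex) \<Rightarrow> real \<Rightarrow> complex" where
  "pairing v t = L2_inner L (u (clamp_time t)) v"

definition trace_primitive :: "real \<Rightarrow> complex" where
  "trace_primitive t = (LINT x:{0..clamp_time t}|lborel. g x)"

lemma clamp_time: "clamp_time t \<in> {0..T}" "t \<in> {0..T} \<Longrightarrow> clamp_time t = t"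
  using T by (auto simp: clamp_time_def)

lemma clamp_time_continuous: "continuous_on A clamp_time"
  unfolding clamp_time_def by (intro continuous_intros)

lemma pairing_continuous:
  assumes "continuous_on UNIV v"
  shows "continuous_on UNIV (pairing v)"
proof -
  have "L2 L v" by (intro L2_continuous continuous_on_subset[OF assms]) auto
  then show ?thesis
    unfolding pairing_def
    by (rule continuous_on_compose2[OF L2_inner_u_continuous clamp_time_continuous])
       (use clamp_time(1) in auto)
qed

lemma trace_primitive_continuous: "continuous_on UNIV trace_primitive"
proof -
  have "has_weak_deriv T (\<lambda>t. LINT x:{0..t}|lborel. g x) g"
    unfolding has_weak_deriv_def
  proof (intro conjI ballI g_L2)
    have "(\<lambda>y. indicator {0..0} y *\<^sub>R g y) = (\<lambda>y. indicator {0} y *\<^sub>R g 0)"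
      by (auto simp: indicator_def)
    then have "(LINT x:{0..0}|lborel. g x) = 0"
      by (simp add: set_lebesgue_integral_def)
    then show "(LINT x:{0..t}|lborel. g x) = (LINT x:{0..0}|lborel. g x) + (LINT y:{0..t}|lborel. g y)" for t by simp
  qed
  from H1_continuous[OF this] show ?thesis
    unfolding trace_primitive_def
    by (rule continuous_on_compose2[OF _ clamp_time_continuous]) (use clamp_time(1) in auto)
qed

lemma norm_trace_primitive: "norm (trace_primitive t) \<le> sqrt T * L2_norm T g"
  unfolding trace_primitive_def by (rule norm_LINT_le_L2_norm[OF g_L2 clamp_time(1)])

text \<open>One step of the lateral Cauchy problem: integrating the pairing with \<open>v''\<close> in time produces the
  increment of the pairing with \<open>v\<close> and an observed quantity.\<close>

lemma integral_pairing:
  assumes v: "\<And>x. (v has_vector_derivative v' x) (at x)" "\<And>x. (v' has_vector_derivative v'' x) (at x)"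
    and c: "continuous_on UNIV v''" and v0: "v 0 = 0" "v' 0 = 0"
    and xy: "0 \<le> x" "x \<le> y" "y \<le> T"
  shows "integral {x..y} (pairing v'') = \<i> * (pairing v y - pairing v x)
     - cnj (v L) * (trace_primitive y - trace_primitive x)"
proof -
  let ?P = "\<lambda>t. integral {0..t} (pairing v'')"
  have cp: "continuous_on A (pairing v'')" for A using pairing_continuous[OF c] by (rule continuous_on_subset) auto
  have eq: "?P t = \<i> * (pairing v t - pairing v 0) - cnj (v L) * trace_primitive t" if t: "t \<in> {0..T}" for t
  proof -
    have gi: "set_integrable lborel {0..t} g"
      by (rule set_integrable_subset[OF L2_set_integrable[OF g_L2]]) (use t in auto)
    have "L2_inner L (u t) v - L2_inner L (u 0) v = (LINT \<tau>:{0..t}|lborel. - \<i> * (cnj (v L) * g \<tau> + L2_inner L (u \<tau>) v''))"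
      using v0 by (intro has_weak_deriv_integral[symmetric, OF weak_deriv_L2_inner_u[OF v c] t]) auto
    also have "\<dots> = (LINT \<tau>:{0..t}|lborel. - \<i> * (cnj (v L) * g \<tau> + pairing v'' \<tau>))"
      using t by (intro set_lebesgue_integral_cong) (auto simp: pairing_def clamp_time)
    also have "\<dots> = - \<i> * (cnj (v L) * (LINT \<tau>:{0..t}|lborel. g \<tau>) + (LINT \<tau>:{0..t}|lborel. pairing v'' \<tau>))"
      by (subst set_integral_mult_right, subst set_integral_add)
         (auto intro!: gi borel_integrable_atLeastAtMost'[OF cp])
    also have "(LINT \<tau>:{0..t}|lborel. pairing v'' \<tau>) = ?P t"
      by (rule set_borel_integral_eq_integral(2)[OF borel_integrable_atLeastAtMost'[OF cp]])
    finally have "pairing v t - pairing v 0 = - \<i> * (cnj (v L) * trace_primitive t + ?P t)"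
      using t T by (simp add: pairing_def trace_primitive_def clamp_time)
    then have "\<i> * (pairing v t - pairing v 0) = \<i> * (- \<i> * (cnj (v L) * trace_primitive t + ?P t))" by simp
    then show ?thesis by (simp flip: mult.assoc)
  qed
  have "?P x + integral {x..y} (pairing v'') = ?P y"
    using xy by (intro Henstock_Kurzweil_Integration.integral_combine continuous_integrable_on cp) auto
  then show ?thesis using eq[of x] eq[of y] xy by (simp add: algebra_simps)
qed

text \<open>A mean over a window of half width \<open>a\<close> turns the increment into a difference quotient and costs the
  factor \<open>1 / a\<close>.  The remaining means commute with translations and do not increase the supremum.\<close>

lemma lateral_step:
  assumes v: "\<And>x. (v has_vector_derivative v' x) (at x)" "\<And>x. (v' has_vector_derivative v'' x) (at x)"
    and c: "continuous_on UNIV v''" and v0: "v 0 = 0" "v' 0 = 0"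
    and a: "a > 0" "\<forall>b\<in>set as. b > 0"
    and t: "a + sum_list as \<le> t" "t + a + sum_list as \<le> T"
    and B: "\<And>s. sum_list as \<le> s \<Longrightarrow> s + sum_list as \<le> T \<Longrightarrow> norm (mean as (pairing v) s) \<le> B"
  shows "norm (mean (a # as) (pairing v'') t) \<le> (B + norm (v L) * (sqrt T * L2_norm T g)) / a"
proof -
  define \<gamma> where "\<gamma> = sqrt T * L2_norm T g"
  define \<beta> where "\<beta> = - cnj (v L) / of_real (2 * a)"
  define h where "h x = \<beta> * trace_primitive (x + a) + (- \<beta>) * trace_primitive (x + (- a))" for x
  define w where "w x = (\<i> / of_real (2 * a)) * pairing v (x + a) + (- \<i> / of_real (2 * a)) * pairing v (x + (- a))" for x
  have "continuous_on UNIV v"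
    using v(1) by (meson continuous_at_imp_continuous_on has_vector_derivative_continuous)
  then have vc: "continuous_on UNIV (pairing v)" by (rule pairing_continuous)
  have sh: "continuous_on UNIV (\<lambda>x. f (x + d))" if "continuous_on UNIV f" for f :: "real \<Rightarrow> complex" and d
    by (rule continuous_on_compose2[OF that]) (auto intro!: continuous_intros)
  have hc: "continuous_on UNIV h" and wc: "continuous_on UNIV w"
    unfolding h_def w_def by (intro continuous_on_add continuous_on_mult_left sh vc trace_primitive_continuous)+
  have "mean (a # as) (pairing v'') t = mean as (\<lambda>x. 1 * w x + 1 * h x) t"
    unfolding mean.simps
  proof (rule mean_cong)
    fix x assume x: "x \<in> {t - sum_list as..t + sum_list as}"
    show "window_mean a (pairing v'') x = 1 * w x + 1 * h x"
      using x t a(1) by (simp add: window_mean_def integral_pairing[OF v c v0] w_def h_def \<beta>_def field_simps)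
  qed
  also have "\<dots> = 1 * mean as w t + 1 * mean as h t"
    by (rule mean_linear[OF wc hc a(2)])
  also have "norm \<dots> \<le> norm (mean as w t) + norm (mean as h t)"
    using norm_triangle_ineq by simp
  also have "norm (mean as w t) \<le> B / a"
  proof -
    have "mean as w t = (\<i> / of_real (2 * a)) * mean as (pairing v) (t + a) + (- \<i> / of_real (2 * a)) * mean as (pairing v) (t + (- a))"
      unfolding w_def by (subst mean_linear[OF sh[OF vc] sh[OF vc] a(2)]) (simp only: mean_shift[OF vc a(2)])
    also have "norm \<dots> \<le> norm ((\<i> / of_real (2 * a)) * mean as (pairing v) (t + a)) + norm ((- \<i> / of_real (2 * a)) * mean as (pairing v) (t + (- a)))"
      by (rule norm_triangle_ineq)
    also have "\<dots> = norm (mean as (pairing v) (t + a)) / (2 * a) + norm (mean as (pairing v) (t + (- a))) / (2 * a)"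
      using a(1) by (simp add: norm_mult norm_divide)
    also have "\<dots> \<le> B / (2 * a) + B / (2 * a)"
      using a(1) t by (intro add_mono divide_right_mono B) auto
    finally show ?thesis by simp
  qed
  also have "norm (mean as h t) \<le> norm (v L) * \<gamma> / a"
  proof (rule norm_mean_le[OF hc _ a(2)])
    fix x
    have "norm (h x) \<le> norm (\<beta> * trace_primitive (x + a)) + norm ((- \<beta>) * trace_primitive (x + (- a)))"
      unfolding h_def by (rule norm_triangle_ineq)
    also have "\<dots> \<le> norm \<beta> * \<gamma> + norm \<beta> * \<gamma>"
      unfolding norm_mult norm_minus_cancel \<gamma>_def by (intro add_mono mult_left_mono norm_trace_primitive) auto
    also have "\<dots> = norm (v L) * \<gamma> / a" using a(1) by (simp add: \<beta>_def norm_divide)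
    finally show "norm (h x) \<le> norm (v L) * \<gamma> / a" .
  qed
  finally show ?thesis by (simp add: \<gamma>_def add_divide_distrib)
qed

end

text \<open>The windows left after \<open>j\<close> steps.  Half widths of order \<open>1 / i\<^sup>2\<close> are summable and still balance the
  decay \<open>1 / (2 j)!\<close> of the test functions; the shift \<open>n\<close> makes the total width small.\<close>

definition widths :: "real \<Rightarrow> nat \<Rightarrow> nat \<Rightarrow> nat \<Rightarrow> real list" where
  "widths L n K j = map (\<lambda>i. L\<^sup>2 / (real (n + i))\<^sup>2) [Suc j..<Suc K]"

lemma sum_list_widths:
  assumes "n \<ge> 1"
  shows "sum_list (widths L n K 0) \<le> L\<^sup>2 / real n"
proof -
  have "sum_list (widths L n K 0) = (\<Sum>i=1..K. L\<^sup>2 * (1 / (real (n + i))\<^sup>2))"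
    unfolding widths_def
    by (subst sum.distinct_set_conv_list[symmetric]) (auto simp: atLeastLessThanSuc_atLeastAtMost simp del: upt_Suc)
  also have "\<dots> \<le> L\<^sup>2 * (1 / real n - 1 / real (n + K))"
    unfolding sum_distrib_left[symmetric] by (intro mult_left_mono sum_inverse_squares_le assms) auto
  also have "\<dots> \<le> L\<^sup>2 * (1 / real n)" by (intro mult_left_mono) auto
  finally show ?thesis by simp
qed

text \<open>For frequencies up to \<open>2 L / T\<close> all arguments \<open>x i\<close> of \<open>sinc\<close> are at most \<open>1\<close>, and they add up to at most
  \<open>2 L\<^sup>2 / T\<close>; each factor is at least \<open>exp (- x i / 3)\<close>.\<close>

lemma prod_sinc_widths:
  assumes n: "n \<ge> 1" and T: "T > 0" and L: "L > 0" and nT: "2 * L\<^sup>2 / T \<le> real n" and w: "0 \<le> w" "w \<le> (2 * L / T)\<^sup>2"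
  shows "exp (- (2 / 3) * (L\<^sup>2 / T)) \<le> (\<Prod>a\<leftarrow>widths L n K 0. sinc (a * w))"
proof -
  define x where "x i = L\<^sup>2 / (real (n + i))\<^sup>2 * w" for i
  have x0: "x i \<ge> 0" for i using w(1) by (simp add: x_def)
  have x1: "x i \<le> 1" for i
  proof -
    have "2 * L\<^sup>2 / T \<le> real (n + i)" using nT by simp
    then have "(2 * L\<^sup>2 / T)\<^sup>2 \<le> (real (n + i))\<^sup>2" using T by (intro power_mono) auto
    moreover have "L\<^sup>2 * w \<le> L\<^sup>2 * (2 * L / T)\<^sup>2" by (intro mult_left_mono w) auto
    then have "L\<^sup>2 * w \<le> (2 * L\<^sup>2 / T)\<^sup>2" by (simp add: power2_eq_square mult_ac)
    ultimately have "L\<^sup>2 * w \<le> (real (n + i))\<^sup>2" by linarith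
    then show ?thesis using n by (simp add: x_def)
  qed
  have "(\<Sum>i=1..K. x i) = L\<^sup>2 * w * (\<Sum>i=1..K. 1 / (real (n + i))\<^sup>2)"
    by (simp add: x_def sum_distrib_left)
  also have "\<dots> \<le> L\<^sup>2 * w * (1 / real n)"
    using sum_inverse_squares_le[OF n, of K] w(1) by (intro mult_left_mono) (auto intro: order_trans)
  also have "\<dots> \<le> (L\<^sup>2 * (2 * L / T)\<^sup>2) * (1 / real n)"
    using n by (intro mult_right_mono mult_left_mono w) auto
  also have "\<dots> \<le> (L\<^sup>2 * (2 * L / T)\<^sup>2) * (1 / (2 * L\<^sup>2 / T))"
    using nT T L n by (intro mult_left_mono divide_left_mono mult_pos_pos) auto
  also have "\<dots> = 2 * (L\<^sup>2 / T)" using T L by (simp add: field_simps power2_eq_square)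
  finally have "- (2 / 3) * (L\<^sup>2 / T) \<le> (\<Sum>i=1..K. - x i / 3)"
    by (simp add: sum_negf sum_divide_distrib[symmetric])
  then have "exp (- (2 / 3) * (L\<^sup>2 / T)) \<le> exp (\<Sum>i=1..K. - x i / 3)" by simp
  also have "\<dots> = (\<Prod>i=1..K. exp (- x i / 3))" by (rule exp_sum) simp
  also have "\<dots> \<le> (\<Prod>i=1..K. sinc (x i))"
    by (intro prod_mono) (use sinc_lower_bound[OF x0 x1] in auto)
  also have "\<dots> = (\<Prod>a\<leftarrow>widths L n K 0. sinc (a * w))"
    unfolding widths_def x_def map_map o_def
    by (subst prod.distinct_set_conv_list[symmetric]) (auto simp: atLeastLessThanSuc_atLeastAtMost simp del: upt_Suc)
  finally show ?thesis .
qed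

context observed_solution
begin

text \<open>The products \<open>Q\<close> of the inverse half widths are the weights that make the bounds of successive
  steps telescope.\<close>

lemma lateral_iteration:
  assumes f: "continuous_on UNIV f" and n: "n \<ge> 1" and j: "j \<le> K"
    and S: "\<And>t. norm (pairing (iterint f (2 * K)) t) \<le> S"
    and t: "sum_list (widths L n K j) \<le> t" "t + sum_list (widths L n K j) \<le> T"
  defines "Q \<equiv> \<lambda>J. \<Prod>i=1..J. (real (n + i))\<^sup>2 / L\<^sup>2"
  shows "Q j * norm (mean (widths L n K j) (pairing (iterint f (2 * j))) t) \<le>
    (\<Sum>J=Suc j..K. norm (iterint f (2 * J) L) * Q J) * (sqrt T * L2_norm T g) + S * Q K"
  using j t
proof (induction j arbitrary: t rule: inc_induct)
  case base
  have "Q K \<ge> 0" by (auto simp: Q_def intro!: prod_nonneg)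
  then show ?case using mult_left_mono[OF S[of t], of "Q K"] by (simp add: widths_def mult.commute)
next
  case (step j)
  define a where "a = L\<^sup>2 / (real (n + Suc j))\<^sup>2"
  define \<gamma> where "\<gamma> = sqrt T * L2_norm T g"
  have a: "a > 0" using L n by (simp add: a_def)
  have Qp: "Q J > 0" for J using L n by (auto simp: Q_def intro!: prod_pos)
  have Qs: "Q j / a = Q (Suc j)" using L by (simp add: Q_def a_def)
  have w: "widths L n K j = a # widths L n K (Suc j)"
    using step(2) by (simp add: widths_def a_def upt_conv_Cons del: upt_Suc)
  define X where "X = (\<Sum>J=Suc (Suc j)..K. norm (iterint f (2 * J) L) * Q J) * \<gamma> + S * Q K"
  have "norm (mean (a # widths L n K (Suc j)) (pairing (iterint f (2 * j))) t) \<le>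
      (X / Q (Suc j) + norm (iterint f (2 * Suc j) L) * (sqrt T * L2_norm T g)) / a"
  proof (rule lateral_step)
    show "(iterint f (2 * Suc j) has_vector_derivative iterint f (Suc (2 * j)) x) (at x)" for x
      using iterint_deriv[OF f, of "Suc (2 * j)" x] by simp
    show "(iterint f (Suc (2 * j)) has_vector_derivative iterint f (2 * j) x) (at x)" for x
      by (rule iterint_deriv[OF f])
    show "iterint f (2 * Suc j) 0 = 0" "iterint f (Suc (2 * j)) 0 = 0"
      using iterint_at_0[OF f, of "Suc (2 * j)"] iterint_at_0[OF f, of "2 * j"] by simp_all
    show "continuous_on UNIV (iterint f (2 * j))" by (rule iterint_continuous[OF f])
    show "\<forall>b\<in>set (widths L n K (Suc j)). b > 0" using L n by (auto simp: widths_def)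
    show "a + sum_list (widths L n K (Suc j)) \<le> t" "t + a + sum_list (widths L n K (Suc j)) \<le> T"
      using step.prems unfolding w by (simp_all add: add.assoc)
    fix s assume "sum_list (widths L n K (Suc j)) \<le> s" "s + sum_list (widths L n K (Suc j)) \<le> T"
    then have "Q (Suc j) * norm (mean (widths L n K (Suc j)) (pairing (iterint f (2 * Suc j))) s) \<le> X"
      unfolding X_def \<gamma>_def by (rule step.IH)
    then show "norm (mean (widths L n K (Suc j)) (pairing (iterint f (2 * Suc j))) s) \<le> X / Q (Suc j)"
      using Qp[of "Suc j"] by (simp add: pos_le_divide_eq mult.commute)
  qed (rule a)
  then have "Q j * norm (mean (widths L n K j) (pairing (iterint f (2 * j))) t) \<le>
      Q j * ((X / Q (Suc j) + norm (iterint f (2 * Suc j) L) * \<gamma>) / a)"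
    unfolding w \<gamma>_def using Qp[of j] by (intro mult_left_mono) auto
  also have "\<dots> = Q j / a * (X / Q (Suc j) + norm (iterint f (2 * Suc j) L) * \<gamma>)" by simp
  also have "\<dots> = norm (iterint f (2 * Suc j) L) * Q (Suc j) * \<gamma> + X"
    unfolding Qs using Qp[of "Suc j"] by (simp add: field_simps)
  also have "\<dots> = (\<Sum>J=Suc j..K. norm (iterint f (2 * J) L) * Q J) * \<gamma> + S * Q K"
    using step(2) by (subst sum.atLeast_Suc_atMost) (auto simp: X_def algebra_simps)
  finally show ?case by (simp add: \<gamma>_def)
qed

text \<open>The iteration starts from the mode itself, at the midpoint of \<open>[0,T]\<close>.  There the iterated mean of the
  pairing is \<open>coef m\<close> up to a phase and the product of the \<open>sinc\<close> factors.\<close>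

lemma low_mode_bound:
  assumes n: "n \<ge> 1" and nT: "2 * L\<^sup>2 / T \<le> real n" and m: "freq k L m < 2 * L / T"
  shows "norm (coef m) * exp (- (2 / 3) * (L\<^sup>2 / T)) \<le>
    sqrt (2 / L) * (\<Sum>J=1..K. rising_ratio n J) * (sqrt T * L2_norm T g) + sqrt 2 * L2_norm L (u 0) * rising_ratio n K"
proof -
  define f where "f = smode k L m"
  define b where "b = sqrt (2 / L)"
  define Q where "Q J = (\<Prod>i=1..J. (real (n + i))\<^sup>2 / L\<^sup>2)" for J
  define w where "w = (freq k L m)\<^sup>2"
  define \<gamma> where "\<gamma> = sqrt T * L2_norm T g"
  define S where "S = L2_norm L (u 0) * (sqrt L * (b * L ^ (2 * K) / fact (2 * K)))"
  have b: "b \<ge> 0" using L by (simp add: b_def)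
  have f: "continuous_on UNIV f" unfolding f_def by (rule mode_continuous)
  have fb: "norm (f x) \<le> b" for x
  proof -
    have "norm (f x) = b * \<bar>sin (freq k L m * (L - x))\<bar>"
      unfolding f_def smode_def b_def norm_of_real abs_mult using L by simp
    also have "\<dots> \<le> b * 1" by (intro mult_left_mono b) auto
    finally show ?thesis by simp
  qed
  have it: "norm (iterint f i x) \<le> b * L ^ i / fact i" if "x \<in> {0..L}" for i x
  proof -
    have "norm (iterint f i x) \<le> b * x ^ i / fact i" by (rule norm_iterint_le[OF f fb that])
    also have "\<dots> \<le> b * L ^ i / fact i"
      using that b by (intro divide_right_mono mult_left_mono power_mono) auto
    finally show ?thesis .
  qed
  have QR: "b * L ^ (2 * J) / fact (2 * J) * Q J = b * rising_ratio n J" for J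
  proof -
    have "Q J = (\<Prod>i=1..J. real (n + i))\<^sup>2 / L ^ (2 * J)"
      by (simp add: Q_def prod_dividef prod_power_distrib power_mult)
    then show ?thesis using L by (simp add: rising_ratio_def)
  qed
  have Q0: "Q J \<ge> 0" for J by (auto simp: Q_def intro!: prod_nonneg)
  have S: "norm (pairing (iterint f (2 * K)) t) \<le> S" for t
  proof -
    have i2: "L2 L (iterint f (2 * K))"
      by (intro L2_continuous continuous_on_subset[OF iterint_continuous[OF f]]) auto
    have "norm (pairing (iterint f (2 * K)) t) \<le> L2_norm L (u (clamp_time t)) * L2_norm L (iterint f (2 * K))"
      unfolding pairing_def using clamp_time(1)[of t] by (intro L2_Cauchy_Schwarz u_L2 i2) auto
    also have "\<dots> \<le> L2_norm L (u 0) * (sqrt L * (b * L ^ (2 * K) / fact (2 * K)))"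
      unfolding L2_norm_u[OF clamp_time(1)]
      using L b by (intro mult_left_mono L2_norm_bounded i2 it L2_norm_nonneg) auto
    finally show ?thesis by (simp add: S_def)
  qed
  have sw: "sum_list (widths L n K 0) \<le> T / 2"
  proof -
    have "L\<^sup>2 / real n \<le> T / 2" using nT n T by (simp add: field_simps)
    then show ?thesis using sum_list_widths[OF n, of L K] by linarith
  qed
  have "norm (mean (widths L n K 0) (pairing f) (T / 2)) \<le>
    (\<Sum>J=1..K. norm (iterint f (2 * J) L) * Q J) * \<gamma> + S * Q K"
    using lateral_iteration[OF f n _ S, of 0 "T / 2"] sw by (simp add: Q_def \<gamma>_def)
  also have "\<dots> \<le> (\<Sum>J=1..K. b * rising_ratio n J) * \<gamma> + sqrt 2 * L2_norm L (u 0) * rising_ratio n K"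
  proof (intro add_mono mult_right_mono sum_mono)
    show "norm (iterint f (2 * J) L) * Q J \<le> b * rising_ratio n J" for J
      unfolding QR[symmetric] using L by (intro mult_right_mono it Q0) auto
    show "0 \<le> \<gamma>" using T by (simp add: \<gamma>_def L2_norm_nonneg)
    have "S * Q K = L2_norm L (u 0) * (sqrt L * (b * rising_ratio n K))"
      unfolding QR[symmetric] by (simp add: S_def)
    also have "\<dots> = (sqrt L * sqrt (2 / L)) * L2_norm L (u 0) * rising_ratio n K" by (simp add: b_def mult_ac)
    also have "sqrt L * sqrt (2 / L) = sqrt 2" using L by (simp flip: real_sqrt_mult)
    finally show "S * Q K \<le> sqrt 2 * L2_norm L (u 0) * rising_ratio n K" by simp
  qed
  finally have up: "norm (mean (widths L n K 0) (pairing f) (T / 2)) \<le>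
     b * (\<Sum>J=1..K. rising_ratio n J) * \<gamma> + sqrt 2 * L2_norm L (u 0) * rising_ratio n K"
    by (simp add: sum_distrib_left)
  have "mean (widths L n K 0) (pairing f) (T / 2) = mean (widths L n K 0) (\<lambda>t. coef m * cis (w * t)) (T / 2)"
  proof (rule mean_cong)
    fix x assume "x \<in> {T / 2 - sum_list (widths L n K 0)..T / 2 + sum_list (widths L n K 0)}"
    then have "x \<in> {0..T}" using sw by auto
    then show "pairing f x = coef m * cis (w * x)"
      by (simp add: pairing_def clamp_time f_def w_def coef_evolution)
  qed
  also have "\<dots> = coef m * of_real (\<Prod>a\<leftarrow>widths L n K 0. sinc (a * w)) * cis (w * (T / 2))"
    using L n by (intro mean_cis) (auto simp: widths_def)
  finally have "norm (mean (widths L n K 0) (pairing f) (T / 2)) = norm (coef m) * \<bar>\<Prod>a\<leftarrow>widths L n K 0. sinc (a * w)\<bar>"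
    by (simp add: norm_mult)
  moreover have "exp (- (2 / 3) * (L\<^sup>2 / T)) \<le> \<bar>\<Prod>a\<leftarrow>widths L n K 0. sinc (a * w)\<bar>"
  proof -
    have "0 \<le> freq k L m" using L by (simp add: freq_def)
    then have "w \<le> (2 * L / T)\<^sup>2" unfolding w_def using m by (intro power_mono) auto
    then have "exp (- (2 / 3) * (L\<^sup>2 / T)) \<le> (\<Prod>a\<leftarrow>widths L n K 0. sinc (a * w))"
      by (intro prod_sinc_widths[OF n T L nT]) (auto simp: w_def)
    then show ?thesis by linarith
  qed
  ultimately have "norm (coef m) * exp (- (2 / 3) * (L\<^sup>2 / T)) \<le> norm (mean (widths L n K 0) (pairing f) (T / 2))"
    by (simp add: mult_left_mono)
  then show ?thesis using up by (simp add: b_def \<gamma>_def)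
qed

end

section \<open>The upper bound\<close>

lemma H1_norm_cong:
  assumes "L \<ge> 0" "\<And>s. s \<in> {0..L} \<Longrightarrow> f s = f' s"
  shows "H1_norm L f = H1_norm L f'"
proof -
  have "has_weak_deriv L f = has_weak_deriv L f'"
    using assms by (auto simp: has_weak_deriv_def fun_eq_iff)
  then have "weak_deriv L f = weak_deriv L f'" by (simp add: weak_deriv_def)
  moreover have "L2_norm L f = L2_norm L f'" by (rule L2_norm_cong) (rule assms(2))
  ultimately show ?thesis by (simp add: H1_norm_def)
qed

text \<open>With \<open>16 n\<close> steps the decay \<open>(4/9) ^ (16 n)\<close> beats the exponential factors that multiply it; so the
  remainder of the lateral iteration, which contains the unknown \<open>L\<^sup>2\<close> norm, can be absorbed.\<close>

lemma low_frequency_remainder_small: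
  fixes n :: nat
  assumes "n \<ge> 1" "\<kappa> \<le> real n / 2"
  shows "sqrt (real n) * exp (2 / 3 * \<kappa>) * sqrt 2 * rising_ratio n (16 * n) \<le> 1 / 4"
proof -
  have n2: "real n \<le> 2 ^ n" by (rule of_nat_less_two_power[THEN less_imp_le])
  have "real n * 1 \<le> real n * real n" using assms(1) by (intro mult_left_mono) auto
  then have "sqrt (real n) \<le> real n" by (intro real_le_lsqrt) (auto simp: power2_eq_square)
  then have a: "sqrt (real n) \<le> 2 ^ n" using n2 by linarith
  have "exp (2 / 3 * \<kappa>) \<le> exp (real n * 1 / 3)" using assms(2) by simp
  also have "\<dots> = exp (1 / 3) ^ n" by (simp add: exp_of_nat_mult[symmetric])
  also have "exp (1 / 3 :: real) \<le> 2"
  proof -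
    have "1 + 1 / 3 + (1/3)\<^sup>2 \<le> (2 :: real)" by (simp add: power2_eq_square)
    then show ?thesis using exp_bound[of "1 / 3 :: real"] by linarith
  qed
  then have "exp (1 / 3 :: real) ^ n \<le> 2 ^ n" by (rule power_mono) simp
  finally have b: "exp (2 / 3 * \<kappa>) \<le> 2 ^ n" .
  have c: "sqrt 2 \<le> 2" by (rule real_le_lsqrt) auto
  have "rising_ratio n (16 * n) \<le> 2 * real (16 * n) * 16 ^ n * (4 / 9) ^ (16 * n)"
    using assms(1) by (intro rising_ratio_bounds) auto
  also have "\<dots> = 32 * real n * (16 * (4 / 9) ^ 16) ^ n"
    by (simp add: power_mult power_mult_distrib)
  also have "\<dots> \<le> 32 * 2 ^ n * (16 * (4 / 9) ^ 16) ^ n"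
    using n2 by (intro mult_right_mono mult_left_mono) auto
  finally have d: "rising_ratio n (16 * n) \<le> 32 * 2 ^ n * (16 * (4 / 9) ^ 16) ^ n" .
  have r0: "rising_ratio n (16 * n) \<ge> 0" by (simp add: rising_ratio_def)
  have "sqrt (real n) * exp (2 / 3 * \<kappa>) * sqrt 2 * rising_ratio n (16 * n) \<le>
      2 ^ n * 2 ^ n * 2 * (32 * 2 ^ n * (16 * (4 / 9) ^ 16) ^ n)"
    using a b c d r0 by (intro mult_mono) auto
  also have "\<dots> = 64 * (2 ^ n * 2 ^ n * 2 ^ n * (16 * (4 / 9) ^ 16) ^ n)" by simp
  also have "2 ^ n * 2 ^ n * 2 ^ n * (16 * (4 / 9) ^ 16) ^ n = (2 * 2 * 2 * (16 * (4 / 9) ^ 16) :: real) ^ n"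
    by (simp only: power_mult_distrib)
  also have "64 * (2 * 2 * 2 * (16 * (4 / 9) ^ 16) :: real) ^ n \<le> 64 * (1 / 256) ^ n"
    by (intro mult_left_mono power_mono) (auto simp: power_divide)
  also have "(1 / 256 :: real) ^ n \<le> 1 / 256" 
    using power_decreasing[of 1 n "1 / 256 :: real"] assms(1) by simp
  then have "64 * (1 / 256 :: real) ^ n \<le> 1 / 4" by simp
  finally show ?thesis .
qed

text \<open>The exact rate is \<open>4 ln 2 = 2.77...\<close>; the rounder value \<open>3\<close> suffices below.\<close>

lemma four_power_le_exp:
  assumes "\<kappa> \<ge> 0" "real n \<le> 2 * \<kappa> + 1"
  shows "4 ^ n \<le> 4 * exp (3 * \<kappa>)"
proof -
  have "(1 + 3 / real 20) ^ 20 \<le> exp (3 :: real)" by (rule exp_ge_one_plus_x_over_n_power_n) auto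
  moreover have "(16 :: real) \<le> (1 + 3 / real 20) ^ 20" by (simp add: power_divide)
  ultimately have e: "(16 :: real) \<le> exp 3" by linarith
  have "(4 :: real) ^ n = 4 powr real n" by (simp add: powr_realpow)
  also have "\<dots> \<le> 4 powr (2 * \<kappa> + 1)" using assms by (intro powr_mono) auto
  also have "\<dots> = 4 * 4 powr (2 * \<kappa>)" by (simp add: powr_add)
  also have "4 powr (2 * \<kappa>) = (4 powr 2) powr \<kappa>" by (rule powr_powr[symmetric])
  also have "(4 powr 2 :: real) = 16" by (simp add: powr_numeral)
  also have "(16 :: real) powr \<kappa> \<le> exp 3 powr \<kappa>" using e assms(1) by (intro powr_mono2) auto
  also have "exp 3 powr \<kappa> = exp (3 * \<kappa>)" by (simp add: powr_def mult.commute)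
  finally show ?thesis by simp
qed

context observed_solution
begin

text \<open>The bounds for low and high frequencies close up: the low modes determine the \<open>L\<^sup>2\<close> norm up to
  \<open>D T / (2 L)\<close>, with \<open>D\<close> the norm of the derivative, and by \<open>energy_bound\<close> this is at most half of the
  \<open>L\<^sup>2\<close> norm up to observed terms.\<close>

lemma observability_bound:
  assumes TL: "T \<le> L\<^sup>2"
  defines "\<kappa> \<equiv> L\<^sup>2 / T"
  defines "X \<equiv> 27648 * \<kappa> ^ 3 * exp (11 / 3 * \<kappa>)"
  shows "H1_norm L (u 0) \<le> 19 * X * sqrt L * (1 + \<kappa> / L) * L2_norm T g"
proof -
  have \<kappa>: "\<kappa> \<ge> 1" using TL T by (simp add: \<kappa>_def)
  define n where "n = nat \<lceil>2 * \<kappa>\<rceil>"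
  have n: "2 * \<kappa> \<le> real n" "real n \<le> 2 * \<kappa> + 1" using \<kappa> by (auto simp: n_def)
  have n1: "n \<ge> 1" using n(1) \<kappa> by linarith
  define K where "K = 16 * n"
  define U where "U = L2_norm L (u 0)"
  define D where "D = L2_norm L (weak_deriv L (u 0))"
  define G where "G = L2_norm T g"
  define R where "R = (\<Sum>J=1..K. rising_ratio n J)"
  \<comment> \<open>\<open>E\<close> undoes the damping by the \<open>sinc\<close> factors; \<open>B\<close> will bound the low coefficients.\<close>
  define E where "E = exp (2 / 3 * \<kappa>)"
  define B where "B = E * (sqrt (2 / L) * R * (sqrt T * G) + sqrt 2 * U * rising_ratio n K)"
  have nn: "U \<ge> 0" "D \<ge> 0" "G \<ge> 0" "E > 0" by (simp_all add: U_def D_def G_def E_def L2_norm_nonneg)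
  have rr: "rising_ratio n J \<ge> 0" for J by (simp add: rising_ratio_def)
  have R0: "R \<ge> 0" by (simp add: R_def sum_nonneg rr)
  have B0: "B \<ge> 0" using nn R0 rr L T by (simp add: B_def)
  have U1: "U \<le> sqrt (real n) * B + D / (2 * L / T)"
    unfolding U_def D_def
  proof (rule low_mode_split)
    fix m
    assume "freq k L m < 2 * L / T"
    moreover have "2 * L\<^sup>2 / T \<le> real n" using n(1) by (simp add: \<kappa>_def)
    ultimately have "norm (coef m) * exp (- (2 / 3) * \<kappa>) \<le>
        sqrt (2 / L) * R * (sqrt T * G) + sqrt 2 * U * rising_ratio n K"
      unfolding \<kappa>_def R_def G_def U_def by (intro low_mode_bound n1)
    then have "E * (norm (coef m) * exp (- (2 / 3) * \<kappa>)) \<le> B"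
      unfolding B_def using nn by (intro mult_left_mono) auto
    moreover have "E * exp (- (2 / 3) * \<kappa>) = 1" by (simp add: E_def flip: exp_add)
    then have "E * (norm (coef m) * exp (- (2 / 3) * \<kappa>)) = norm (coef m)" by (simp add: mult.left_commute)
    ultimately show "norm (coef m) \<le> B" by linarith
  next
    fix m assume "m \<ge> n"
    then have "2 * \<kappa> \<le> real m + real k / 2" using n(1) by linarith
    then have "2 * \<kappa> * 1 \<le> (real m + real k / 2) * pi" using pi_gt3 \<kappa> by (intro mult_mono) auto
    then have "2 * \<kappa> / L \<le> (real m + real k / 2) * pi / L" using L by (intro divide_right_mono) auto
    moreover have "2 * \<kappa> / L = 2 * L / T" using L by (simp add: \<kappa>_def power2_eq_square)
    ultimately show "2 * L / T \<le> freq k L m" by (simp add: freq_def)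
  qed (use L T B0 in auto)
  have D1: "T * D \<le> L * sqrt L * G + L * U"
    unfolding D_def G_def U_def by (rule energy_bound[OF TL])
  have D2: "D \<le> \<kappa> / L * (sqrt L * G + U)"
  proof -
    have "D \<le> (L * sqrt L * G + L * U) / T" using D1 T by (simp add: pos_le_divide_eq mult.commute)
    also have "\<dots> = \<kappa> / L * (sqrt L * G + U)" using L T by (simp add: \<kappa>_def power2_eq_square field_simps)
    finally show ?thesis .
  qed
  have "D / (2 * L / T) \<le> (sqrt L * G + U) / 2"
    using D1 L T by (simp add: field_simps)
  then have U2: "U \<le> 2 * sqrt (real n) * B + sqrt L * G" using U1 by (simp add: field_simps)
  have "\<kappa> \<le> real n / 2" using n(1) by simp
  from low_frequency_remainder_small[OF n1 this]
  have sm: "sqrt (real n) * E * sqrt 2 * rising_ratio n K \<le> 1 / 4" by (simp add: E_def K_def)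
  have "2 * sqrt (real n) * B = 2 * sqrt (real n) * E * (sqrt (2 / L) * R * (sqrt T * G))
      + 2 * U * (sqrt (real n) * E * sqrt 2 * rising_ratio n K)"
    by (simp add: B_def algebra_simps)
  also have "\<dots> \<le> 2 * sqrt (real n) * E * (sqrt (2 / L) * R * (sqrt T * G)) + 2 * U * (1 / 4)"
    using nn by (intro add_left_mono mult_left_mono sm) auto
  finally have U3: "U \<le> 4 * sqrt (real n) * E * (sqrt (2 / L) * R * (sqrt T * G)) + 2 * sqrt L * G"
    using U2 by simp
  define Y where "Y = real n * E * (real K)\<^sup>2 * 4 ^ n"
  have n3: "real n \<le> 3 * \<kappa>" using n(2) \<kappa> by linarith
  have YX: "Y \<le> X"
  proof -
    have "Y \<le> (3 * \<kappa>) * E * (48 * \<kappa>)\<^sup>2 * (4 * exp (3 * \<kappa>))"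
      unfolding Y_def K_def using n3 n(2) \<kappa> nn by (intro mult_mono power_mono four_power_le_exp) auto
    also have "\<dots> = 27648 * \<kappa> ^ 3 * (E * exp (3 * \<kappa>))" by (simp add: power2_eq_square power3_eq_cube)
    also have "E * exp (3 * \<kappa>) = exp (11 / 3 * \<kappa>)" by (simp add: E_def flip: exp_add)
    finally show ?thesis by (simp add: X_def)
  qed
  have X1: "1 \<le> X"
  proof -
    have "1 * 1 * 1 \<le> 27648 * \<kappa> ^ 3 * exp (11 / 3 * \<kappa>)"
      using \<kappa> one_le_power[OF \<kappa>, of 3] by (intro mult_mono) auto
    then show ?thesis by (simp add: X_def)
  qed
  have "4 * sqrt (real n) * E * (sqrt (2 / L) * R * (sqrt T * G)) \<le> 16 * Y * sqrt L * G"
  proof -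
    have "R \<le> (\<Sum>J=1..K. 2 * real K * 4 ^ n)"
      unfolding R_def
    proof (rule sum_mono)
      fix J assume J: "J \<in> {1..K}"
      then have "rising_ratio n J \<le> 2 * real J * 4 ^ n" by (intro rising_ratio_bounds) auto
      also have "\<dots> \<le> 2 * real K * 4 ^ n" using J by (intro mult_right_mono) auto
      finally show "rising_ratio n J \<le> 2 * real K * 4 ^ n" .
    qed
    also have "\<dots> = 2 * (real K)\<^sup>2 * 4 ^ n" by (simp add: power2_eq_square)
    finally have R: "R \<le> 2 * (real K)\<^sup>2 * 4 ^ n" .
    have "real n * 1 \<le> real n * real n" using n1 by (intro mult_left_mono) auto
    then have sn: "sqrt (real n) \<le> real n" by (intro real_le_lsqrt) (auto simp: power2_eq_square)
    have "2 / L * T \<le> 2 / L * L\<^sup>2" using L TL by (intro mult_left_mono) auto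
    also have "\<dots> = 2 * L" using L by (simp add: power2_eq_square)
    also have "\<dots> \<le> 2\<^sup>2 * L" using L by simp
    finally have "sqrt (2 / L * T) \<le> sqrt (2\<^sup>2 * L)" by (rule real_sqrt_le_mono)
    then have st: "sqrt (2 / L) * sqrt T \<le> 2 * sqrt L" by (simp only: real_sqrt_mult real_sqrt_abs abs_numeral)
    define q where "q = sqrt (2 / L) * sqrt T"
    have q: "0 \<le> q" "q \<le> 2 * sqrt L" using st L T by (simp_all add: q_def)
    have "4 * sqrt (real n) * E * (sqrt (2 / L) * R * (sqrt T * G)) = 4 * sqrt (real n) * E * R * q * G"
      by (simp add: q_def mult_ac)
    also have "\<dots> \<le> 4 * real n * E * (2 * (real K)\<^sup>2 * 4 ^ n) * (2 * sqrt L) * G"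
      using sn R q nn R0 L T by (intro mult_mono) auto
    also have "\<dots> = 16 * Y * sqrt L * G" by (simp add: Y_def)
    finally show ?thesis .
  qed
  also have "16 * Y * sqrt L * G \<le> 16 * X * sqrt L * G" using YX nn L by (intro mult_right_mono mult_left_mono) auto
  finally have "U \<le> 16 * X * sqrt L * G + 2 * (1 * (sqrt L * G))" using U3 by linarith
  also have "\<dots> \<le> 16 * X * sqrt L * G + 2 * (X * (sqrt L * G))"
    using X1 nn L by (intro add_left_mono mult_left_mono mult_right_mono) auto
  finally have U4: "U \<le> 18 * (X * sqrt L * G)" by (simp add: mult_ac)
  have XG: "sqrt L * G \<le> X * sqrt L * G" using mult_right_mono[OF X1, of "sqrt L * G"] nn L by simp
  have "sqrt L * G + U \<le> 19 * (X * sqrt L * G)" using U4 XG by linarith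
  then have "D \<le> \<kappa> / L * (19 * (X * sqrt L * G))"
    using \<kappa> L by (intro order_trans[OF D2] mult_left_mono) auto
  moreover have "U \<le> 19 * (X * sqrt L * G)" using U4 XG mult_nonneg_nonneg[OF real_sqrt_ge_zero[of L] nn(3)] L by linarith
  moreover have "H1_norm L (u 0) \<le> U + D"
    unfolding H1_norm_def U_def D_def by (rule sqrt_sum_squares_le_sum) (auto simp: L2_norm_nonneg)
  ultimately have "H1_norm L (u 0) \<le> 19 * (X * sqrt L * G) + \<kappa> / L * (19 * (X * sqrt L * G))" by linarith
  then show ?thesis by (simp add: G_def algebra_simps)
qed

end

lemma fifth_power_le_exp:
  assumes "\<kappa> \<ge> (0 :: real)"
  shows "\<kappa> ^ 5 \<le> 50 ^ 5 * exp (\<kappa> / 10)"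
proof -
  have "(\<kappa> / 50) ^ 5 \<le> (1 + \<kappa> / 10 / real 5) ^ 5" using assms by (intro power_mono) auto
  also have "\<dots> \<le> exp (\<kappa> / 10)" using assms by (intro exp_ge_one_plus_x_over_n_power_n) auto
  finally show ?thesis by (simp add: power_divide)
qed

text \<open>The exponent \<open>11/3\<close> leaves room: a further \<open>1/10\<close> pays for the powers of \<open>L\<^sup>2 / T\<close>, and
  \<open>11/3 + 1/10 = 113/30 < 4 (36/37)\<^sup>2\<close>.  Large \<open>L\<close> is no obstacle, since \<open>T \<le> \<pi>\<^sup>2\<close> bounds \<open>L\<^sup>2\<close> by a
  multiple of \<open>L\<^sup>2 / T\<close>.\<close>

lemma observable_beyond_upper: "observable_beyond (4 * (36 / 37)\<^sup>2)"
  unfolding observable_beyond_def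
proof (intro allI impI)
  fix \<alpha> L0 :: real assume \<alpha>: "4 * (36 / 37)\<^sup>2 < \<alpha>" and L0: "0 < L0"
  \<comment> \<open>The powers of \<open>\<kappa>\<close> that occur below add up to \<open>\<kappa> ^ 5\<close>, which is at most \<open>50 ^ 5 exp (\<kappa> / 10)\<close>.\<close>
  define c where "c = (19 * 27648 * 4 * 50 ^ 5 :: real)"
  define C where "C = c * (1 + 1 / L0)"
  have c: "c > 0" by (simp add: c_def)
  have \<alpha>': "113 / 30 \<le> \<alpha>" using \<alpha> by (simp add: power2_eq_square)
  show "\<exists>C>0. \<forall>k\<in>{0, 1}. \<forall>L\<ge>L0. \<forall>T. 0 < T \<and> T \<le> (min pi L)\<^sup>2 \<longrightarrow> observability_estimate \<alpha> C k L T"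
  proof (intro exI[of _ C] conjI ballI allI impI)
    show "C > 0" using c L0 by (simp add: C_def add_pos_pos)
    fix k :: nat and L T :: real
    assume k: "k \<in> {0, 1}" and LL: "L0 \<le> L" and T: "0 < T \<and> T \<le> (min pi L)\<^sup>2"
    have L: "L > 0" using LL L0 by simp
    have m: "0 \<le> min pi L" using L by simp
    have TL: "T \<le> L\<^sup>2" and Tpi: "T \<le> pi\<^sup>2"
      using T power_mono[OF min.cobounded2 m, of 2] power_mono[OF min.cobounded1 m, of 2] by linarith+
    show "observability_estimate \<alpha> C k L T"
      unfolding observability_estimate_def
    proof (intro ballI allI impI)
      fix u0 u g assume u: "schrodinger_solution k L T u0 u" and g: "neumann_trace L T u g"
      interpret observed_solution k L T u0 u g using k L T u g by unfold_locales auto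
      define \<kappa> where "\<kappa> = L\<^sup>2 / T"
      define G where "G = L2_norm T g"
      have \<kappa>: "\<kappa> \<ge> 1" using TL T by (simp add: \<kappa>_def)
      have G: "G \<ge> 0" by (simp add: G_def L2_norm_nonneg)
      have "L\<^sup>2 = \<kappa> * T" using T by (simp add: \<kappa>_def)
      also have "\<dots> \<le> \<kappa> * 4\<^sup>2"
        using \<kappa> order_trans[OF Tpi power_mono[of pi 4 2]] pi_less_4 by (intro mult_left_mono) auto
      also have "\<dots> \<le> (4 * \<kappa>)\<^sup>2" using \<kappa> by (simp add: power2_eq_square)
      finally have "L \<le> 4 * \<kappa>" using \<kappa> by (intro power2_le_imp_le[of L]) auto
      also have "\<dots> \<le> (4 * \<kappa>)\<^sup>2" using \<kappa> by (simp add: power2_eq_square)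
      finally have sL: "sqrt L \<le> 4 * \<kappa>" using \<kappa> by (intro real_le_lsqrt) auto
      have "\<kappa> / L \<le> \<kappa> / L0" using LL L0 \<kappa> by (intro divide_left_mono) auto
      then have kL: "1 + \<kappa> / L \<le> \<kappa> * (1 + 1 / L0)" using \<kappa> by (simp add: algebra_simps)
      have "H1_norm L u0 = H1_norm L (u 0)"
        using u L by (intro H1_norm_cong) (auto simp: schrodinger_solution_def)
      also have "\<dots> \<le> 19 * (27648 * \<kappa> ^ 3 * exp (11 / 3 * \<kappa>)) * sqrt L * (1 + \<kappa> / L) * G"
        unfolding \<kappa>_def G_def by (rule observability_bound[OF TL])
      also have "\<dots> \<le> 19 * (27648 * \<kappa> ^ 3 * exp (11 / 3 * \<kappa>)) * (4 * \<kappa>) * (\<kappa> * (1 + 1 / L0)) * G"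
        using \<kappa> sL kL G L by (intro mult_right_mono mult_mono) auto
      also have "\<dots> = 19 * 27648 * 4 * (1 + 1 / L0) * G * (\<kappa> ^ 5 * exp (11 / 3 * \<kappa>))"
        by (simp add: eval_nat_numeral algebra_simps)
      also have "\<dots> \<le> 19 * 27648 * 4 * (1 + 1 / L0) * G * ((50 ^ 5 * exp (\<kappa> / 10)) * exp (11 / 3 * \<kappa>))"
        using \<kappa> G L0 by (intro mult_left_mono mult_right_mono fifth_power_le_exp) auto
      also have "\<dots> = C * G * exp (113 / 30 * \<kappa>)"
        by (simp add: C_def c_def flip: exp_add)
      also have "\<dots> \<le> C * G * exp (\<alpha> * \<kappa>)"
        using \<alpha>' \<kappa> G \<open>C > 0\<close> by (intro mult_left_mono) auto
      finally show "H1_norm L u0 \<le> C * exp (\<alpha> * L\<^sup>2 / T) * L2_norm T g"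
        by (simp add: G_def \<kappa>_def mult_ac)
    qed
  qed
qed

section \<open>Finite sums of modes\<close>

lemma LINT_eq_L2_inner: "(LINT x:{0..t}|lborel. f x) = L2_inner t f (\<lambda>_. 1)"
  by (simp add: L2_inner_def)

definition mode_sum :: "nat \<Rightarrow> real \<Rightarrow> nat \<Rightarrow> (nat \<Rightarrow> complex) \<Rightarrow> real \<Rightarrow> real \<Rightarrow> complex" where
  "mode_sum k L N b t s = (\<Sum>m<N. (b m * cis ((freq k L m)\<^sup>2 * t)) * smode k L m s)"

lemma smode_sum_deriv: 
  "has_weak_deriv L (\<lambda>s. \<Sum>m<N. \<beta> m * smode k L m s) (\<lambda>s. \<Sum>m<N. (- \<beta> m * freq k L m) * cmode k L m s)"
proof (rule has_weak_deriv_C1)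
  fix x
  have "((\<lambda>s. \<Sum>m<N. \<beta> m * smode k L m s) has_vector_derivative (\<Sum>m<N. \<beta> m * (- of_real (freq k L m) * cmode k L m x))) (at x)"
    by (intro has_vector_derivative_sum has_vector_derivative_mult_right smode_deriv)
  then show "((\<lambda>s. \<Sum>m<N. \<beta> m * smode k L m s) has_vector_derivative (\<Sum>m<N. (- \<beta> m * freq k L m) * cmode k L m x)) (at x)"
    by (simp add: mult_ac)
qed (intro continuous_intros mode_continuous)

lemma H1_norm_smode_sum:
  assumes "L > 0" "k \<in> {0, 1}"
  shows "H1_norm L (\<lambda>s. \<Sum>m<N. \<beta> m * smode k L m s) =
    sqrt (\<Sum>m<N. (norm (\<beta> m))\<^sup>2 * ((L2_norm L (smode k L m))\<^sup>2 + (freq k L m)\<^sup>2 * (L2_norm L (cmode k L m))\<^sup>2))"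
proof -
  note d = smode_sum_deriv[where L=L and N=N and k=k and \<beta>=\<beta>]
  have "L2_norm L (weak_deriv L (\<lambda>s. \<Sum>m<N. \<beta> m * smode k L m s)) = L2_norm L (\<lambda>s. \<Sum>m<N. (- \<beta> m * freq k L m) * cmode k L m s)"
    unfolding L2_norm_eq_inner
    by (subst L2_inner_cong_AE[OF _ _ weak_deriv_AE(1)[OF d] _ _ weak_deriv_AE(1)[OF d]])
       (use has_weak_deriv_L2[OF d] has_weak_deriv_L2[OF weak_deriv_AE(2)[OF d]] in auto)
  moreover have "(L2_norm L (\<lambda>s. \<Sum>m<N. (- \<beta> m * freq k L m) * cmode k L m s))\<^sup>2 =
      (\<Sum>m<N. (norm (- \<beta> m * freq k L m))\<^sup>2 * (L2_norm L (cmode k L m))\<^sup>2)"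
    by (rule L2_norm_orthogonal_sum) (simp_all add: L2_modes mode_inner[OF assms])
  ultimately have "(L2_norm L (weak_deriv L (\<lambda>s. \<Sum>m<N. \<beta> m * smode k L m s)))\<^sup>2 =
      (\<Sum>m<N. (norm (- \<beta> m * freq k L m))\<^sup>2 * (L2_norm L (cmode k L m))\<^sup>2)"
    by (simp only:)
  moreover have "(L2_norm L (\<lambda>s. \<Sum>m<N. \<beta> m * smode k L m s))\<^sup>2 = (\<Sum>m<N. (norm (\<beta> m))\<^sup>2 * (L2_norm L (smode k L m))\<^sup>2)"
    by (rule L2_norm_orthogonal_sum) (simp_all add: L2_modes mode_inner[OF assms])
  ultimately show ?thesis
    by (simp add: H1_norm_def norm_mult power_mult_distrib distrib_left sum.distrib mult_ac)
qed

lemma cmode_weak_by_parts: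
  assumes L: "L > 0" and k: "k \<in> {0, 1}" and v: "has_weak_deriv L v v'" and "v 0 = 0 \<or> k = 1"
  shows "L2_inner L (cmode k L m) v' = of_real (sqrt (2 / L)) * cnj (v L) - freq k L m * L2_inner L (smode k L m) v"
proof -
  have "L2_inner L (\<lambda>s. of_real (freq k L m) * smode k L m s) v = cmode k L m L * cnj (v L) - cmode k L m 0 * cnj (v 0) - L2_inner L (cmode k L m) v'"
    using L by (intro weak_by_parts[OF v _ cmode_deriv]) (auto intro!: continuous_intros mode_continuous)
  moreover have "cmode k L m 0 * cnj (v 0) = 0" using assms(4) mode_boundary(4)[OF L k] by auto
  ultimately have "of_real (freq k L m) * L2_inner L (smode k L m) v = of_real (sqrt (2 / L)) * cnj (v L) - 0 - L2_inner L (cmode k L m) v'"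
    by (simp only: L2_inner_smult mode_boundary(2)[OF L k])
  then show ?thesis by (simp add: algebra_simps)
qed

lemma mode_sum_inner_deriv:
  assumes L: "L > 0" and k: "k \<in> {0, 1}" and v: "v \<in> H1 L" and v0: "v 0 = 0 \<or> k = 1"
  shows "L2_inner L (weak_deriv L (mode_sum k L N b t)) (weak_deriv L v) =
    (\<Sum>m<N. (b m * cis ((freq k L m)\<^sup>2 * t)) * ((freq k L m)\<^sup>2 * L2_inner L (smode k L m) v - freq k L m * sqrt (2 / L) * cnj (v L)))"
proof -
  obtain v' where "has_weak_deriv L v v'" using v by (auto simp: H1_def)
  then have v': "has_weak_deriv L v (weak_deriv L v)" by (rule weak_deriv_AE(2))
  note d = smode_sum_deriv[where L=L and N=N and k=k and \<beta>="\<lambda>m. b m * cis ((freq k L m)\<^sup>2 * t)"]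
  have "L2_inner L (weak_deriv L (mode_sum k L N b t)) (weak_deriv L v) =
      L2_inner L (\<lambda>s. \<Sum>m<N. (- (b m * cis ((freq k L m)\<^sup>2 * t)) * freq k L m) * cmode k L m s) (weak_deriv L v)"
    unfolding mode_sum_def[abs_def]
    by (rule L2_inner_cong_AE[OF _ _ weak_deriv_AE(1)[OF d]])
       (use has_weak_deriv_L2[OF d] has_weak_deriv_L2[OF weak_deriv_AE(2)[OF d]] has_weak_deriv_L2[OF v'] in auto)
  also have "\<dots> = (\<Sum>m<N. (- (b m * cis ((freq k L m)\<^sup>2 * t)) * freq k L m) * L2_inner L (cmode k L m) (weak_deriv L v))"
    by (subst L2_inner_sum_left) (simp_all only: L2_smult L2_modes has_weak_deriv_L2[OF v'] L2_inner_smult)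
  also have "\<dots> = (\<Sum>m<N. (b m * cis ((freq k L m)\<^sup>2 * t)) * ((freq k L m)\<^sup>2 * L2_inner L (smode k L m) v - freq k L m * sqrt (2 / L) * cnj (v L)))"
    by (intro sum.cong refl) (simp add: cmode_weak_by_parts[OF L k v' v0] power2_eq_square algebra_simps)
  finally show ?thesis .
qed

lemma mode_sum_inner:
  assumes "L2 L v"
  shows "L2_inner L (mode_sum k L N b t) v = (\<Sum>m<N. (b m * cis ((freq k L m)\<^sup>2 * t)) * L2_inner L (smode k L m) v)"
  unfolding mode_sum_def[abs_def] using assms
  by (subst L2_inner_sum_left) (auto intro!: L2_smult L2_modes simp: L2_inner_smult)

lemma H1_L2: "v \<in> H1 L \<Longrightarrow> L2 L v"
  unfolding H1_def using H1_continuous L2_continuous by blast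

lemma mode_sum_solution:
  assumes L: "L > 0" and k: "k \<in> {0, 1}"
  shows "schrodinger_solution k L T (mode_sum k L N b 0) (mode_sum k L N b)"
  unfolding schrodinger_solution_def
proof (intro conjI allI ballI impI)
  fix t :: real assume "t \<ge> 0"
  show "mode_sum k L N b t \<in> H1k k L"
    using smode_sum_deriv[where L=L and N=N and k=k and \<beta>="\<lambda>m. b m * cis ((freq k L m)\<^sup>2 * t)"] mode_boundary(1,3)[OF L k]
    unfolding mode_sum_def[abs_def] by (auto simp: H1k_def H1_def)
  define W where "W m = (L2_norm L (smode k L m))\<^sup>2 + (freq k L m)\<^sup>2 * (L2_norm L (cmode k L m))\<^sup>2" for m
  have "(\<lambda>s. mode_sum k L N b \<tau> s - mode_sum k L N b t s) =
      (\<lambda>s. \<Sum>m<N. (b m * (cis ((freq k L m)\<^sup>2 * \<tau>) - cis ((freq k L m)\<^sup>2 * t))) * smode k L m s)" for \<tau>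
    by (simp add: mode_sum_def sum_subtractf algebra_simps)
  then have "H1_norm L (\<lambda>s. mode_sum k L N b \<tau> s - mode_sum k L N b t s) =
      sqrt (\<Sum>m<N. (norm (b m * (cis ((freq k L m)\<^sup>2 * \<tau>) - cis ((freq k L m)\<^sup>2 * t))))\<^sup>2 * W m)" for \<tau>
    unfolding W_def by (simp only: H1_norm_smode_sum[OF L k])
  moreover have "((\<lambda>\<tau>. sqrt (\<Sum>m<N. (norm (b m * (cis ((freq k L m)\<^sup>2 * \<tau>) - cis ((freq k L m)\<^sup>2 * t))))\<^sup>2 * W m))
      \<longlongrightarrow> sqrt (\<Sum>m<N. (norm (b m * (cis ((freq k L m)\<^sup>2 * t) - cis ((freq k L m)\<^sup>2 * t))))\<^sup>2 * W m)) (at t within {0..})"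
    by (intro tendsto_intros)
  ultimately show "((\<lambda>\<tau>. H1_norm L (\<lambda>s. mode_sum k L N b \<tau> s - mode_sum k L N b t s)) \<longlongrightarrow> 0) (at t within {0..})"
    by simp
next
  fix v t assume v: "v \<in> H1k k L" and "t \<in> {0<..<T}"
  have vH: "v \<in> H1 L" and vb: "v 0 = 0 \<or> k = 1" "v L = 0" using v k by (auto simp: H1k_def)
  have "((\<lambda>\<tau>. \<Sum>m<N. (b m * cis ((freq k L m)\<^sup>2 * \<tau>)) * L2_inner L (smode k L m) v) has_vector_derivative
     (\<Sum>m<N. (b m * (\<i> * of_real ((freq k L m)\<^sup>2) * cis ((freq k L m)\<^sup>2 * t))) * L2_inner L (smode k L m) v)) (at t)"
    by (intro has_vector_derivative_sum has_vector_derivative_mult_left has_vector_derivative_mult_right cis_linear_deriv)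
  then have "((\<lambda>\<tau>. L2_inner L (mode_sum k L N b \<tau>) v) has_vector_derivative
     (\<Sum>m<N. (b m * (\<i> * of_real ((freq k L m)\<^sup>2) * cis ((freq k L m)\<^sup>2 * t))) * L2_inner L (smode k L m) v)) (at t)"
    by (simp only: mode_sum_inner[OF H1_L2[OF vH]])
  moreover have "\<i> * (\<Sum>m<N. (b m * (\<i> * of_real ((freq k L m)\<^sup>2) * cis ((freq k L m)\<^sup>2 * t))) * L2_inner L (smode k L m) v) +
      L2_inner L (weak_deriv L (mode_sum k L N b t)) (weak_deriv L v) = 0"
    unfolding mode_sum_inner_deriv[OF L k vH vb(1)] sum_distrib_left sum.distrib[symmetric]
    by (intro sum.neutral) (simp add: vb(2) algebra_simps)
  ultimately show "\<exists>D. ((\<lambda>\<tau>. L2_inner L (mode_sum k L N b \<tau>) v) has_vector_derivative D) (at t) \<and>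
      \<i> * D + L2_inner L (weak_deriv L (mode_sum k L N b t)) (weak_deriv L v) = 0" by blast
qed simp

text \<open>The classical derivative of the mode sum at the endpoint \<open>L\<close>.\<close>

definition mode_trace_sum :: "nat \<Rightarrow> real \<Rightarrow> nat \<Rightarrow> (nat \<Rightarrow> complex) \<Rightarrow> real \<Rightarrow> complex" where
  "mode_trace_sum k L N b t = - of_real (sqrt (2 / L)) * (\<Sum>m<N. (b m * freq k L m) * cis ((freq k L m)\<^sup>2 * t))"

lemma mode_sum_trace:
  assumes L: "L > 0" and k: "k \<in> {0, 1}"
  shows "neumann_trace L T (mode_sum k L N b) (mode_trace_sum k L N b)"
  unfolding neumann_trace_def
proof (intro conjI ballI impI)
  show "L2 T (mode_trace_sum k L N b)"
    unfolding mode_trace_sum_def by (intro L2_continuous continuous_intros)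
  fix v t assume v: "v \<in> H1 L" "v 0 = 0" and t: "t \<in> {0..T}"
  define c where "c m \<tau> = cis ((freq k L m)\<^sup>2 * \<tau>)" for m \<tau>
  define I where "I m = L2_inner t (c m) (\<lambda>_. 1)" for m
  define e where "e m = L2_inner L (smode k L m) v" for m
  define A where "A m = (freq k L m)\<^sup>2 * e m - freq k L m * sqrt (2 / L) * cnj (v L)" for m
  have c2: "L2 t (c m)" "L2 t (\<lambda>_. 1)" for m unfolding c_def by (intro L2_continuous continuous_intros)+
  have I: "c m t - 1 = \<i> * (freq k L m)\<^sup>2 * I m" for m
  proof -
    have "(LINT \<tau>:{0..t}|lborel. \<i> * of_real ((freq k L m)\<^sup>2) * c m \<tau>) = c m t - c m 0"
      unfolding c_def using t by (intro LINT_FTC cis_linear_deriv continuous_intros) auto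
    then show ?thesis by (simp add: I_def LINT_eq_L2_inner L2_inner_smult c_def[abs_def])
  qed
  have "(LINT \<tau>:{0..t}|lborel. L2_inner L (weak_deriv L (mode_sum k L N b \<tau>)) (weak_deriv L v)) =
      L2_inner t (\<lambda>\<tau>. \<Sum>m<N. (b m * A m) * c m \<tau>) (\<lambda>_. 1)"
    unfolding LINT_eq_L2_inner using v by (simp add: mode_sum_inner_deriv[OF L k] A_def c_def e_def mult_ac)
  also have "\<dots> = (\<Sum>m<N. (b m * A m) * I m)"
    using c2 by (simp add: L2_inner_sum_left L2_smult L2_inner_smult I_def)
  finally have 1: "(LINT \<tau>:{0..t}|lborel. L2_inner L (weak_deriv L (mode_sum k L N b \<tau>)) (weak_deriv L v)) = (\<Sum>m<N. (b m * A m) * I m)" .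
  have 2: "(LINT \<tau>:{0..t}|lborel. mode_trace_sum k L N b \<tau>) = - of_real (sqrt (2 / L)) * (\<Sum>m<N. (b m * freq k L m) * I m)"
    unfolding LINT_eq_L2_inner mode_trace_sum_def c_def[symmetric] L2_inner_smult using c2
    by (simp add: L2_inner_sum_left L2_smult L2_inner_smult I_def)
  have "\<i> * (L2_inner L (mode_sum k L N b t) v - L2_inner L (mode_sum k L N b 0) v) = (\<Sum>m<N. \<i> * (b m * (c m t - 1) * e m))"
    by (simp add: mode_sum_inner[OF H1_L2[OF v(1)]] c_def e_def sum_subtractf sum_distrib_left algebra_simps)
  also have "\<dots> = (\<Sum>m<N. - (b m * ((freq k L m)\<^sup>2 * e m) * I m))"
    unfolding I by (intro sum.cong refl) (simp add: algebra_simps)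
  finally show "\<i> * (L2_inner L (mode_sum k L N b t) v - L2_inner L (mode_sum k L N b 0) v)
          + (LINT \<tau>:{0..t}|lborel. L2_inner L (weak_deriv L (mode_sum k L N b \<tau>)) (weak_deriv L v))
        = (LINT \<tau>:{0..t}|lborel. mode_trace_sum k L N b \<tau>) * cnj (v L)"
    unfolding 1 2 sum.distrib[symmetric] by (simp add: A_def sum_distrib_left sum_distrib_right algebra_simps sum_negf sum_subtractf)
qed

section \<open>The lower bound\<close>

lemma cos_zero_iff_odd_pi:
  "cos w = 0 \<longleftrightarrow> (\<exists>j::int. w = of_real ((of_int j + 1 / 2) * pi))" for w :: complex
  unfolding cos_eq_0 by (auto simp: algebra_simps)

lemma cos_half_int_pi: "cos ((of_int j + 1 / 2) * pi) = (0::real)"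
  by (simp add: distrib_right cos_add sin_times_pi_eq_0)

lemma sin_half_int_pi: "sin ((of_int j + 1 / 2) * pi) = cos (of_int j * pi)" for j :: int
  by (simp add: distrib_right sin_add sin_times_pi_eq_0)

lemma residue_gauss_sec:
  fixes z :: complex and j :: int
  defines "p \<equiv> (of_int j + 1 / 2) * pi"
  shows "residue (\<lambda>w. w * exp (- (w\<^sup>2 * z)) / cos w) (of_real p) = - (of_real (p * cos (of_int j * pi)) * exp (- ((of_real p)\<^sup>2 * z)))"
proof (rule residue_simple')
  show "open (ball (complex_of_real p) 1)" "complex_of_real p \<in> ball (complex_of_real p) 1" by auto
  have nz: "cos w \<noteq> 0" if "w \<in> ball (of_real p) 1 - {of_real p}" for w :: complex
  proof
    assume "cos w = 0"
    then obtain i :: int where i: "w = of_real ((of_int i + 1 / 2) * pi)" by (auto simp: cos_zero_iff_odd_pi)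
    have "norm (of_real p - w) = \<bar>of_int (j - i) * pi\<bar>"
      unfolding i p_def of_real_diff[symmetric] norm_of_real by (simp add: algebra_simps)
    moreover have "i \<noteq> j" using that i by (auto simp: p_def)
    then have "1 \<le> \<bar>of_int (j - i) :: real\<bar>" by linarith
    then have "1 * 1 \<le> \<bar>of_int (j - i) :: real\<bar> * pi" using pi_gt3 by (intro mult_mono) auto
    ultimately show False using that by (simp add: dist_norm abs_mult)
  qed
  show "(\<lambda>w. w * exp (- (w\<^sup>2 * z)) / cos w) holomorphic_on ball (of_real p) 1 - {of_real p}"
    by (intro holomorphic_intros) (use nz in auto)
  have cp: "cos (complex_of_real p) = 0"
    using cos_half_int_pi[of j] unfolding p_def by (simp only: cos_of_real of_real_0)
  have sp: "sin (complex_of_real p) = of_real (cos (of_int j * pi))"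
    using sin_half_int_pi[of j] unfolding p_def by (simp only: sin_of_real)
  have c1: "cos (of_int j * pi) * cos (of_int j * pi) = (1 :: real)"
  proof -
    have "sin (of_int j * pi) = (0 :: real)" by (simp add: sin_times_pi_eq_0)
    then show ?thesis using sin_cos_squared_add[of "of_int j * pi"] by (simp only: power2_eq_square mult_zero_left add_0_left)
  qed
  have inv: "inverse (- complex_of_real (cos (of_int j * pi))) = - of_real (cos (of_int j * pi))"
    by (rule inverse_unique) (simp add: c1 del: of_real_mult flip: of_real_mult)
  have "(cos has_field_derivative - sin (complex_of_real p)) (at (of_real p))"
    by (rule DERIV_cos)
  then have "((\<lambda>w. (cos w - cos (of_real p)) / (w - of_real p)) \<longlongrightarrow> - sin (complex_of_real p)) (at (of_real p))"
    by (simp add: has_field_derivative_iff)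
  then have "((\<lambda>w. inverse ((cos w - cos (of_real p)) / (w - of_real p))) \<longlongrightarrow> inverse (- sin (complex_of_real p))) (at (of_real p))"
    using c1 by (intro tendsto_inverse) (auto simp: sp)
  then have "((\<lambda>w. (w - complex_of_real p) / cos w) \<longlongrightarrow> - complex_of_real (cos (of_int j * pi))) (at (of_real p))"
    unfolding sp inv cp by simp
  then have "((\<lambda>w. (w * exp (- (w\<^sup>2 * z))) * ((w - of_real p) / cos w)) \<longlongrightarrow>
      (of_real p * exp (- ((of_real p)\<^sup>2 * z))) * (- of_real (cos (of_int j * pi)))) (at (of_real p))"
    by (intro tendsto_mult) (auto intro!: tendsto_intros)
  then show "((\<lambda>w. w * exp (- (w\<^sup>2 * z)) / cos w * (w - of_real p)) \<longlongrightarrow>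
      - (of_real (p * cos (of_int j * pi)) * exp (- ((of_real p)\<^sup>2 * z)))) (at (of_real p))"
    by (simp add: mult_ac)
qed

lemma norm_exp_square:
  "norm (exp (- (w\<^sup>2 * z))) = exp (- (Re z * ((Re w)\<^sup>2 - (Im w)\<^sup>2)) + 2 * Re w * Im w * Im z)" for w z :: complex
  by (simp add: norm_exp_eq_Re power2_eq_square algebra_simps)

lemma norm_cos_square: "(norm (cos w))\<^sup>2 = (cos (Re w))\<^sup>2 + (sinh (Im w))\<^sup>2" for w :: complex
proof -
  have "(norm (cos w))\<^sup>2 = (cos (Re w) * cosh (Im w))\<^sup>2 + (sin (Re w) * sinh (Im w))\<^sup>2"
    unfolding cmod_power2 Re_cos Im_cos by (simp add: cosh_field_def sinh_field_def power2_eq_square field_simps exp_minus)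
  also have "\<dots> = (cos (Re w))\<^sup>2 * (1 + (sinh (Im w))\<^sup>2) + (1 - (cos (Re w))\<^sup>2) * (sinh (Im w))\<^sup>2"
    unfolding power_mult_distrib cosh_square_eq sin_squared_eq by simp
  finally show ?thesis by (simp add: algebra_simps)
qed

lemma norm_cos_ge: "\<bar>sinh (Im w)\<bar> \<le> norm (cos w)" "\<bar>cos (Re w)\<bar> \<le> norm (cos w)" for w :: complex
proof -
  have "\<bar>sinh (Im w)\<bar>\<^sup>2 \<le> (norm (cos w))\<^sup>2" "\<bar>cos (Re w)\<bar>\<^sup>2 \<le> (norm (cos w))\<^sup>2"
    by (simp_all add: norm_cos_square)
  then show "\<bar>sinh (Im w)\<bar> \<le> norm (cos w)" "\<bar>cos (Re w)\<bar> \<le> norm (cos w)"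
    by (auto intro: power2_le_imp_le)
qed

text \<open>For \<open>N\<close> to infinity, up to constants, the derivative of the Jacobi theta function of odd characteristic
  at \<open>0\<close>.\<close>

definition theta_sum :: "nat \<Rightarrow> complex \<Rightarrow> complex" where
  "theta_sum N z = (\<Sum>m<N. of_real ((- 1) ^ m * freq 1 1 m) * exp (- ((of_real (freq 1 1 m))\<^sup>2 * z)))"

text \<open>The residue is an even function of the pole, so each value occurs twice.\<close>

lemma sum_residues:
  fixes z :: complex
  defines "p \<equiv> \<lambda>j::int. (of_int j + 1 / 2) * pi"
  shows "(\<Sum>j\<in>{- int N..<int N}. of_real (p j * cos (of_int j * pi)) * exp (- ((of_real (p j))\<^sup>2 * z))) = 2 * theta_sum N z"
proof (induction N)
  case (Suc N)
  define r where "r j = of_real (p j * cos (of_int j * pi)) * exp (- ((of_real (p j))\<^sup>2 * z))" for j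
  have s: "{- int (Suc N)..<int (Suc N)} = insert (- int (Suc N)) (insert (int N) {- int N..<int N})" by auto
  have f: "freq 1 1 N = p (int N)" by (simp add: freq_def p_def)
  have pm: "p (- int (Suc N)) = - p (int N)" by (simp add: p_def algebra_simps)
  have "cos (of_int (- int (Suc N)) * pi) = cos (real (Suc N) * pi)" by (simp only: of_int_minus of_int_of_nat_eq mult_minus_left cos_minus)
  then have cm: "cos (of_int (- int (Suc N)) * pi) = - ((- 1) ^ N)" by (simp only: cos_npi power_Suc mult_minus_left mult_1_left)
  have c: "cos (of_int (int N) * pi) = (- 1) ^ N" by (simp only: of_int_of_nat_eq cos_npi)
  have "r (int N) = of_real ((- 1) ^ N * freq 1 1 N) * exp (- ((of_real (freq 1 1 N))\<^sup>2 * z))"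
    unfolding r_def c f by (simp add: mult_ac)
  moreover have "r (- int (Suc N)) = r (int N)"
    unfolding r_def c cm pm by simp
  ultimately have "(\<Sum>j\<in>{- int (Suc N)..<int (Suc N)}. r j) = 2 * (of_real ((- 1) ^ N * freq 1 1 N) * exp (- ((of_real (freq 1 1 N))\<^sup>2 * z))) + (\<Sum>j\<in>{- int N..<int N}. r j)"
    unfolding s by simp
  then show ?case using Suc by (simp add: r_def theta_sum_def algebra_simps)
qed (simp add: theta_sum_def)

text \<open>The poles inside the rectangle are the first \<open>2 N\<close> zeros of the cosine.\<close>

lemma theta_sum_contour:
  fixes z :: complex and N :: nat and h :: real
  assumes N: "N \<ge> 1" and h: "h > 0"
  defines "X \<equiv> real N * pi"
  shows "contour_integral (rectpath (Complex (- X) (- h)) (Complex X h)) (\<lambda>w. w * exp (- (w\<^sup>2 * z)) / cos w) = - 4 * pi * \<i> * theta_sum N z"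
    (is "contour_integral ?\<gamma> ?f = _")
proof -
  define p where "p j = (of_int j + 1 / 2) * pi" for j :: int
  define J where "J = {- int N..<int N}"
  define S where "S = {w :: complex. Re w \<in> {- X - 1<..<X + 1}}"
  have S1: "S = {w. - X - 1 < Re w} \<inter> {w. Re w < X + 1}" by (auto simp: S_def)
  have open_S: "open S" unfolding S1 by (intro open_Int open_halfspace_Re_gt open_halfspace_Re_lt)
  have "convex S" unfolding S1 by (intro convex_Int convex_halfspace_Re_gt convex_halfspace_Re_lt)
  then have conn_S: "connected S" by (rule convex_connected)
  have X: "X > 0" using N by (simp add: X_def)
  have pJ: "p j \<in> {- X<..<X}" if "j \<in> J" for j
  proof -
    have "- real N \<le> of_int j" "of_int j \<le> real N - 1" using that by (auto simp: J_def)
    then have "- real N < of_int j + 1 / 2" "of_int j + 1 / 2 < real N" by linarith+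
    then have "- real N * pi < (of_int j + 1 / 2) * pi" "(of_int j + 1 / 2) * pi < real N * pi"
      by (intro mult_strict_right_mono; simp)+
    then show ?thesis by (simp add: p_def X_def)
  qed
  \<comment> \<open>The strip extends by \<open>1\<close> beyond the rectangle; the next zeros are at distance \<open>\<pi>/2\<close>.\<close>
  have zeros: "w \<in> (\<lambda>j. of_real (p j)) ` J" if w: "w \<in> S" "cos w = 0" for w
  proof -
    obtain j where j: "w = of_real (p j)" using w(2) by (auto simp: cos_zero_iff_odd_pi p_def)
    have "- X - 1 < p j" "p j < X + 1" using w(1) by (auto simp: j S_def)
    moreover have "(real N + 1 / 2) * pi = X + pi / 2" by (simp add: X_def distrib_right)
    ultimately have "- ((real N + 1 / 2) * pi) < p j" "p j < (real N + 1 / 2) * pi"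
      using pi_gt3 by linarith+
    then have "- ((real N + 1 / 2) * pi) < (of_int j + 1 / 2) * pi" "(of_int j + 1 / 2) * pi < (real N + 1 / 2) * pi"
      unfolding p_def .
    then have "- (real N + 1 / 2) < of_int j + 1 / 2" "of_int j + 1 / 2 < real N + 1 / 2"
      by (simp_all only: mult_minus_left[symmetric] mult_less_cancel_right_pos[OF pi_gt_zero])
    then have "j \<in> J" by (auto simp: J_def)
    then show ?thesis using j by blast
  qed
  have ends: "Re (Complex (- X) (- h)) \<le> Re (Complex X h)" "Im (Complex (- X) (- h)) \<le> Im (Complex X h)" using X h by auto
  have pim: "path_image ?\<gamma> \<subseteq> cbox (Complex (- X) (- h)) (Complex X h)"
    by (rule path_image_rectpath_subset_cbox[OF ends])
  have cb: "cbox (Complex (- X) (- h)) (Complex X h) \<subseteq> S" by (auto simp: S_def in_cbox_complex_iff)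
  have box: "complex_of_real (p j) \<in> box (Complex (- X) (- h)) (Complex X h)" if "j \<in> J" for j
    using pJ[OF that] h by (auto simp: in_box_complex_iff)
  have "contour_integral ?\<gamma> ?f = 2 * pi * \<i> * (\<Sum>q\<in>(\<lambda>j. of_real (p j)) ` J. winding_number ?\<gamma> q * residue ?f q)"
  proof (rule Residue_theorem[OF open_S conn_S])
    show "finite ((\<lambda>j. complex_of_real (p j)) ` J)" by (simp add: J_def)
    show "?f holomorphic_on S - (\<lambda>j. of_real (p j)) ` J"
      using zeros by (intro holomorphic_intros) auto
    show "path_image ?\<gamma> \<subseteq> S - (\<lambda>j. of_real (p j)) ` J"
      using pim cb box path_image_rectpath_inter_box[OF ends] by blast
    show "\<forall>q. q \<notin> S \<longrightarrow> winding_number ?\<gamma> q = 0"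
      using cb winding_number_rectpath_outside[OF ends] by blast
  qed auto
  also have "\<dots> = 2 * pi * \<i> * (\<Sum>j\<in>J. winding_number ?\<gamma> (of_real (p j)) * residue ?f (of_real (p j)))"
    by (subst sum.reindex) (auto simp: inj_on_def p_def)
  also have "(\<Sum>j\<in>J. winding_number ?\<gamma> (of_real (p j)) * residue ?f (of_real (p j))) =
      (\<Sum>j\<in>J. - (of_real (p j * cos (of_int j * pi)) * exp (- ((of_real (p j))\<^sup>2 * z))))"
    using winding_number_rectpath[OF box] residue_gauss_sec[where z=z] by (intro sum.cong refl) (simp add: p_def)
  also have "\<dots> = - (2 * theta_sum N z)"
    unfolding sum_negf J_def p_def sum_residues ..
  finally show ?thesis by simp
qed

text \<open>The rectangle has height \<open>2 h\<close> and vertical sides at \<open>\<plusminus>4 h = \<plusminus>N \<pi>\<close>, where the cosine has modulus at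
  least \<open>1\<close>.  On the horizontal sides the Gaussian is at most \<open>exp (h/2)\<close>, because
  \<open>Re (- w\<^sup>2 z) = h/2\<close> at worst, while \<open>1 / cos w\<close> is of order \<open>exp (- h)\<close>.  On the vertical sides the
  Gaussian alone is smaller than \<open>exp (- h/2)\<close>.\<close>

lemma norm_theta_sum_le:
  fixes z :: complex and N :: nat
  assumes N: "N \<ge> 1"
  defines "h \<equiv> real N * pi / 4"
  assumes z: "Re z = 1 / (4 * h)" "\<bar>Im z\<bar> \<le> 1 / (4 * h)"
  shows "norm (theta_sum N z) \<le> 30 * h\<^sup>2 * exp (- h / 2)"
proof -
  define X where "X = real N * pi"
  define f where "f w = w * exp (- (w\<^sup>2 * z)) / cos w" for w
  have Xh: "X = 4 * h" by (simp add: X_def h_def)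
  have "1 * 3 \<le> real N * pi" using N pi_gt3 by (intro mult_mono) auto
  then have h: "h \<ge> 3 / 4" by (simp add: h_def)
  have sinh_h: "exp h / 4 \<le> sinh h"
  proof -
    have "1 + h \<le> exp h" by (rule exp_ge_add_one_self)
    then have e: "7 / 4 \<le> exp h" using h by linarith
    then have "(7 / 4) * (7 / 4) \<le> exp h * exp h" by (intro mult_mono) auto
    then have "2 \<le> exp h * exp h" by simp
    then have "exp (- h) \<le> exp h / 2" by (simp add: exp_minus field_simps)
    then show ?thesis by (simp add: sinh_field_def)
  qed
  have nw: "norm w \<le> 5 * h" if "\<bar>Re w\<bar> \<le> X" "\<bar>Im w\<bar> \<le> h" for w
    using cmod_le[of w] that by (simp add: Xh)
  have hor: "norm (f w) \<le> 20 * h * exp (- h / 2)" if w: "\<bar>Re w\<bar> \<le> X" "\<bar>Im w\<bar> = h" for w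
  proof -
    have i2: "(Im w)\<^sup>2 = h\<^sup>2" using w(2) by (metis power2_abs)
    have "2 * Re w * Im w * Im z \<le> \<bar>2 * Re w * Im w * Im z\<bar>" by simp
    also have "\<dots> = 2 * \<bar>Re w\<bar> * h * \<bar>Im z\<bar>" using w(2) by (simp add: abs_mult)
    also have "\<dots> \<le> 2 * \<bar>Re w\<bar> * h * (1 / (4 * h))" using z(2) h by (intro mult_left_mono) auto
    also have "\<dots> = \<bar>Re w\<bar> / 2" using h by simp
    finally have a: "2 * Re w * Im w * Im z \<le> \<bar>Re w\<bar> / 2" .
    have "0 \<le> (\<bar>Re w\<bar> - h)\<^sup>2" by simp
    then have "\<bar>Re w\<bar> * (2 * h) \<le> (Re w)\<^sup>2 + h\<^sup>2" by (simp add: power2_diff mult_ac)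
    then have "\<bar>Re w\<bar> / 2 \<le> 1 / (4 * h) * ((Re w)\<^sup>2 + h\<^sup>2)" using h by (simp add: field_simps)
    then have "- (Re z * ((Re w)\<^sup>2 - (Im w)\<^sup>2)) + 2 * Re w * Im w * Im z \<le> 1 / (4 * h) * (2 * h\<^sup>2)"
      using a unfolding z(1) i2 by (simp add: algebra_simps)
    also have "\<dots> = h / 2" using h by (simp add: power2_eq_square)
    finally have e: "norm (exp (- (w\<^sup>2 * z))) \<le> exp (h / 2)" unfolding norm_exp_square by simp
    have "\<bar>sinh (Im w)\<bar> = sinh h" using w(2) h by (auto simp: abs_if split: if_splits)
    then have c: "exp h / 4 \<le> norm (cos w)" using norm_cos_ge(1)[of w] sinh_h by linarith
    have "norm (f w) = norm w * norm (exp (- (w\<^sup>2 * z))) / norm (cos w)" by (simp add: f_def norm_mult norm_divide)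
    also have "\<dots> \<le> (5 * h) * exp (h / 2) / (exp h / 4)"
      using nw[of w] w c e h by (intro frac_le mult_mono) auto
    also have "\<dots> = 20 * h * (exp (h / 2) / exp h)" by simp
    also have "exp (h / 2) / exp h = exp (- h / 2)" by (simp flip: exp_diff)
    finally show ?thesis .
  qed
  \<comment> \<open>Here \<open>(Re w)\<^sup>2 - (Im w)\<^sup>2\<close> is at least \<open>15 h\<^sup>2\<close>, which outweighs the mixed term.\<close>
  have ver: "norm (f w) \<le> 5 * h * exp (- h / 2)" if w: "\<bar>Re w\<bar> = X" "\<bar>Im w\<bar> \<le> h" for w
  proof -
    have r2: "(Re w)\<^sup>2 = (4 * h)\<^sup>2" using w(1) Xh by (metis power2_abs)
    have i2: "(Im w)\<^sup>2 \<le> h\<^sup>2" using w(2) by (metis abs_le_square_iff abs_ge_zero abs_of_nonneg order_trans abs_abs)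
    have "2 * Re w * Im w * Im z \<le> \<bar>2 * Re w * Im w * Im z\<bar>" by simp
    also have "\<dots> = 2 * (4 * h) * (\<bar>Im w\<bar> * \<bar>Im z\<bar>)" using w(1) Xh by (simp add: abs_mult)
    also have "\<dots> \<le> 2 * (4 * h) * (h * (1 / (4 * h)))" using z(2) h w(2) by (intro mult_left_mono mult_mono) auto
    also have "\<dots> = 2 * h" using h by simp
    finally have a: "2 * Re w * Im w * Im z \<le> 2 * h" .
    have "1 / (4 * h) * (15 * h\<^sup>2) \<le> Re z * ((Re w)\<^sup>2 - (Im w)\<^sup>2)"
      unfolding z(1) r2 using i2 h by (intro mult_left_mono) (auto simp: power2_eq_square)
    moreover have "1 / (4 * h) * (15 * h\<^sup>2) = 15 / 4 * h" using h by (simp add: power2_eq_square)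
    ultimately have "- (Re z * ((Re w)\<^sup>2 - (Im w)\<^sup>2)) + 2 * Re w * Im w * Im z \<le> - h / 2" using a h by linarith
    then have e: "norm (exp (- (w\<^sup>2 * z))) \<le> exp (- h / 2)" unfolding norm_exp_square by simp
    have "Re w = X \<or> Re w = - X" using w(1) by linarith
    then have "cos (Re w) = cos (real N * pi)" by (auto simp: X_def)
    then have c: "1 \<le> norm (cos w)" using norm_cos_ge(2)[of w] by (simp add: cos_npi power_abs)
    have "norm (f w) = norm w * norm (exp (- (w\<^sup>2 * z))) / norm (cos w)" by (simp add: f_def norm_mult norm_divide)
    also have "\<dots> \<le> (5 * h) * exp (- h / 2) / 1"
      using nw[of w] w c e h by (intro frac_le mult_mono) auto
    finally show ?thesis by simp
  qed
  let ?a = "Complex (- X) (- h)" and ?b = "Complex X (- h)" and ?c = "Complex X h" and ?d = "Complex (- X) h"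
  have X0: "X > 0" using h Xh by simp
  have cosnz: "cos w \<noteq> 0" if "(\<bar>Re w\<bar> \<le> X \<and> \<bar>Im w\<bar> = h) \<or> (\<bar>Re w\<bar> = X \<and> \<bar>Im w\<bar> \<le> h)" for w :: complex
    using that
  proof
    assume "\<bar>Re w\<bar> \<le> X \<and> \<bar>Im w\<bar> = h"
    then have "\<bar>sinh (Im w)\<bar> > 0" using h by auto
    then show ?thesis using norm_cos_ge(1)[of w] by auto
  next
    assume "\<bar>Re w\<bar> = X \<and> \<bar>Im w\<bar> \<le> h"
    then have "Re w = X \<or> Re w = - X" by linarith
    then have "cos (Re w) = cos (real N * pi)" by (auto simp: X_def)
    then show ?thesis using norm_cos_ge(2)[of w] by (auto simp: cos_npi power_abs)
  qed
  have seg: "\<bar>Re w\<bar> \<le> X \<and> \<bar>Im w\<bar> = h" if "w \<in> closed_segment ?a ?b \<union> closed_segment ?c ?d" for w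
    using that X0 h by (auto simp: closed_segment_same_Im closed_segment_eq_real_ivl split: if_splits)
  have seg': "\<bar>Re w\<bar> = X \<and> \<bar>Im w\<bar> \<le> h" if "w \<in> closed_segment ?b ?c \<union> closed_segment ?d ?a" for w
    using that X0 h by (auto simp: closed_segment_same_Re closed_segment_eq_real_ivl split: if_splits)
  have cont: "continuous_on (closed_segment p q) f"
    if "closed_segment p q \<in> {closed_segment ?a ?b, closed_segment ?b ?c, closed_segment ?c ?d, closed_segment ?d ?a}" for p q
    unfolding f_def using that seg seg' cosnz by (intro continuous_intros) blast
  have int: "f contour_integrable_on linepath p q"
    if "closed_segment p q \<in> {closed_segment ?a ?b, closed_segment ?b ?c, closed_segment ?c ?d, closed_segment ?d ?a}" for p q
    by (rule contour_integrable_continuous_linepath[OF cont[OF that]])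
  have rect: "rectpath ?a ?c = linepath ?a ?b +++ linepath ?b ?c +++ linepath ?c ?d +++ linepath ?d ?a"
    by (simp add: rectpath_def Let_def)
  have eq: "contour_integral (rectpath ?a ?c) f = contour_integral (linepath ?a ?b) f + (contour_integral (linepath ?b ?c) f
      + (contour_integral (linepath ?c ?d) f + contour_integral (linepath ?d ?a) f))"
    unfolding rect by (simp add: int contour_integrable_joinI valid_path_join)
  have n1: "norm (contour_integral (linepath p q) f) \<le> 20 * h * exp (- h / 2) * (8 * h)"
    if "closed_segment p q \<in> {closed_segment ?a ?b, closed_segment ?c ?d}" "norm (q - p) = 8 * h" for p q
    unfolding that(2)[symmetric]
  proof (rule contour_integral_bound_linepath)
    show "f contour_integrable_on linepath p q" using that(1) by (intro int) blast
    show "0 \<le> 20 * h * exp (- h / 2)" using h by simp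
    fix w assume "w \<in> closed_segment p q"
    then have "w \<in> closed_segment ?a ?b \<union> closed_segment ?c ?d" using that(1) by blast
    then show "norm (f w) \<le> 20 * h * exp (- h / 2)" using seg hor by blast
  qed
  have n2: "norm (contour_integral (linepath p q) f) \<le> 5 * h * exp (- h / 2) * (2 * h)"
    if "closed_segment p q \<in> {closed_segment ?b ?c, closed_segment ?d ?a}" "norm (q - p) = 2 * h" for p q
    unfolding that(2)[symmetric]
  proof (rule contour_integral_bound_linepath)
    show "f contour_integrable_on linepath p q" using that(1) by (intro int) blast
    show "0 \<le> 5 * h * exp (- h / 2)" using h by simp
    fix w assume "w \<in> closed_segment p q"
    then have "w \<in> closed_segment ?b ?c \<union> closed_segment ?d ?a" using that(1) by blast
    then show "norm (f w) \<le> 5 * h * exp (- h / 2)" using seg' ver by blast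
  qed
  have l: "norm (?b - ?a) = 8 * h" "norm (?d - ?c) = 8 * h" "norm (?c - ?b) = 2 * h" "norm (?a - ?d) = 2 * h"
    using h by (simp_all add: Xh cmod_eq_Re cmod_eq_Im)
  have "- 4 * pi * \<i> * theta_sum N z = contour_integral (rectpath ?a ?c) f"
    using theta_sum_contour[OF N, of h z] h by (simp add: f_def[abs_def] X_def)
  also have "norm \<dots> \<le> 20 * h * exp (- h / 2) * (8 * h) + (5 * h * exp (- h / 2) * (2 * h)
      + (20 * h * exp (- h / 2) * (8 * h) + 5 * h * exp (- h / 2) * (2 * h)))"
    unfolding eq by (intro norm_add_rule_thm n1 n2 l) auto
  finally have "norm (- 4 * pi * \<i> * theta_sum N z) \<le> 20 * h * exp (- h / 2) * (8 * h) + (5 * h * exp (- h / 2) * (2 * h)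
      + (20 * h * exp (- h / 2) * (8 * h) + 5 * h * exp (- h / 2) * (2 * h)))" .
  then have "pi * norm (theta_sum N z) * 4 \<le> 340 * h\<^sup>2 * exp (- h / 2)"
    by (simp add: norm_mult power2_eq_square)
  moreover have "3 * norm (theta_sum N z) \<le> pi * norm (theta_sum N z)"
    using pi_gt3 by (intro mult_right_mono) auto
  moreover have "0 \<le> h\<^sup>2 * exp (- h / 2)" by simp
  ultimately show ?thesis by linarith
qed

text \<open>The finite mode sum with coefficients \<open>(-1)\<^sup>m exp (- \<omega>\<^sup>2 (1 + i) T / 2)\<close> has as its trace, up to a
  constant, the theta sum at \<open>z\<close> with \<open>Re z = T/2\<close> and \<open>Im z = T/2 - t\<close>.  The sum decays like
  \<open>exp (- Re (1/z) / 4)\<close>, and the choice \<open>Re z = T/2\<close> maximizes the least value of \<open>Re (1/z)\<close> over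
  \<open>[0,T]\<close>.  The lowest mode keeps the datum bounded below.  Here \<open>T = 1 / (2 h)\<close>.\<close>

lemma observability_of_theta_sum:
  assumes N: "N \<ge> 1" and est: "observability_estimate \<alpha> C 1 1 (1 / (2 * h))" and C: "C \<ge> 0"
    and h: "h = real N * pi / 4"
  shows "exp (- 2) \<le> C * exp (2 * \<alpha> * h) * (60 * h\<^sup>2 * exp (- h / 2))"
proof -
  define T where "T = 1 / (2 * h)"
  define w where "w m = freq 1 1 m" for m
  define b where "b m = (- 1) ^ m * exp (- (of_real (w m) ^ 2 * (of_real (T / 2) * (1 + \<i>))))" for m
  define z where "z t = Complex (T / 2) (T / 2 - t)" for t
  have "1 * 3 \<le> real N * pi" using N pi_gt3 by (intro mult_mono) auto
  then have h34: "h \<ge> 3 / 4" by (simp add: h)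
  have T: "0 < T" "T \<le> 1" using h34 by (simp_all add: T_def)
  let ?u = "mode_sum 1 1 N b" and ?g = "mode_trace_sum 1 1 N b"
  have k: "(1::nat) \<in> {0, 1}" by simp
  have sol: "schrodinger_solution 1 1 T (?u 0) ?u" by (rule mode_sum_solution) auto
  have tr: "neumann_trace 1 T ?u ?g" by (rule mode_sum_trace) auto
  have "?u 0 \<in> H1k 1 1" using sol by (simp add: schrodinger_solution_def)
  then have E: "H1_norm 1 (?u 0) \<le> C * exp (\<alpha> * 1\<^sup>2 / T) * L2_norm T ?g"
    using est sol tr unfolding observability_estimate_def T_def by blast
  have gt: "?g t = - of_real (sqrt 2) * theta_sum N (z t)" for t
  proof -
    have "b m * w m * cis ((w m)\<^sup>2 * t) = of_real ((- 1) ^ m * w m) * exp (- ((of_real (w m))\<^sup>2 * z t))" for m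
    proof -
      have "- (of_real (w m) ^ 2 * (of_real (T / 2) * (1 + \<i>))) + \<i> * of_real ((w m)\<^sup>2 * t) = - ((of_real (w m))\<^sup>2 * z t)"
        by (simp add: z_def complex_eq_iff power2_eq_square algebra_simps)
      then have "exp (- (of_real (w m) ^ 2 * (of_real (T / 2) * (1 + \<i>)))) * cis ((w m)\<^sup>2 * t) = exp (- ((of_real (w m))\<^sup>2 * z t))"
        unfolding cis_conv_exp exp_add[symmetric] by (rule arg_cong)
      then show ?thesis by (simp add: b_def mult_ac)
    qed
    then have "(\<Sum>m<N. b m * of_real (freq 1 1 m) * cis ((freq 1 1 m)\<^sup>2 * t)) = theta_sum N (z t)"
      unfolding theta_sum_def w_def by (intro sum.cong refl)
    then show ?thesis unfolding mode_trace_sum_def by simp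
  qed
  have "L2_norm T ?g \<le> sqrt T * (60 * h\<^sup>2 * exp (- h / 2))"
  proof (rule L2_norm_bounded)
    show "L2 T ?g" using tr by (simp add: neumann_trace_def)
    fix t assume t: "t \<in> {0..T}"
    have "norm (theta_sum N (z t)) \<le> 30 * (real N * pi / 4)\<^sup>2 * exp (- (real N * pi / 4) / 2)"
    proof (rule norm_theta_sum_le[OF N])
      show "Re (z t) = 1 / (4 * (real N * pi / 4))" by (simp add: z_def T_def h)
      have "\<bar>T / 2 - t\<bar> \<le> T / 2" using t unfolding abs_le_iff by auto
      moreover have "T / 2 = 1 / (4 * (real N * pi / 4))" by (simp add: T_def h)
      ultimately show "\<bar>Im (z t)\<bar> \<le> 1 / (4 * (real N * pi / 4))" by (simp only: z_def complex.sel)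
    qed
    then have th: "norm (theta_sum N (z t)) \<le> 30 * h\<^sup>2 * exp (- h / 2)" by (simp only: h)
    have "sqrt 2 \<le> (2 :: real)" by (rule real_le_lsqrt) auto
    then have "sqrt 2 * norm (theta_sum N (z t)) \<le> 2 * (30 * h\<^sup>2 * exp (- h / 2))"
      by (intro mult_mono th) auto
    moreover have "norm (?g t) = sqrt 2 * norm (theta_sum N (z t))" unfolding gt by (simp add: norm_mult)
    ultimately show "norm (?g t) \<le> 60 * h\<^sup>2 * exp (- h / 2)" by linarith
  qed (use T in auto)
  also have "\<dots> \<le> 1 * (60 * h\<^sup>2 * exp (- h / 2))" using T by (intro mult_right_mono) auto
  finally have g: "L2_norm T ?g \<le> 60 * h\<^sup>2 * exp (- h / 2)" by simp
  have "exp (- 2) \<le> norm (b 0)"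
  proof -
    have "(w 0)\<^sup>2 * (T / 2) \<le> 2"
    proof -
      have "(pi / 2)\<^sup>2 \<le> 2\<^sup>2" using pi_less_4 by (intro power_mono) auto
      then have "(pi / 2)\<^sup>2 * (T / 2) \<le> 2\<^sup>2 * (1 / 2)" using T by (intro mult_mono) auto
      then show ?thesis by (simp add: w_def freq_def)
    qed
    then show ?thesis by (simp add: b_def norm_mult norm_exp_eq_Re power2_eq_square)
  qed
  also have "norm (b 0) = sqrt ((norm (b 0))\<^sup>2)" by simp
  also have "\<dots> \<le> H1_norm 1 (?u 0)"
  proof -
    define W where "W m = (L2_norm 1 (smode 1 1 m))\<^sup>2 + (freq 1 1 m)\<^sup>2 * (L2_norm 1 (cmode 1 1 m))\<^sup>2" for m
    have W0: "W m \<ge> 0" for m by (simp add: W_def)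
    have "L2_norm 1 (smode 1 1 0) = 1" by (simp add: L2_norm_eq_inner mode_inner)
    then have W1: "1 \<le> W 0" by (simp add: W_def)
    have "(norm (b 0))\<^sup>2 * 1 \<le> (norm (b 0))\<^sup>2 * W 0" by (intro mult_left_mono W1) auto
    also have "\<dots> \<le> (\<Sum>m<N. (norm (b m))\<^sup>2 * W m)"
      using N W0 by (intro member_le_sum) auto
    finally have "(norm (b 0))\<^sup>2 \<le> (\<Sum>m<N. (norm (b m))\<^sup>2 * W m)" by simp
    then have "sqrt ((norm (b 0))\<^sup>2) \<le> sqrt (\<Sum>m<N. (norm (b m))\<^sup>2 * W m)" by (rule real_sqrt_le_mono)
    also have "\<dots> = H1_norm 1 (\<lambda>s. \<Sum>m<N. b m * smode 1 1 m s)"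
      unfolding W_def by (rule H1_norm_smode_sum[symmetric]) auto
    also have "(\<lambda>s. \<Sum>m<N. b m * smode 1 1 m s) = ?u 0" by (simp add: mode_sum_def fun_eq_iff)
    finally show ?thesis .
  qed
  also note E
  also have "C * exp (\<alpha> * 1\<^sup>2 / T) * L2_norm T ?g \<le> C * exp (2 * \<alpha> * h) * (60 * h\<^sup>2 * exp (- h / 2))"
    using g C by (intro mult_mono) (auto simp: T_def mult_ac L2_norm_nonneg)
  finally show ?thesis .
qed

text \<open>For \<open>\<alpha> < 1/4\<close> the cost \<open>exp (\<alpha> / T) = exp (2 \<alpha> h)\<close> cannot compensate the factor
  \<open>exp (- h/2)\<close> in the trace as \<open>h\<close> grows.\<close>

lemma observable_beyond_lower:
  assumes "observable_beyond a"
  shows "1 / 4 \<le> a"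
proof (rule ccontr)
  assume "\<not> 1 / 4 \<le> a"
  define \<alpha> where "\<alpha> = (a + 1 / 4) / 2"
  define \<delta> where "\<delta> = 1 / 2 - 2 * \<alpha>"
  have \<alpha>: "a < \<alpha>" and \<delta>: "\<delta> > 0" using \<open>\<not> 1 / 4 \<le> a\<close> by (simp_all add: \<alpha>_def \<delta>_def)
  obtain C where C: "C > 0" and est: "\<And>T. 0 < T \<Longrightarrow> T \<le> (min pi 1)\<^sup>2 \<Longrightarrow> observability_estimate \<alpha> C 1 1 T"
    using assms \<alpha> unfolding observable_beyond_def
    by (metis insertI1 insertI2 order_refl zero_less_one)
  define B where "B = 1620 * C * exp 2 / \<delta> ^ 3"
  obtain n :: nat where n: "B < real n" using reals_Archimedean2 by blast
  define N where "N = Suc (2 * n)"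
  define h where "h = real N * pi / 4"
  have "real N * 3 \<le> real N * pi" using pi_gt3 by (intro mult_left_mono) auto
  then have "3 / 4 * real N \<le> h" by (simp add: h_def)
  then have h: "B < h" "h \<ge> 3 / 4" using n by (simp_all add: N_def)
  have "min pi 1 = 1" using pi_gt3 by simp
  then have "observability_estimate \<alpha> C 1 1 (1 / (2 * h))" using h by (intro est) auto
  then have "exp (- 2) \<le> C * exp (2 * \<alpha> * h) * (60 * h\<^sup>2 * exp (- h / 2))"
    using C by (intro observability_of_theta_sum[of N]) (auto simp: N_def h_def)
  also have "\<dots> = 60 * C * h\<^sup>2 * (exp (2 * \<alpha> * h) * exp (- h / 2))" by (simp add: mult_ac)
  also have "exp (2 * \<alpha> * h) * exp (- h / 2) = exp (- (\<delta> * h))"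
    unfolding exp_add[symmetric] by (rule arg_cong[of _ _ exp]) (simp add: \<delta>_def algebra_simps)
  finally have "exp (- 2) * exp (\<delta> * h) \<le> 60 * C * h\<^sup>2 * exp (- (\<delta> * h)) * exp (\<delta> * h)" by simp
  also have "\<dots> = 60 * C * h\<^sup>2" by (simp flip: exp_add)
  finally have u: "exp (- 2) * exp (\<delta> * h) \<le> 60 * C * h\<^sup>2" .
  have "(\<delta> * h / 3) ^ 3 \<le> (1 + \<delta> * h / real 3) ^ 3" using \<delta> h by (intro power_mono) auto
  also have "\<dots> \<le> exp (\<delta> * h)"
    using mult_pos_pos[OF \<delta>, of h] h by (intro exp_ge_one_plus_x_over_n_power_n) auto
  finally have "exp (- 2) * (\<delta> * h / 3) ^ 3 \<le> 60 * C * h\<^sup>2" using u by (simp add: mult_left_mono order_trans[rotated])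
  then have "exp 2 * (exp (- 2) * (\<delta> * h / 3) ^ 3) \<le> exp 2 * (60 * C * h\<^sup>2)" by (rule mult_left_mono) simp
  moreover have "exp 2 * exp (- 2) = (1 :: real)" by (simp flip: exp_add)
  then have "exp 2 * (exp (- 2) * (\<delta> * h / 3) ^ 3) = (\<delta> * h / 3) ^ 3" by (simp only: mult.assoc[symmetric] mult_1_left)
  ultimately have "(\<delta> * h / 3) ^ 3 \<le> exp 2 * (60 * C * h\<^sup>2)" by simp
  then have "\<delta> ^ 3 * h * h\<^sup>2 \<le> 1620 * C * exp 2 * h\<^sup>2" by (simp add: power_divide power_mult_distrib eval_nat_numeral mult_ac)
  then have "\<delta> ^ 3 * h \<le> 1620 * C * exp 2" using h by simp
  then have "h \<le> B" using \<delta> by (simp add: B_def pos_le_divide_eq mult.commute)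
  then show False using h by simp
qed

section \<open>The optimal rate\<close>

text \<open>The condition on \<open>a\<close> only concerns the exponents \<open>\<alpha> > a\<close>, so it passes to infima: the least
  admissible number exists.\<close>

lemma alpha_star_attained:
  defines "P \<equiv> \<lambda>a. 0 < a \<and> observable_beyond a"
  shows "P alpha_star" "P a \<Longrightarrow> alpha_star \<le> a"
proof -
  define A where "A = Inf {a. P a}"
  have lb: "1 / 4 \<le> a" if "P a" for a using that observable_beyond_lower by (simp add: P_def)
  then have bdd: "bdd_below {a. P a}" by (intro bdd_belowI[of _ "1 / 4"]) auto
  have ne: "{a. P a} \<noteq> {}"
    using observable_beyond_upper by (auto simp: P_def intro!: exI[of _ "4 * (36 / 37)\<^sup>2"])
  have A: "1 / 4 \<le> A" unfolding A_def by (rule cInf_greatest[OF ne]) (use lb in auto)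
  have "observable_beyond A"
    unfolding observable_beyond_def
  proof (intro allI impI)
    fix \<alpha> L0 :: real assume "A < \<alpha>" "0 < L0"
    then obtain a where "P a" "a < \<alpha>"
      using cInf_less_iff[OF ne bdd, of \<alpha>] by (auto simp: A_def)
    then show "\<exists>C>0. \<forall>k\<in>{0, 1}. \<forall>L\<ge>L0. \<forall>T. 0 < T \<and> T \<le> (min pi L)\<^sup>2 \<longrightarrow> observability_estimate \<alpha> C k L T"
      using \<open>0 < L0\<close> unfolding P_def observable_beyond_def by blast
  qed
  then have PA: "P A" using A by (simp add: P_def)
  moreover have le: "A \<le> a" if "P a" for a unfolding A_def by (rule cInf_lower[OF _ bdd]) (use that in simp)
  ultimately have "alpha_star = A"
    unfolding alpha_star_def P_def by (intro Least_equality) auto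
  then show "P alpha_star" "P a \<Longrightarrow> alpha_star \<le> a" using PA le by simp_all
qed

theorem theorem1p2:
  shows "1 / 4 \<le> alpha_star \<and> alpha_star \<le> 4 * (36 / 37)\<^sup>2 \<and> 4 * (36 / 37)\<^sup>2 < (4::real)"
  using alpha_star_attained(1) alpha_star_attained(2)[of "4 * (36 / 37)\<^sup>2"]
    observable_beyond_upper observable_beyond_lower
  by (simp add: power2_eq_square)

end
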